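(* For each $\varepsilon>0$ let $u^\varepsilon$ be the solution of the nonlocal problem (Neumann conditions in the holes) $$u^\varepsilon_t(x,t)=\int_{\mathbb{R}^N\setminus A^\varepsilon}J(x-y)\,u^\varepsilon(y,t)\,dy-h_\varepsilon(x)\,u^\varepsilon(x,t)+g\big(m_{\Omega^\varepsilon}(x,u^\varepsilon(\cdot,t))\big),\qquad x\in\Omega^\varepsilon,\ t\in\mathbb{R},$$ $$u^\varepsilon(x,t)=0\ \text{ for } x\in\mathbb{R}^N\setminus\Omega,\ t\in\mathbb{R},\qquad u^\varepsilon(x,0)=u_0(x)\ \text{ for } x\in\Omega^\varepsilon,\qquad h_\varepsilon(x)=\int_{\mathbb{R}^N\setminus A^\varepsilon}J(x-y)\,dy,$$ where $u_0\in L^2(\Omega)$. Then there exists a function $u^*=u^*(x,t)$, $x\in\mathbb{R}^N$, $t\in\mathbb{R}$, with $u^*(x,t)\equiv 0$ for $x\in\mathbb{R}^N\setminus\Omega$ and $u^*\in C^1([a,b];L^2(\mathbb{R}^N))$ for every closed bounded interval $[a,b]\subset\mathbb{R}$, such that, as $\varepsilon\to0$, $$\tilde u^\varepsilon\rightharpoonup u^*\quad\text{weakly}^*\text{ in }L^\infty([a,b];L^2(\Omega))$$ for every such $[a,b]$, where $\tilde u^\varepsilon$ denotes the extension of $u^\varepsilon$ by zero outside $\Omega^\varepsilon$. Furthermore, $u^*$ satisfies the following nonlocal equation in $\Omega$ (that is, $u=u^*$ satisfies it): $$u_t(x,t)=\mathcal{X}(x)\int_{\mathbb{R}^N}J(x-y)\big(u(y,t)-u(x,t)\big)\,dy+\mathcal{X}(x)\,g\big(m_{\mathcal{X}}(x,u(\cdot,t))\big)-\Lambda(x)\,u(x,t),$$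 with $u(x,t)\equiv0$ for $x\in\mathbb{R}^N\setminus\Omega$ and $u(x,0)=\mathcal{X}(x)\,u_0(x)$, where $\Lambda\in L^\infty(\mathbb{R}^N)$ is given by $$\Lambda(x)=\int_{\mathbb{R}^N}J(x-y)\big(1-\chi_\Omega(y)+\mathcal{X}(y)\big)\,dy-\mathcal{X}(x)$$ and $\chi_\Omega$ is the characteristic function of $\Omega$.
   Context: $\Omega\subset\mathbb{R}^N$ is a fixed bounded open domain, and for each $\varepsilon>0$, $\Omega^\varepsilon\subset\Omega$ is an open set; $A^\varepsilon=\Omega\setminus\Omega^\varepsilon$ (the holes). $\chi_\varepsilon$ is the characteristic function of $\Omega^\varepsilon$. It is assumed that there is $\mathcal{X}\in L^\infty(\mathbb{R}^N)$ with $\mathcal{X}\equiv0$ in $\mathbb{R}^N\setminus\Omega$ such that $\int_\Omega\chi_\varepsilon\varphi\,dx\to\int_\Omega\mathcal{X}\varphi\,dx$ as $\varepsilon\to0$ for all $\varphi\in L^1(\Omega)$, and that there is a constant $c>0$ with $\mathcal{X}(x)\ge c$ for all $x\in\Omega$ (consequently $\mathcal{X}\le1$). The kernel $J\in C(\mathbb{R}^N,\mathbb{R})$ is non-negative with $J(0)>0$, $J(-x)=J(x)$ for every $x$, and $\int_{\mathbb{R}^N}J(x)\,dx=1$. The function $g:\mathbb{R}\to\mathbb{R}$ is smooth and globally Lipschitz. $\delta>0$ is fixed and $B_\delta(x)$ is the ball of radius $\delta$ centered at $x$. The averages are $$m_{\Omega^\varepsilon}(x,u)=\frac{1}{|B_\delta(x)\cap\Omega^\varepsilon|}\int_{B_\delta(x)\cap\Omega^\varepsilon}u(y)\,dy,\quad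 x\in\Omega^\varepsilon,\qquad m_{\mathcal{X}}(x,u)=\frac{1}{\int_{B_\delta(x)}\mathcal{X}(y)\,dy}\int_{B_\delta(x)}u(y)\,dy,\quad x\in\Omega.$$ The solution $u^\varepsilon$ is the unique global one, with $u^\varepsilon\in C^1([a,b];L^2(\Omega^\varepsilon))$ for every bounded interval $[a,b]\subset\mathbb{R}$, the equation being understood in $L^2(\Omega^\varepsilon)$ for each $t$; since $u^\varepsilon$ vanishes outside $\Omega$, the integral over $\mathbb{R}^N\setminus A^\varepsilon$ involves only values of $u^\varepsilon$ on $\Omega^\varepsilon$. The limit equation is understood in $L^2(\Omega)$. *)

theory Defs
  imports "HOL-Analysis.Analysis"
begin

text \<open>
  Elements of the Lebesgue spaces are handled through representatives
  \<open>f :: 'a \<Rightarrow> real\<close> with \<open>'a\<close> the Euclidean space, and curves in \<open>L2 D\<close> through functions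
  \<open>u :: real \<Rightarrow> 'a \<Rightarrow> real\<close>, where \<open>u t x\<close> stands for $u(x,t)$. All notions of convergence
  below depend only on the classes modulo null sets.
\<close>

definition L2 :: "'a::euclidean_space set \<Rightarrow> ('a \<Rightarrow> real) set" where
  "L2 D = {f. f \<in> borel_measurable (lebesgue_on D) \<and> integrable (lebesgue_on D) (\<lambda>x. (f x)\<^sup>2)}"

definition L2_norm :: "'a::euclidean_space set \<Rightarrow> ('a \<Rightarrow> real) \<Rightarrow> real" where
  "L2_norm D f = sqrt (LINT x|lebesgue_on D. (f x)\<^sup>2)"

definition Linf :: "'a::euclidean_space set \<Rightarrow> ('a \<Rightarrow> real) set" where
  "Linf D = {f. f \<in> borel_measurable (lebesgue_on D) \<and> (\<exists>M. AE x in lebesgue_on D. \<bar>f x\<bar> \<le> M)}"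

text \<open>The curve \<open>u : S \<rightarrow> L2 D\<close> is differentiable at \<open>t\<close> in the \<open>L2\<close> norm, with derivative \<open>w\<close>.\<close>

definition has_L2_derivative ::
  "'a::euclidean_space set \<Rightarrow> (real \<Rightarrow> 'a \<Rightarrow> real) \<Rightarrow> ('a \<Rightarrow> real) \<Rightarrow> real \<Rightarrow> real set \<Rightarrow> bool" where
  "has_L2_derivative D u w t S \<longleftrightarrow>
     (\<forall>s\<in>S. u s \<in> L2 D) \<and> w \<in> L2 D \<and>
     ((\<lambda>s. L2_norm D (\<lambda>x. (u s x - u t x) / (s - t) - w x)) \<longlongrightarrow> 0) (at t within S)"

text \<open>$C^1([a,b];L^2(D))$, with one-sided derivatives at the end points.\<close>

definition C1_L2 :: "real \<Rightarrow> real \<Rightarrow> 'a::euclidean_space set \<Rightarrow> (real \<Rightarrow> 'a \<Rightarrow> real) set" where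
  "C1_L2 a b D = {u. \<exists>v.
     (\<forall>t\<in>{a..b}. has_L2_derivative D u (v t) t {a..b}) \<and>
     (\<forall>t\<in>{a..b}. ((\<lambda>s. L2_norm D (\<lambda>x. v s x - v t x)) \<longlongrightarrow> 0) (at t within {a..b}))}"

text \<open>
  Bochner (strong) measurability of a curve \<open>[a,b] \<rightarrow> L2 D\<close>: almost everywhere in \<open>t\<close> it is the
  \<open>L2\<close>-limit of simple functions. The library's Bochner integral does not apply directly, since
  \<open>L2 D\<close> is not a type.
\<close>

definition L2_strongly_measurable ::
  "real \<Rightarrow> real \<Rightarrow> 'a::euclidean_space set \<Rightarrow> (real \<Rightarrow> 'a \<Rightarrow> real) set" where
  "L2_strongly_measurable a b D = {f.
     (\<forall>t\<in>{a..b}. f t \<in> L2 D) \<and>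
     (\<exists>s :: nat \<Rightarrow> real \<Rightarrow> 'a \<Rightarrow> real.
        (\<forall>n. simple_function (lebesgue_on {a..b}) (s n) \<and> (\<forall>t\<in>{a..b}. s n t \<in> L2 D)) \<and>
        (AE t in lebesgue_on {a..b}. (\<lambda>n. L2_norm D (\<lambda>x. s n t x - f t x)) \<longlonglongrightarrow> 0))}"

definition L1_L2 :: "real \<Rightarrow> real \<Rightarrow> 'a::euclidean_space set \<Rightarrow> (real \<Rightarrow> 'a \<Rightarrow> real) set" where
  "L1_L2 a b D = {f \<in> L2_strongly_measurable a b D.
     integrable (lebesgue_on {a..b}) (\<lambda>t. L2_norm D (f t))}"

definition Linf_L2 :: "real \<Rightarrow> real \<Rightarrow> 'a::euclidean_space set \<Rightarrow> (real \<Rightarrow> 'a \<Rightarrow> real) set" where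
  "Linf_L2 a b D = {f \<in> L2_strongly_measurable a b D.
     \<exists>M. AE t in lebesgue_on {a..b}. L2_norm D (f t) \<le> M}"

text \<open>
  Weak* convergence in $L^\infty([a,b];L^2(D))$, regarded as the dual of $L^1([a,b];L^2(D))$
  through the pairing $\int_a^b \int_D u \varphi \, dx \, dt$.
\<close>

definition weak_star_Linf_L2 ::
  "real \<Rightarrow> real \<Rightarrow> 'a::euclidean_space set \<Rightarrow> ('i \<Rightarrow> real \<Rightarrow> 'a \<Rightarrow> real) \<Rightarrow>
     (real \<Rightarrow> 'a \<Rightarrow> real) \<Rightarrow> 'i filter \<Rightarrow> bool" where
  "weak_star_Linf_L2 a b D U u F \<longleftrightarrow>
     (\<forall>\<^sub>F i in F. U i \<in> Linf_L2 a b D) \<and> u \<in> Linf_L2 a b D \<and>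
     (\<forall>\<phi>\<in>L1_L2 a b D.
        ((\<lambda>i. LINT t|lebesgue_on {a..b}. LINT x|lebesgue_on D. U i t x * \<phi> t x)
           \<longlongrightarrow> (LINT t|lebesgue_on {a..b}. LINT x|lebesgue_on D. u t x * \<phi> t x)) F)"

definition smooth :: "(real \<Rightarrow> real) \<Rightarrow> bool" where
  "smooth g \<longleftrightarrow> (\<forall>n. (deriv ^^ n) g differentiable_on UNIV)"

definition mean_on :: "real \<Rightarrow> 'a::euclidean_space set \<Rightarrow> 'a \<Rightarrow> ('a \<Rightarrow> real) \<Rightarrow> real" where
  "mean_on \<delta> E x u = (LINT y:(ball x \<delta> \<inter> E)|lebesgue. u y) / measure lebesgue (ball x \<delta> \<inter> E)"

text \<open>Only the denominator is weighted by \<open>X\<close>; the numerator is the plain integral of \<open>u\<close>.\<close>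

definition mean_weighted ::
  "real \<Rightarrow> ('a::euclidean_space \<Rightarrow> real) \<Rightarrow> 'a \<Rightarrow> ('a \<Rightarrow> real) \<Rightarrow> real" where
  "mean_weighted \<delta> X x u = (LINT y:ball x \<delta>|lebesgue. u y) / (LINT y:ball x \<delta>|lebesgue. X y)"

text \<open>
  In the perforated problem \<open>E\<close> is the perforated domain, so \<open>\<Omega> - E\<close> is the set of holes and
  \<open>- (\<Omega> - E)\<close> its complement in the whole space. Values of \<open>u\<close> on the holes play no role.
\<close>

definition h_coeff ::
  "('a::euclidean_space \<Rightarrow> real) \<Rightarrow> 'a set \<Rightarrow> 'a set \<Rightarrow> 'a \<Rightarrow> real" where
  "h_coeff J \<Omega> E x = (LINT y:- (\<Omega> - E)|lebesgue. J (x - y))"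

definition perforated_solution ::
  "('a::euclidean_space \<Rightarrow> real) \<Rightarrow> (real \<Rightarrow> real) \<Rightarrow> real \<Rightarrow> 'a set \<Rightarrow> 'a set \<Rightarrow>
     ('a \<Rightarrow> real) \<Rightarrow> (real \<Rightarrow> 'a \<Rightarrow> real) \<Rightarrow> bool" where
  "perforated_solution J g \<delta> \<Omega> E u0 u \<longleftrightarrow>
     (\<forall>a b. a < b \<longrightarrow> u \<in> C1_L2 a b E) \<and>
     (\<forall>t. has_L2_derivative E u
            (\<lambda>x. (LINT y:- (\<Omega> - E)|lebesgue. J (x - y) * u t y)
                 - h_coeff J \<Omega> E x * u t x + g (mean_on \<delta> E x (u t))) t UNIV) \<and>
     (\<forall>t. \<forall>x\<in>- \<Omega>. u t x = 0) \<and>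
     (AE x in lebesgue_on E. u 0 x = u0 x)"

definition Lambda_coeff ::
  "('a::euclidean_space \<Rightarrow> real) \<Rightarrow> 'a set \<Rightarrow> ('a \<Rightarrow> real) \<Rightarrow> 'a \<Rightarrow> real" where
  "Lambda_coeff J \<Omega> X x = (LINT y|lebesgue. J (x - y) * (1 - indicator \<Omega> y + X y)) - X x"

definition limit_solution ::
  "('a::euclidean_space \<Rightarrow> real) \<Rightarrow> (real \<Rightarrow> real) \<Rightarrow> real \<Rightarrow> 'a set \<Rightarrow> ('a \<Rightarrow> real) \<Rightarrow>
     ('a \<Rightarrow> real) \<Rightarrow> (real \<Rightarrow> 'a \<Rightarrow> real) \<Rightarrow> bool" where
  "limit_solution J g \<delta> \<Omega> X u0 u \<longleftrightarrow>
     (\<forall>t. has_L2_derivative \<Omega> u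
            (\<lambda>x. X x * (LINT y|lebesgue. J (x - y) * (u t y - u t x))
                 + X x * g (mean_weighted \<delta> X x (u t))
                 - Lambda_coeff J \<Omega> X x * u t x) t UNIV) \<and>
     (\<forall>t. \<forall>x\<in>- \<Omega>. u t x = 0) \<and>
     (AE x in lebesgue_on \<Omega>. u 0 x = X x * u0 x)"

end

theory Submission
  imports Defs
begin

text \<open>
  Extended by zero, the solutions of the perforated problems become curves in the Hilbert space
  $L^2(\mathbb{R}^N)$ that solve ordinary differential equations $U' = F_\theta(U)$ with
  $F_\theta(v) = \theta\,(J * v + g(m_\theta v)) - h_\theta v$ on $\Omega$ and
  $h_\theta(x) = \int J(x-y)(1-\chi_\Omega(y)+\theta(y))\,dy$, where the weight $\theta$ is the
  characteristic function of the perforated domain. Since $\Lambda = h_{\mathcal X} - \mathcal X$,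
  the limit equation has the same form with $\theta = \mathcal X$. So the claim is a statement about
  continuous dependence of the solution on the weight.

  The weights have $\int_{B_\delta(x)}\theta$ bounded below uniformly in $x \in \Omega$ and in small
  $\varepsilon$ (lemma \<open>uniform_ball_mass\<close>), so the fields $F_\theta$ are Lipschitz with a common
  constant (\<open>drift_lipschitz\<close>). The decisive fact is \<open>weakly_tendsto_drift\<close>: if
  $\theta_n \to \mathcal X$ weakly* and $v_n \rightharpoonup v$ in $L^2$, then
  $F_{\theta_n}(v_n) \rightharpoonup F_{\mathcal X}(v)$. Indeed $J * v_n$, the averages of $v_n$ and
  $h_{\theta_n}$ arise by pairing with fixed functions; hence they converge pointwise and boundedly,
  and every product in $F_{\theta_n}(v_n)$ has one weakly and otherwise only strongly convergent factors.

  The nonlinear equation then needs no compactness in time: by induction each Picard iterate of the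
  $n$-th equation converges weakly, for every $t$, to the iterate of the limit equation, and the
  iterates approximate the solutions at a geometric rate that does not depend on $n$
  (\<open>weak_stability_of_solutions\<close>). This gives weak convergence in $L^2$ at each time, and dominated
  convergence in $t$ turns it into weak* convergence in $L^\infty([a,b];L^2(\Omega))$
  (\<open>weak_star_from_pointwise_weak\<close>). The limit is defined beforehand as the solution of the limit
  equation (\<open>lipschitz_ode_solution_exists\<close>), so it suffices to treat sequences
  $\varepsilon_n \to 0$.
\<close>

section \<open>The Hilbert space of square integrable functions\<close>

lemma L2_UNIV_iff:
  "f \<in> L2 UNIV \<longleftrightarrow> f \<in> borel_measurable lebesgue \<and> integrable lebesgue (\<lambda>x. (f x)\<^sup>2)"
  by (simp add: L2_def lebesgue_on_UNIV_eq)

lemma L2_norm_UNIV: "L2_norm UNIV f = sqrt (LINT x|lebesgue. (f x)\<^sup>2)"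
  by (simp add: L2_norm_def lebesgue_on_UNIV_eq)

lemma L2_UNIV_dominated:
  assumes "g \<in> L2 UNIV" "f \<in> borel_measurable lebesgue" "AE x in lebesgue. \<bar>f x\<bar> \<le> C * \<bar>g x\<bar>"
  shows "f \<in> L2 UNIV"
  unfolding L2_UNIV_iff
proof
  have "integrable lebesgue (\<lambda>x. C\<^sup>2 * (g x)\<^sup>2)"
    using assms(1) by (simp add: L2_UNIV_iff)
  then show "integrable lebesgue (\<lambda>x. (f x)\<^sup>2)"
  proof (rule Bochner_Integration.integrable_bound)
    show "(\<lambda>x. (f x)\<^sup>2) \<in> borel_measurable lebesgue" using assms(2) by measurable
    show "AE x in lebesgue. norm ((f x)\<^sup>2) \<le> norm (C\<^sup>2 * (g x)\<^sup>2)"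
      using assms(3)
    proof eventually_elim
      case (elim x)
      then have "\<bar>f x\<bar>\<^sup>2 \<le> (C * \<bar>g x\<bar>)\<^sup>2" by (intro power_mono) auto
      then show ?case by (simp add: power_mult_distrib)
    qed
  qed
qed (fact assms(2))

lemma L2_UNIV_mult_integrable:
  assumes "f \<in> L2 UNIV" "g \<in> L2 UNIV"
  shows "integrable lebesgue (\<lambda>x. f x * g x)"
proof (rule Bochner_Integration.integrable_bound)
  show "integrable lebesgue (\<lambda>x. (f x)\<^sup>2 + (g x)\<^sup>2)"
    using assms by (auto simp: L2_UNIV_iff)
  show "(\<lambda>x. f x * g x) \<in> borel_measurable lebesgue"
    using assms by (auto simp: L2_UNIV_iff)
  have "\<bar>a * b\<bar> \<le> a\<^sup>2 + b\<^sup>2" for a b :: real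
    using sum_squares_bound[of "\<bar>a\<bar>" "\<bar>b\<bar>"] abs_ge_zero[of "a * b"]
    unfolding abs_mult power2_abs by linarith
  then show "AE x in lebesgue. norm (f x * g x) \<le> norm ((f x)\<^sup>2 + (g x)\<^sup>2)" by auto
qed

lemma L2_UNIV_add:
  assumes "f \<in> L2 UNIV" "g \<in> L2 UNIV"
  shows "(\<lambda>x. f x + g x) \<in> L2 UNIV"
  using assms L2_UNIV_mult_integrable[OF assms]
  by (auto simp: L2_UNIV_iff power2_sum mult.assoc)

lemma L2_UNIV_scale: "f \<in> L2 UNIV \<Longrightarrow> (\<lambda>x. c * f x) \<in> L2 UNIV"
  by (auto simp: L2_UNIV_iff power_mult_distrib)

lemma L2_UNIV_diff:
  assumes "f \<in> L2 UNIV" "g \<in> L2 UNIV"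
  shows "(\<lambda>x. f x - g x) \<in> L2 UNIV"
  using L2_UNIV_add[OF assms(1) L2_UNIV_scale[OF assms(2), of "-1"]] by simp

lemma L2_UNIV_zero: "(\<lambda>x. 0) \<in> L2 UNIV"
  by (simp add: L2_UNIV_iff)

text \<open>The space of square integrable functions on the whole space modulo null sets. It is a type, so that
  the calculus of Banach space valued functions applies; functions on a set \<open>D\<close> are represented by
  their extensions by zero.\<close>

quotient_type (overloaded) 'a l2 = "'a::euclidean_space \<Rightarrow> real" /
  partial: "\<lambda>f g. f \<in> L2 UNIV \<and> g \<in> L2 UNIV \<and> (AE x in lebesgue. f x = g x)"
proof (rule part_equivpI)
  show "\<exists>f::'a \<Rightarrow> real. f \<in> L2 UNIV \<and> f \<in> L2 UNIV \<and> (AE x in lebesgue. f x = f x)"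
    using L2_UNIV_zero by auto
  show "symp (\<lambda>f g::'a \<Rightarrow> real. f \<in> L2 UNIV \<and> g \<in> L2 UNIV \<and> (AE x in lebesgue. f x = g x))"
    by (auto intro!: sympI simp: eq_commute)
  show "transp (\<lambda>f g::'a \<Rightarrow> real. f \<in> L2 UNIV \<and> g \<in> L2 UNIV \<and> (AE x in lebesgue. f x = g x))"
    by (rule transpI) (auto elim: AE_mp)
qed

lemma rep_l2_L2 [simp]: "rep_l2 v \<in> L2 UNIV"
  using Quotient3_rep_reflp[OF Quotient3_l2] by blast

lemma abs_rep_l2 [simp]: "abs_l2 (rep_l2 v) = v"
  by (rule Quotient3_abs_rep[OF Quotient3_l2])

lemma abs_l2_eq_iff:
  "f \<in> L2 UNIV \<Longrightarrow> g \<in> L2 UNIV \<Longrightarrow> abs_l2 f = abs_l2 g \<longleftrightarrow> (AE x in lebesgue. f x = g x)"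
  using Quotient3_rel[OF Quotient3_l2, of f g] by auto

lemma rep_abs_l2: "f \<in> L2 UNIV \<Longrightarrow> AE x in lebesgue. rep_l2 (abs_l2 f) x = f x"
  using abs_l2_eq_iff[of "rep_l2 (abs_l2 f)" f] by simp

lemma rep_l2_measurable [measurable, simp]: "rep_l2 v \<in> borel_measurable lebesgue"
  using rep_l2_L2[of v] by (simp add: L2_UNIV_iff del: rep_l2_L2)

lemma l2_eqI: "(AE x in lebesgue. rep_l2 v x = rep_l2 w x) \<Longrightarrow> v = w"
  using abs_l2_eq_iff[of "rep_l2 v" "rep_l2 w"] by simp

instantiation l2 :: (euclidean_space) real_vector
begin

definition zero_l2 :: "'a l2" where
  "zero_l2 = abs_l2 (\<lambda>x. 0)"
definition plus_l2 :: "'a l2 \<Rightarrow> 'a l2 \<Rightarrow> 'a l2" where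
  "plus_l2 v w = abs_l2 (\<lambda>x. rep_l2 v x + rep_l2 w x)"
definition minus_l2 :: "'a l2 \<Rightarrow> 'a l2 \<Rightarrow> 'a l2" where
  "minus_l2 v w = abs_l2 (\<lambda>x. rep_l2 v x - rep_l2 w x)"
definition uminus_l2 :: "'a l2 \<Rightarrow> 'a l2" where
  "uminus_l2 v = abs_l2 (\<lambda>x. - 1 * rep_l2 v x)"
definition scaleR_l2 :: "real \<Rightarrow> 'a l2 \<Rightarrow> 'a l2" where
  "scaleR_l2 c v = abs_l2 (\<lambda>x. c * rep_l2 v x)"
lemma rep_l2_zero: "AE x in lebesgue. rep_l2 0 x = 0"
  unfolding zero_l2_def by (rule rep_abs_l2) (rule L2_UNIV_zero)

lemma rep_l2_add: "AE x in lebesgue. rep_l2 (v + w) x = rep_l2 v x + rep_l2 w x"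
  unfolding plus_l2_def by (rule rep_abs_l2) (simp add: L2_UNIV_add)

lemma rep_l2_diff: "AE x in lebesgue. rep_l2 (v - w) x = rep_l2 v x - rep_l2 w x"
  unfolding minus_l2_def by (rule rep_abs_l2) (simp add: L2_UNIV_diff)

lemma rep_l2_uminus: "AE x in lebesgue. rep_l2 (- v) x = - 1 * rep_l2 v x"
  unfolding uminus_l2_def by (rule rep_abs_l2) (rule L2_UNIV_scale, simp)

lemma rep_l2_scaleR: "AE x in lebesgue. rep_l2 (c *\<^sub>R v) x = c * rep_l2 v x"
  unfolding scaleR_l2_def by (rule rep_abs_l2) (rule L2_UNIV_scale, simp)

instance
proof
  fix u v w :: "'a l2" and a b :: real
  show "u + v + w = u + (v + w)"
    apply (rule l2_eqI)
    using rep_l2_add[of "u + v" w] rep_l2_add[of u v] rep_l2_add[of u "v + w"] rep_l2_add[of v w]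
    by eventually_elim simp
  show "u + v = v + u"
    apply (rule l2_eqI)
    using rep_l2_add[of u v] rep_l2_add[of v u] by eventually_elim simp
  show "0 + u = u"
    apply (rule l2_eqI)
    using rep_l2_add[of 0 u] rep_l2_zero by eventually_elim simp
  show "- u + u = 0"
    apply (rule l2_eqI)
    using rep_l2_add[of "- u" u] rep_l2_zero rep_l2_uminus[of u] by eventually_elim simp
  show "u - v = u + - v"
    apply (rule l2_eqI)
    using rep_l2_add[of "u" "- v"] rep_l2_diff[of u v] rep_l2_uminus[of v] by eventually_elim simp
  show "a *\<^sub>R (u + v) = a *\<^sub>R u + a *\<^sub>R v"
    apply (rule l2_eqI)
    using rep_l2_scaleR[of a "u + v"] rep_l2_add[of u v] rep_l2_scaleR[of a u] rep_l2_scaleR[of a v]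
      rep_l2_add[of "a *\<^sub>R u" "a *\<^sub>R v"] by eventually_elim (simp add: algebra_simps)
  show "(a + b) *\<^sub>R u = a *\<^sub>R u + b *\<^sub>R u"
    apply (rule l2_eqI)
    using rep_l2_scaleR[of "a + b" u] rep_l2_scaleR[of a u] rep_l2_scaleR[of b u]
      rep_l2_add[of "a *\<^sub>R u" "b *\<^sub>R u"] by eventually_elim (simp add: algebra_simps)
  show "a *\<^sub>R b *\<^sub>R u = (a * b) *\<^sub>R u"
    apply (rule l2_eqI)
    using rep_l2_scaleR[of a "b *\<^sub>R u"] rep_l2_scaleR[of b u] rep_l2_scaleR[of "a * b" u]
    by eventually_elim simp
  show "1 *\<^sub>R u = u"
    apply (rule l2_eqI)
    using rep_l2_scaleR[of 1 u] by eventually_elim simp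
qed

end

instantiation l2 :: (euclidean_space) real_inner
begin

definition inner_l2 :: "'a l2 \<Rightarrow> 'a l2 \<Rightarrow> real" where
  "inner_l2 v w = (LINT x|lebesgue. rep_l2 v x * rep_l2 w x)"
definition norm_l2 :: "'a l2 \<Rightarrow> real" where
  "norm_l2 v = sqrt (inner v v)"
definition sgn_l2 :: "'a l2 \<Rightarrow> 'a l2" where
  "sgn_l2 v = v /\<^sub>R norm v"
definition dist_l2 :: "'a l2 \<Rightarrow> 'a l2 \<Rightarrow> real" where
  "dist_l2 v w = norm (v - w)"
definition uniformity_l2 :: "('a l2 \<times> 'a l2) filter" where
  "uniformity_l2 = (INF e\<in>{0<..}. principal {(x, y). dist x y < e})"
definition open_l2 :: "'a l2 set \<Rightarrow> bool" where
  "open_l2 U \<longleftrightarrow> (\<forall>x\<in>U. \<forall>\<^sub>F (x', y) in uniformity. x' = x \<longrightarrow> y \<in> U)"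

instance
proof
  fix u v w :: "'a l2" and a b :: real
  show "dist u v = norm (u - v)" by (rule dist_l2_def)
  show "sgn u = u /\<^sub>R norm u" by (rule sgn_l2_def)
  show "uniformity = (INF e\<in>{0<..}. principal {(x::'a l2, y). dist x y < e})"
    by (rule uniformity_l2_def)
  show "open U \<longleftrightarrow> (\<forall>x\<in>U. \<forall>\<^sub>F (x', y) in uniformity. x' = x \<longrightarrow> y \<in> U)" for U :: "'a l2 set"
    by (rule open_l2_def)
  show "norm u = sqrt (inner u u)" by (rule norm_l2_def)
  show "inner u v = inner v u" by (simp add: inner_l2_def mult.commute)
  show "inner (u + v) w = inner u w + inner v w"
  proof -
    have "inner (u + v) w = (LINT x|lebesgue. rep_l2 u x * rep_l2 w x + rep_l2 v x * rep_l2 w x)"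
      unfolding inner_l2_def
      by (rule integral_cong_AE, measurable) (use rep_l2_add[of u v] in \<open>auto simp: algebra_simps\<close>)
    also have "\<dots> = inner u w + inner v w"
      unfolding inner_l2_def by (intro Bochner_Integration.integral_add L2_UNIV_mult_integrable) simp_all
    finally show ?thesis .
  qed
  show "inner (a *\<^sub>R u) v = a * inner u v"
  proof -
    have "inner (a *\<^sub>R u) v = (LINT x|lebesgue. a * (rep_l2 u x * rep_l2 v x))"
      unfolding inner_l2_def
      by (rule integral_cong_AE, measurable) (use rep_l2_scaleR[of a u] in \<open>auto simp: algebra_simps\<close>)
    then show ?thesis by (simp add: inner_l2_def)
  qed
  show "0 \<le> inner u u" by (simp add: inner_l2_def)
  show "inner u u = 0 \<longleftrightarrow> u = 0"
  proof -
    have "inner u u = 0 \<longleftrightarrow> (AE x in lebesgue. rep_l2 u x * rep_l2 u x = 0)"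
      unfolding inner_l2_def by (intro integral_nonneg_eq_0_iff_AE L2_UNIV_mult_integrable) simp_all
    also have "\<dots> \<longleftrightarrow> (AE x in lebesgue. rep_l2 u x = rep_l2 0 x)"
      by (rule eventually_cong[OF rep_l2_zero]) auto
    also have "\<dots> \<longleftrightarrow> u = 0" using l2_eqI[of u 0] by auto
    finally show ?thesis .
  qed
qed

end

lemma inner_abs_l2:
  assumes "f \<in> L2 UNIV" "g \<in> L2 UNIV"
  shows "inner (abs_l2 f) (abs_l2 g) = (LINT x|lebesgue. f x * g x)"
  unfolding inner_l2_def
  apply (rule integral_cong_AE)
    apply measurable
  using assms rep_abs_l2[OF assms(1)] rep_abs_l2[OF assms(2)] by (auto simp: L2_UNIV_iff)

lemma norm_abs_l2: "f \<in> L2 UNIV \<Longrightarrow> norm (abs_l2 f) = L2_norm UNIV f"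
  by (simp add: norm_l2_def inner_abs_l2 L2_norm_UNIV power2_eq_square)

lemma norm_l2_eq: "norm v = L2_norm UNIV (rep_l2 v)"
  using norm_abs_l2[of "rep_l2 v"] by simp

lemma abs_l2_diff:
  assumes "f \<in> L2 UNIV" "g \<in> L2 UNIV"
  shows "abs_l2 f - abs_l2 g = abs_l2 (\<lambda>x. f x - g x)"
  unfolding minus_l2_def
  apply (subst abs_l2_eq_iff)
  using assms rep_abs_l2[OF assms(1)] rep_abs_l2[OF assms(2)] by (auto simp: L2_UNIV_diff)

lemma abs_l2_add:
  assumes "f \<in> L2 UNIV" "g \<in> L2 UNIV"
  shows "abs_l2 f + abs_l2 g = abs_l2 (\<lambda>x. f x + g x)"
  unfolding plus_l2_def
  apply (subst abs_l2_eq_iff)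
  using assms rep_abs_l2[OF assms(1)] rep_abs_l2[OF assms(2)] by (auto simp: L2_UNIV_add)

lemma abs_l2_scaleR:
  assumes "f \<in> L2 UNIV"
  shows "c *\<^sub>R abs_l2 f = abs_l2 (\<lambda>x. c * f x)"
  unfolding scaleR_l2_def
  apply (subst abs_l2_eq_iff)
  using assms rep_abs_l2[OF assms(1)] by (auto simp: L2_UNIV_scale)

lemma norm_l2_dominated:
  assumes "f \<in> borel_measurable lebesgue" "AE x in lebesgue. \<bar>f x\<bar> \<le> C * \<bar>rep_l2 v x\<bar>" "C \<ge> 0"
  shows "norm (abs_l2 f) \<le> C * norm v"
proof -
  have f: "f \<in> L2 UNIV" using L2_UNIV_dominated[OF _ assms(1,2)] by simp
  have "(norm (abs_l2 f))\<^sup>2 = (LINT x|lebesgue. (f x)\<^sup>2)"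
    by (simp add: norm_abs_l2[OF f] L2_norm_UNIV)
  also have "\<dots> \<le> (LINT x|lebesgue. C\<^sup>2 * (rep_l2 v x)\<^sup>2)"
  proof (rule integral_mono_AE)
    show "AE x in lebesgue. (f x)\<^sup>2 \<le> C\<^sup>2 * (rep_l2 v x)\<^sup>2"
      using assms(2)
    proof eventually_elim
      case (elim x)
      then have "\<bar>f x\<bar>\<^sup>2 \<le> (C * \<bar>rep_l2 v x\<bar>)\<^sup>2" by (intro power_mono) auto
      then show ?case by (simp add: power_mult_distrib)
    qed
  qed (use f rep_l2_L2[of v] in \<open>auto simp: L2_UNIV_iff simp del: rep_l2_L2\<close>)
  also have "\<dots> = (C * norm v)\<^sup>2"
    by (simp add: norm_l2_eq L2_norm_UNIV power_mult_distrib)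
  finally show ?thesis using assms(3) by (auto dest: power2_le_imp_le)
qed

text \<open>Riesz--Fischer for rapidly convergent sequences, with representatives \<open>r k\<close> of \<open>f k\<close>.
  The weighted sum of squares \<open>\<Sum>k. 2 ^ k * (r (Suc k) x - r k x)\<^sup>2\<close> has finite integral; where it is
  finite, the representatives converge by the inequality \<open>\<bar>a\<bar> \<le> 1 / e + e * a\<^sup>2\<close> with \<open>e = 2 ^ k\<close>,
  and Fatou's lemma bounds the distance to the pointwise limit.\<close>
lemma l2_fast_Cauchy_convergent:
  fixes f :: "nat \<Rightarrow> 'a::euclidean_space l2"
  assumes fast: "\<And>m n. m \<le> n \<Longrightarrow> norm (f n - f m) \<le> (1/2) ^ m"
  shows "convergent f"
proof -
  define r where "r k = rep_l2 (f k)" for k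
  have r [measurable]: "r k \<in> borel_measurable lebesgue" for k by (simp add: r_def)
  define d where "d k x = 2 ^ k * (r (Suc k) x - r k x)\<^sup>2" for k x
  have dL2: "(\<lambda>x. r n x - r m x) \<in> L2 UNIV" for m n by (simp add: r_def L2_UNIV_diff)
  have nrm: "(\<integral>\<^sup>+ x. ennreal ((r n x - r m x)\<^sup>2) \<partial>lebesgue) = ennreal ((norm (f n - f m))\<^sup>2)" for m n
  proof -
    have "norm (f n - f m) = L2_norm UNIV (\<lambda>x. r n x - r m x)"
      using abs_l2_diff[of "r n" "r m"] norm_abs_l2[OF dL2, of n m] by (simp add: r_def)
    then have "(norm (f n - f m))\<^sup>2 = (LINT x|lebesgue. (r n x - r m x)\<^sup>2)"
      by (simp add: L2_norm_UNIV)
    then show ?thesis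
      using dL2[of n m] by (simp add: nn_integral_eq_integral L2_UNIV_iff)
  qed
  have "(\<integral>\<^sup>+ x. (\<Sum>k. ennreal (d k x)) \<partial>lebesgue) = (\<Sum>k. \<integral>\<^sup>+ x. ennreal (d k x) \<partial>lebesgue)"
    by (rule nn_integral_suminf) (simp add: d_def)
  also have "\<dots> \<le> (\<Sum>k. ennreal ((1/2) ^ k))"
  proof (rule suminf_le)
    fix k
    have "(\<integral>\<^sup>+ x. ennreal (d k x) \<partial>lebesgue) = ennreal (2 ^ k) * ennreal ((norm (f (Suc k) - f k))\<^sup>2)"
      by (simp add: d_def ennreal_mult nn_integral_cmult nrm flip: nrm)
    also have "\<dots> = ennreal (2 ^ k * (norm (f (Suc k) - f k))\<^sup>2)"
      by (simp add: ennreal_mult)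
    also have "\<dots> \<le> ennreal ((1/2) ^ k)"
    proof (rule ennreal_leI)
      have "(norm (f (Suc k) - f k))\<^sup>2 \<le> ((1/2) ^ k)\<^sup>2"
        by (intro power_mono fast) auto
      then have "2 ^ k * (norm (f (Suc k) - f k))\<^sup>2 \<le> 2 ^ k * ((1/2) ^ k)\<^sup>2" by simp
      also have "\<dots> = (1/2::real) ^ k"
        by (simp add: power2_eq_square power_one_over field_simps)
      finally show "2 ^ k * (norm (f (Suc k) - f k))\<^sup>2 \<le> (1/2) ^ k" .
    qed
    finally show "(\<integral>\<^sup>+ x. ennreal (d k x) \<partial>lebesgue) \<le> ennreal ((1/2) ^ k)" .
  qed auto
  also have "\<dots> = ennreal (\<Sum>k. (1/2) ^ k)"
    by (intro suminf_ennreal_eq) (auto intro!: summable_sums)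
  finally have "(\<integral>\<^sup>+ x. (\<Sum>k. ennreal (d k x)) \<partial>lebesgue) < \<infinity>"
    using ennreal_less_top le_less_trans by fastforce
  then have "AE x in lebesgue. (\<Sum>k. ennreal (d k x)) \<noteq> \<infinity>"
    by (intro nn_integral_PInf_AE) (auto simp: d_def)
  then have conv: "AE x in lebesgue. convergent (\<lambda>k. r k x)"
  proof eventually_elim
    case (elim x)
    have sd: "summable (\<lambda>k. d k x)"
      using elim by (intro summable_suminf_not_top) (auto simp: d_def)
    have "summable (\<lambda>k. r (Suc k) x - r k x)"
    proof (rule summable_comparison_test')
      show "summable (\<lambda>k. (1/2) ^ k + d k x)" using sd by (intro summable_add) auto
      fix k :: nat
      have *: "\<bar>a\<bar> \<le> 1 / e + e * a\<^sup>2" if "e > 0" for a e :: real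
      proof -
        have "0 \<le> (e * \<bar>a\<bar> - 1)\<^sup>2 / e" using that by simp
        also have "\<dots> = e * a\<^sup>2 - 2 * \<bar>a\<bar> + 1 / e"
          using that by (simp add: power2_diff power_mult_distrib field_simps power2_eq_square)
        finally show ?thesis by simp
      qed
      show "norm (r (Suc k) x - r k x) \<le> (1/2) ^ k + d k x"
        using *[of "2 ^ k" "r (Suc k) x - r k x"] by (simp add: d_def power_one_over)
    qed
    then have "summable (\<lambda>k. (\<lambda>k. r k x) (Suc k) - (\<lambda>k. r k x) k)" by simp
    then have "(\<lambda>n. \<Sum>k<n. r (Suc k) x - r k x) \<longlonglongrightarrow> (\<Sum>k. r (Suc k) x - r k x)"
      by (simp add: summable_LIMSEQ)
    then have "(\<lambda>n. r n x - r 0 x) \<longlonglongrightarrow> (\<Sum>k. r (Suc k) x - r k x)"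
      using sum_lessThan_telescope[of "\<lambda>k. r k x"] by simp
    then have "(\<lambda>n. (r n x - r 0 x) + r 0 x) \<longlonglongrightarrow> (\<Sum>k. r (Suc k) x - r k x) + r 0 x"
      by (intro tendsto_intros)
    then show ?case by (auto simp: convergent_def)
  qed
  define l where "l x = lim (\<lambda>k. r k x)" for x
  have l [measurable]: "l \<in> borel_measurable lebesgue"
    unfolding l_def by measurable
  have lim: "AE x in lebesgue. (\<lambda>k. r k x) \<longlonglongrightarrow> l x"
    using conv by eventually_elim (simp add: l_def convergent_LIMSEQ_iff)
  have fatou: "(\<integral>\<^sup>+ x. ennreal ((l x - r m x)\<^sup>2) \<partial>lebesgue) \<le> ennreal (((1/2) ^ m)\<^sup>2)" for m
  proof -
    have "(\<integral>\<^sup>+ x. ennreal ((l x - r m x)\<^sup>2) \<partial>lebesgue)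
        = (\<integral>\<^sup>+ x. liminf (\<lambda>n. ennreal ((r n x - r m x)\<^sup>2)) \<partial>lebesgue)"
    proof (rule nn_integral_cong_AE)
      show "AE x in lebesgue. ennreal ((l x - r m x)\<^sup>2) = liminf (\<lambda>n. ennreal ((r n x - r m x)\<^sup>2))"
        using lim
      proof eventually_elim
        case (elim x)
        have "(\<lambda>n. ennreal ((r n x - r m x)\<^sup>2)) \<longlonglongrightarrow> ennreal ((l x - r m x)\<^sup>2)"
          by (intro tendsto_ennrealI tendsto_intros elim)
        from lim_imp_Liminf[OF trivial_limit_sequentially this] show ?case by simp
      qed
    qed
    also have "\<dots> \<le> liminf (\<lambda>n. \<integral>\<^sup>+ x. ennreal ((r n x - r m x)\<^sup>2) \<partial>lebesgue)"
      by (rule nn_integral_liminf) simp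
    also have "\<dots> \<le> liminf (\<lambda>n. ennreal (((1/2) ^ m)\<^sup>2))"
    proof (rule Liminf_mono)
      show "\<forall>\<^sub>F n in sequentially. (\<integral>\<^sup>+ x. ennreal ((r n x - r m x)\<^sup>2) \<partial>lebesgue) \<le> ennreal (((1/2) ^ m)\<^sup>2)"
        using eventually_ge_at_top[of m]
        by eventually_elim (auto simp: nrm intro!: ennreal_leI power_mono fast)
    qed
    finally show ?thesis by (simp add: Liminf_const)
  qed
  have dl: "(\<lambda>x. l x - r m x) \<in> L2 UNIV" for m
  proof -
    have "integrable lebesgue (\<lambda>x. (l x - r m x)\<^sup>2)"
      using fatou[of m] by (intro integrableI_bounded) (auto simp: le_less_trans)
    then show ?thesis by (simp add: L2_UNIV_iff)
  qed
  have lL2: "l \<in> L2 UNIV" using L2_UNIV_add[OF dl[of 0], of "r 0"] by (simp add: r_def)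
  have "norm (f m - abs_l2 l) \<le> (1/2) ^ m" for m
  proof -
    have "abs_l2 l - f m = abs_l2 (\<lambda>x. l x - r m x)"
      using abs_l2_diff[OF lL2, of "r m"] by (simp add: r_def)
    then have "norm (f m - abs_l2 l) = L2_norm UNIV (\<lambda>x. l x - r m x)"
      using norm_abs_l2[OF dl, of m] by (simp add: norm_minus_commute)
    also have "\<dots> \<le> sqrt (((1/2) ^ m)\<^sup>2)"
      unfolding L2_norm_UNIV
      using fatou[of m] dl[of m]
      by (intro real_sqrt_le_mono) (simp add: nn_integral_eq_integral L2_UNIV_iff)
    finally show ?thesis by simp
  qed
  then have "(\<lambda>m. norm (f m - abs_l2 l)) \<longlonglongrightarrow> 0"
    by (intro tendsto_sandwich[OF _ _ tendsto_const LIMSEQ_power_zero[of "1/2::real"]]) auto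
  then have "f \<longlonglongrightarrow> abs_l2 l" by (simp add: tendsto_norm_zero_iff LIM_zero_iff)
  then show ?thesis by (auto simp: convergent_def)
qed

instance l2 :: (euclidean_space) banach
proof
  fix f :: "nat \<Rightarrow> 'a l2" assume C: "Cauchy f"
  have "\<exists>N. \<forall>m\<ge>N. \<forall>n\<ge>N. norm (f m - f n) < (1/2) ^ k" for k
    using C by (simp add: Cauchy_iff)
  then obtain N where N: "\<And>k m n. m \<ge> N k \<Longrightarrow> n \<ge> N k \<Longrightarrow> norm (f m - f n) < (1/2) ^ k" by metis
  define s where "s k = (\<Sum>i\<le>k. Suc (N i))" for k
  have s: "strict_mono s" by (auto simp: strict_mono_Suc_iff s_def)
  have sN: "N k \<le> s k" for k
    using member_le_sum[of k "{..k}" "\<lambda>i. Suc (N i)"] by (simp add: s_def)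
  have "convergent (f \<circ> s)"
  proof (rule l2_fast_Cauchy_convergent)
    fix m n :: nat assume "m \<le> n"
    then have "s m \<le> s n" using s by (simp add: strict_mono_less_eq)
    then show "norm ((f \<circ> s) n - (f \<circ> s) m) \<le> (1/2) ^ m"
      using N[of m "s n" "s m"] sN[of m] by simp
  qed
  then show "convergent f"
    using C s by (auto simp: convergent_def intro: Cauchy_converges_subseq)
qed

lemma L2_UNIV_mult_bounded:
  assumes "f \<in> L2 UNIV" "m \<in> borel_measurable lebesgue" "AE x in lebesgue. \<bar>m x\<bar> \<le> C"
  shows "(\<lambda>x. m x * f x) \<in> L2 UNIV"
proof (rule L2_UNIV_dominated[OF assms(1)])
  show "(\<lambda>x. m x * f x) \<in> borel_measurable lebesgue" using assms by (auto simp: L2_UNIV_iff)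
  show "AE x in lebesgue. \<bar>m x * f x\<bar> \<le> C * \<bar>f x\<bar>"
    using assms(3) by eventually_elim (auto simp: abs_mult intro!: mult_right_mono)
qed

lemma L2_UNIV_cut:
  assumes "D \<in> sets lebesgue" "f \<in> L2 UNIV"
  shows "(\<lambda>x. indicator D x * f x) \<in> L2 UNIV"
  using assms by (intro L2_UNIV_mult_bounded[where C=1]) (auto simp: indicator_def)

lemma L2_UNIV_indicator:
  assumes "D \<in> lmeasurable"
  shows "indicator D \<in> L2 UNIV"
proof -
  have "(\<lambda>x. (indicator D x)\<^sup>2) = (indicator D :: 'a \<Rightarrow> real)" by (auto simp: indicator_def)
  then show ?thesis
    using assms by (auto simp: L2_UNIV_iff fmeasurable_def lmeasurable_iff_integrable)
qed

section \<open>Lipschitz differential equations and weak convergence\<close>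

text \<open>The primitive of \<open>f\<close> that vanishes at \<open>0\<close>, also for negative arguments.\<close>
definition antideriv :: "(real \<Rightarrow> 'h::banach) \<Rightarrow> real \<Rightarrow> 'h" where
  "antideriv f t = (if t \<ge> 0 then integral {0..t} f else - integral {t..0} f)"

lemma antideriv_0 [simp]: "antideriv f 0 = 0"
  by (simp add: antideriv_def)

lemma antideriv_has_vector_derivative:
  assumes f: "continuous_on UNIV f"
  shows "(antideriv f has_vector_derivative f t) (at t)"
proof -
  define R where "R = \<bar>t\<bar> + 1"
  have int: "f integrable_on {a..b}" for a b
    by (intro integrable_continuous_real continuous_on_subset[OF f]) auto
  have eq: "integral {-R..s} f - integral {-R..0} f = antideriv f s" if "s \<in> {-R<..<R}" for s
  proof (cases "s \<ge> 0")
    case True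
    then show ?thesis
      using Henstock_Kurzweil_Integration.integral_combine[of "-R" 0 s f] int that
      by (simp add: antideriv_def R_def algebra_simps)
  next
    case False
    then show ?thesis
      using Henstock_Kurzweil_Integration.integral_combine[of "-R" s 0 f] int that
      by (simp add: antideriv_def R_def algebra_simps)
  qed
  have t: "-R < t" "t < R" by (auto simp: R_def)
  have "((\<lambda>s. integral {-R..s} f) has_vector_derivative f t) (at t within {-R..R})"
    using t by (intro integral_has_vector_derivative continuous_on_subset[OF f]) auto
  then have "((\<lambda>s. integral {-R..s} f) has_vector_derivative f t) (at t)"
    using t by (simp add: at_within_Icc_at)
  then have "((\<lambda>s. integral {-R..s} f - integral {-R..0} f) has_vector_derivative f t - 0) (at t)"
    by (intro has_vector_derivative_diff has_vector_derivative_const)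
  then have d: "((\<lambda>s. integral {-R..s} f - integral {-R..0} f) has_vector_derivative f t) (at t)"
    by simp
  show ?thesis
    by (rule has_vector_derivative_transform_within_open[OF d, of "{-R<..<R}"]) (use t eq in auto)
qed

text \<open>These bounds replace Gronwall's inequality: in the norm with weight \<open>exp (\<kappa> * \<bar>t\<bar>)\<close>,
  integration from \<open>0\<close> shrinks by the factor \<open>1 / \<kappa>\<close>.\<close>
lemma norm_growth_bound_pos:
  fixes D :: "real \<Rightarrow> 'h::real_normed_vector"
  assumes D: "\<And>s. 0 \<le> s \<Longrightarrow> s \<le> t \<Longrightarrow> (D has_vector_derivative D' s) (at s)"
    and D0: "D 0 = 0" and "\<kappa> > 0" "C \<ge> 0" "t \<ge> 0"
    and bnd: "\<And>s. 0 \<le> s \<Longrightarrow> s \<le> t \<Longrightarrow> norm (D' s) \<le> C * exp (\<kappa> * s)"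
  shows "norm (D t) \<le> C / \<kappa> * exp (\<kappa> * t)"
proof (cases "t = 0")
  case True
  then show ?thesis using assms by simp
next
  case False
  have "norm (D t - D 0) \<le> C / \<kappa> * exp (\<kappa> * t) - C / \<kappa> * exp (\<kappa> * 0)"
  proof (rule differentiable_bound_general[where f' = D' and \<phi>' = "\<lambda>s. C * exp (\<kappa> * s)"])
    show "continuous_on {0..t} D"
      by (intro continuous_at_imp_continuous_on ballI) (auto intro: has_vector_derivative_continuous[OF D])
    show "((\<lambda>s. C / \<kappa> * exp (\<kappa> * s)) has_vector_derivative C * exp (\<kappa> * s)) (at s)" for s
      using \<open>\<kappa> > 0\<close> unfolding has_real_derivative_iff_has_vector_derivative[symmetric]
      by (auto intro!: derivative_eq_intros)
  qed (use assms False in \<open>auto intro!: continuous_intros\<close>)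
  moreover have "C / \<kappa> \<ge> 0" using assms by simp
  ultimately show ?thesis using D0 by simp
qed

lemma norm_growth_bound:
  fixes D :: "real \<Rightarrow> 'h::real_normed_vector"
  assumes D: "\<And>s. \<bar>s\<bar> \<le> \<bar>t\<bar> \<Longrightarrow> (D has_vector_derivative D' s) (at s)"
    and D0: "D 0 = 0" and "\<kappa> > 0" "C \<ge> 0"
    and bnd: "\<And>s. \<bar>s\<bar> \<le> \<bar>t\<bar> \<Longrightarrow> norm (D' s) \<le> C * exp (\<kappa> * \<bar>s\<bar>)"
  shows "norm (D t) \<le> C / \<kappa> * exp (\<kappa> * \<bar>t\<bar>)"
proof (cases "t \<ge> 0")
  case True
  show ?thesis
    unfolding abs_of_nonneg[OF True]
  proof (rule norm_growth_bound_pos)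
    show "norm (D' s) \<le> C * exp (\<kappa> * s)" if "0 \<le> s" "s \<le> t" for s
      using bnd[of s] that by simp
  qed (use assms True in auto)
next
  case False
  have "norm ((\<lambda>s. D (- s)) (- t)) \<le> C / \<kappa> * exp (\<kappa> * (- t))"
  proof (rule norm_growth_bound_pos)
    fix s assume s: "0 \<le> s" "s \<le> - t"
    have "(D \<circ> uminus has_vector_derivative (-1) *\<^sub>R D' (- s)) (at s)"
    proof (rule vector_diff_chain_at)
      show "(uminus has_vector_derivative - 1) (at s)" for s :: real
        by (auto intro!: derivative_eq_intros simp: has_real_derivative_iff_has_vector_derivative[symmetric])
      show "(D has_vector_derivative D' (- s)) (at (- s))" using s by (intro D) auto
    qed
    then show "((\<lambda>s. D (- s)) has_vector_derivative - D' (- s)) (at s)" by (simp add: o_def)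
    show "norm (- D' (- s)) \<le> C * exp (\<kappa> * s)" using bnd[of "- s"] s by simp
  qed (use assms False in auto)
  then show ?thesis using False by simp
qed

lemma geometric_steps_bound:
  fixes x :: "nat \<Rightarrow> 'h::real_normed_vector"
  assumes "\<And>k. norm (x (Suc k) - x k) \<le> A * (1/2) ^ k"
  shows "norm (x (k + m) - x k) \<le> 2 * A * (1/2) ^ k"
proof -
  have "norm (x (k + m) - x k) \<le> 2 * A * ((1/2) ^ k - (1/2) ^ (k + m))"
  proof (induction m)
    case (Suc m)
    have "norm (x (k + Suc m) - x k) \<le> norm (x (Suc (k + m)) - x (k + m)) + norm (x (k + m) - x k)"
      using norm_triangle_ineq[of "x (Suc (k + m)) - x (k + m)" "x (k + m) - x k"] by simp
    also have "\<dots> \<le> A * (1/2) ^ (k + m) + 2 * A * ((1/2) ^ k - (1/2) ^ (k + m))"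
      using assms Suc by (intro add_mono)
    finally show ?case by (simp add: algebra_simps)
  qed simp
  also have "\<dots> \<le> 2 * A * (1/2) ^ k"
  proof -
    have "0 \<le> norm (x (Suc 0) - x 0)" by simp
    also have "\<dots> \<le> A" using assms[of 0] by simp
    finally show ?thesis by (intro mult_left_mono) auto
  qed
  finally show ?thesis .
qed

lemma geometric_steps_limit:
  fixes x :: "nat \<Rightarrow> 'h::real_normed_vector"
  assumes "\<And>k. norm (x (Suc k) - x k) \<le> A * (1/2) ^ k" "x \<longlonglongrightarrow> l"
  shows "norm (x k - l) \<le> 2 * A * (1/2) ^ k"
proof -
  have "(\<lambda>m. norm (x (m + k) - x k)) \<longlonglongrightarrow> norm (l - x k)"
    by (intro tendsto_intros LIMSEQ_ignore_initial_segment assms(2))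
  then have "norm (l - x k) \<le> 2 * A * (1/2) ^ k"
    by (rule tendsto_upperbound) (use geometric_steps_bound[OF assms(1), of k] in \<open>auto simp: add.commute\<close>)
  then show ?thesis by (simp add: norm_minus_commute)
qed

lemma geometric_steps_convergent:
  fixes x :: "nat \<Rightarrow> 'h::banach"
  assumes "\<And>k. norm (x (Suc k) - x k) \<le> A * (1/2) ^ k"
  shows "convergent x"
proof -
  have "summable (\<lambda>k. A * (1/2::real) ^ k)" by (intro summable_mult) simp
  then have "summable (\<lambda>k. x (Suc k) - x k)"
    by (rule summable_comparison_test') (rule assms)
  then have "convergent (\<lambda>n. (\<Sum>k<n. x (Suc k) - x k))"
    by (simp add: summable_iff_convergent)
  then have "convergent (\<lambda>n. (x n - x 0) + x 0)"
    by (intro convergent_add convergent_const) (simp only: sum_lessThan_telescope)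
  then show ?thesis by simp
qed

text \<open>The Picard iterates for the initial value problem \<open>U' = F U\<close>, \<open>U 0 = a\<close>.\<close>
primrec picard :: "('h::banach \<Rightarrow> 'h) \<Rightarrow> 'h \<Rightarrow> nat \<Rightarrow> real \<Rightarrow> 'h" where
  "picard F a 0 = (\<lambda>t. a)"
| "picard F a (Suc k) = (\<lambda>t. a + antideriv (\<lambda>s. F (picard F a k s)) t)"

lemma picard_at_0 [simp]: "picard F a k 0 = a"
  by (cases k) auto

context
  fixes F :: "'h::banach \<Rightarrow> 'h" and L :: real
  assumes L: "L > 0" and lip: "\<And>v w. norm (F v - F w) \<le> L * norm (v - w)"
begin

lemma continuous_on_lip: "continuous_on S u \<Longrightarrow> continuous_on S (\<lambda>s. F (u s))"
proof -
  assume u: "continuous_on S u"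
  have "continuous_on UNIV F"
    by (rule lipschitz_on_continuous_on[of L])
      (use lip L in \<open>auto simp: lipschitz_on_def dist_norm\<close>)
  from continuous_on_compose2[OF this u] show ?thesis by auto
qed

lemma picard_continuous: "continuous_on UNIV (picard F a k)"
proof (induction k)
  case (Suc k)
  have "(antideriv (\<lambda>s. F (picard F a k s)) has_vector_derivative F (picard F a k t)) (at t)" for t
    by (intro antideriv_has_vector_derivative continuous_on_lip Suc)
  then have "continuous_on UNIV (antideriv (\<lambda>s. F (picard F a k s)))"
    by (auto intro!: continuous_at_imp_continuous_on has_vector_derivative_continuous)
  then show ?case by (auto intro!: continuous_intros)
qed simp

lemma picard_derivative: "(picard F a (Suc k) has_vector_derivative F (picard F a k t)) (at t)"
proof -
  have "((\<lambda>t. a + antideriv (\<lambda>s. F (picard F a k s)) t) has_vector_derivative 0 + F (picard F a k t)) (at t)"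
    by (intro has_vector_derivative_add has_vector_derivative_const antideriv_has_vector_derivative
        continuous_on_lip picard_continuous)
  then show ?thesis by simp
qed

text \<open>The exponent \<open>2 * L\<close> makes the Picard map a contraction with factor \<open>1/2\<close>.\<close>
lemma picard_step:
  assumes B: "norm (F a) \<le> B"
  shows "norm (picard F a (Suc k) t - picard F a k t) \<le> B / (2 * L) * exp (2 * L * \<bar>t\<bar>) * (1/2) ^ k"
proof (induction k arbitrary: t)
  case 0
  have "norm ((\<lambda>t. picard F a (Suc 0) t - a) t) \<le> B / (2 * L) * exp (2 * L * \<bar>t\<bar>)"
  proof (rule norm_growth_bound)
    show "((\<lambda>t. picard F a (Suc 0) t - a) has_vector_derivative F a - 0) (at s)" for s
      using picard_derivative[of a 0] by (intro has_vector_derivative_diff has_vector_derivative_const) simp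
    have B0: "B \<ge> 0" using B norm_ge_zero order_trans by blast
    then show "B \<ge> 0" .
    fix s :: real
    have "B * 1 \<le> B * exp (2 * L * \<bar>s\<bar>)" using B0 L by (intro mult_left_mono) auto
    then show "norm (F a - 0) \<le> B * exp (2 * L * \<bar>s\<bar>)" using B by simp
  qed (use L in auto)
  then show ?case by simp
next
  case (Suc k)
  let ?C = "L * (B / (2 * L) * (1/2) ^ k)"
  have B0: "B \<ge> 0" using B norm_ge_zero order_trans by blast
  have "norm ((\<lambda>t. picard F a (Suc (Suc k)) t - picard F a (Suc k) t) t) \<le> ?C / (2 * L) * exp (2 * L * \<bar>t\<bar>)"
  proof (rule norm_growth_bound)
    show "((\<lambda>t. picard F a (Suc (Suc k)) t - picard F a (Suc k) t) has_vector_derivative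
        F (picard F a (Suc k) s) - F (picard F a k s)) (at s)" for s
      by (intro has_vector_derivative_diff picard_derivative)
    fix s
    have "norm (F (picard F a (Suc k) s) - F (picard F a k s)) \<le> L * norm (picard F a (Suc k) s - picard F a k s)"
      by (rule lip)
    also have "\<dots> \<le> L * (B / (2 * L) * exp (2 * L * \<bar>s\<bar>) * (1/2) ^ k)"
      using L by (intro mult_left_mono Suc) auto
    finally show "norm (F (picard F a (Suc k) s) - F (picard F a k s)) \<le> ?C * exp (2 * L * \<bar>s\<bar>)"
      by (simp only: mult_ac times_divide_eq_left times_divide_eq_right)
  qed (use L B0 in auto)
  also have "?C / (2 * L) * exp (2 * L * \<bar>t\<bar>) = B / (2 * L) * exp (2 * L * \<bar>t\<bar>) * (1/2) ^ Suc k"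
    using L by simp
  finally show ?case .
qed

lemma picard_near_start:
  assumes B: "norm (F a) \<le> B"
  shows "norm (picard F a k t - a) \<le> B / L * exp (2 * L * \<bar>t\<bar>)"
  using geometric_steps_bound[of "\<lambda>k. picard F a k t", OF picard_step[OF B], of 0 k] L
  by simp

text \<open>A priori a solution is only bounded on compact intervals, by an unknown constant \<open>M\<close>; this
  suffices for convergence of the iterates, and the increments of \<open>picard_step\<close> then give a rate that
  involves only \<open>L\<close> and the bound on \<open>F a\<close>.\<close>
lemma picard_approximates_solution:
  assumes U: "\<And>t. (U has_vector_derivative F (U t)) (at t)" and U0: "U 0 = a"
    and B: "norm (F a) \<le> B"
  shows "norm (picard F a k t - U t) \<le> B / L * exp (2 * L * \<bar>t\<bar>) * (1/2) ^ k"
proof -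
  have contU: "continuous_on UNIV U"
    using U by (auto intro!: continuous_at_imp_continuous_on has_vector_derivative_continuous)
  have "bounded ((\<lambda>s. a - U s) ` {-\<bar>t\<bar>..\<bar>t\<bar>})"
    by (intro compact_imp_bounded compact_continuous_image continuous_intros continuous_on_subset[OF contU]) auto
  then obtain M where M: "\<And>s. \<bar>s\<bar> \<le> \<bar>t\<bar> \<Longrightarrow> norm (a - U s) \<le> M"
    unfolding bounded_iff by fastforce
  have M0: "M \<ge> 0" using M[of 0] U0 by simp
  have rate: "norm (picard F a k s - U s) \<le> M * (1/2) ^ k * exp (2 * L * \<bar>s\<bar>)" if "\<bar>s\<bar> \<le> \<bar>t\<bar>" for k s
    using that
  proof (induction k arbitrary: s)
    case 0
    have "M * 1 \<le> M * exp (2 * L * \<bar>s\<bar>)" using M0 L by (intro mult_left_mono) auto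
    then show ?case using M[OF 0] by simp
  next
    case (Suc k)
    let ?C = "L * (M * (1/2) ^ k)"
    have "norm ((\<lambda>s. picard F a (Suc k) s - U s) s) \<le> ?C / (2 * L) * exp (2 * L * \<bar>s\<bar>)"
    proof (rule norm_growth_bound)
      show "((\<lambda>s. picard F a (Suc k) s - U s) has_vector_derivative F (picard F a k r) - F (U r)) (at r)" for r
        by (intro has_vector_derivative_diff picard_derivative U)
      fix r assume r: "\<bar>r\<bar> \<le> \<bar>s\<bar>"
      have "norm (F (picard F a k r) - F (U r)) \<le> L * norm (picard F a k r - U r)" by (rule lip)
      also have "\<dots> \<le> L * (M * (1/2) ^ k * exp (2 * L * \<bar>r\<bar>))"
        using L r Suc by (intro mult_left_mono Suc) auto
      finally show "norm (F (picard F a k r) - F (U r)) \<le> ?C * exp (2 * L * \<bar>r\<bar>)" by (simp add: mult_ac)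
    qed (use L M0 U0 in auto)
    then show ?case using L by simp
  qed
  have "(\<lambda>k. picard F a k t - U t) \<longlonglongrightarrow> 0"
  proof (rule Lim_null_comparison)
    show "(\<lambda>k. M * (1/2) ^ k * exp (2 * L * \<bar>t\<bar>)) \<longlonglongrightarrow> 0"
      by (rule tendsto_eq_intros refl | simp)+
  qed (auto intro!: always_eventually rate)
  then have "(\<lambda>k. picard F a k t) \<longlonglongrightarrow> U t" by (simp add: LIM_zero_iff)
  from geometric_steps_limit[OF picard_step[OF B] this, of k] show ?thesis using L by simp
qed

lemma solution_bound:
  assumes "\<And>t. (U has_vector_derivative F (U t)) (at t)" and "norm (F (U 0)) \<le> B"
  shows "norm (U t) \<le> norm (U 0) + B / L * exp (2 * L * \<bar>t\<bar>)"
proof -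
  have "norm (U 0 - U t) \<le> B / L * exp (2 * L * \<bar>t\<bar>)"
    using picard_approximates_solution[OF assms(1) refl assms(2), of 0 t] by simp
  then show ?thesis using norm_triangle_sub[of "U t" "U 0"] by (simp add: norm_minus_commute)
qed

theorem lipschitz_ode_solution_exists:
  shows "\<exists>U. (\<forall>t. (U has_vector_derivative F (U t)) (at t)) \<and> U 0 = a"
proof -
  let ?B = "norm (F a)"
  define U where "U t = lim (\<lambda>k. picard F a k t)" for t
  have lim: "(\<lambda>k. picard F a k t) \<longlonglongrightarrow> U t" for t
    unfolding U_def convergent_LIMSEQ_iff[symmetric]
    by (rule geometric_steps_convergent) (rule picard_step[OF order_refl])
  have rate: "norm (picard F a k t - U t) \<le> ?B / L * exp (2 * L * \<bar>t\<bar>) * (1/2) ^ k" for k t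
    using geometric_steps_limit[OF picard_step[of a ?B, OF order_refl] lim, of k t] L by simp
  have contU: "continuous_on UNIV U"
  proof (rule continuous_at_imp_continuous_on, rule ballI)
    fix t :: real
    define R where "R = \<bar>t\<bar> + 1"
    have "continuous_on {-R..R} U"
    proof (rule uniform_limit_theorem)
      show "\<forall>\<^sub>F k in sequentially. continuous_on {-R..R} (picard F a k)"
        by (intro always_eventually allI continuous_on_subset[OF picard_continuous]) auto
      show "uniform_limit {-R..R} (picard F a) U sequentially"
      proof (rule uniform_limitI)
        fix e :: real assume "e > 0"
        have "(\<lambda>k. ?B / L * exp (2 * L * R) * (1/2) ^ k) \<longlonglongrightarrow> 0"
          by (rule tendsto_eq_intros refl | simp)+
        then have "\<forall>\<^sub>F k in sequentially. ?B / L * exp (2 * L * R) * (1/2) ^ k < e"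
          using \<open>e > 0\<close> by (rule order_tendstoD)
        then show "\<forall>\<^sub>F k in sequentially. \<forall>s\<in>{-R..R}. dist (picard F a k s) (U s) < e"
        proof eventually_elim
          case (elim k)
          show ?case
          proof
            fix s assume "s \<in> {-R..R}"
            then have "?B / L * exp (2 * L * \<bar>s\<bar>) * (1/2) ^ k \<le> ?B / L * exp (2 * L * R) * (1/2) ^ k"
              using L by (intro mult_right_mono mult_left_mono) auto
            then show "dist (picard F a k s) (U s) < e"
              using rate[of k s] elim by (simp add: dist_norm)
          qed
        qed
      qed
    qed simp
    then have "continuous_on {-R<..<R} U" by (rule continuous_on_subset) auto
    then show "isCont U t" by (rule continuous_on_interior) (auto simp: R_def)
  qed
  define V where "V t = a + antideriv (\<lambda>s. F (U s)) t" for t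
  have V': "(V has_vector_derivative F (U t)) (at t)" for t
  proof -
    have "((\<lambda>t. a + antideriv (\<lambda>s. F (U s)) t) has_vector_derivative 0 + F (U t)) (at t)"
      by (intro has_vector_derivative_add has_vector_derivative_const antideriv_has_vector_derivative
          continuous_on_lip contU)
    then show ?thesis by (simp add: V_def[abs_def])
  qed
  \<comment> \<open>The iterates converge to \<open>V\<close> as well, which makes \<open>U\<close> differentiable.\<close>
  have "V t = U t" for t
  proof -
    have est: "norm (picard F a (Suc k) t - V t) \<le> (L * (?B / L * (1/2) ^ k)) / (2 * L) * exp (2 * L * \<bar>t\<bar>)" for k
    proof (rule norm_growth_bound[where D = "\<lambda>t. picard F a (Suc k) t - V t"])
      show "((\<lambda>t. picard F a (Suc k) t - V t) has_vector_derivative F (picard F a k r) - F (U r)) (at r)" for r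
        by (intro has_vector_derivative_diff picard_derivative V')
      fix r
      have "norm (F (picard F a k r) - F (U r)) \<le> L * norm (picard F a k r - U r)" by (rule lip)
      also have "\<dots> \<le> L * (?B / L * exp (2 * L * \<bar>r\<bar>) * (1/2) ^ k)"
        using L by (intro mult_left_mono rate) auto
      finally show "norm (F (picard F a k r) - F (U r)) \<le> L * (?B / L * (1/2) ^ k) * exp (2 * L * \<bar>r\<bar>)"
        by (simp only: mult_ac times_divide_eq_left times_divide_eq_right)
    qed (use L in \<open>auto simp: V_def simp del: picard.simps\<close>)
    have "(\<lambda>k. picard F a (Suc k) t - V t) \<longlonglongrightarrow> 0"
    proof (rule Lim_null_comparison)
      show "(\<lambda>k. (L * (?B / L * (1/2) ^ k)) / (2 * L) * exp (2 * L * \<bar>t\<bar>)) \<longlonglongrightarrow> 0"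
        by (rule tendsto_eq_intros refl | use L in simp)+
    qed (rule always_eventually, rule allI, rule est)
    then have "(\<lambda>k. picard F a (Suc k) t) \<longlonglongrightarrow> V t" by (simp only: LIM_zero_iff)
    moreover have "(\<lambda>k. picard F a (Suc k) t) \<longlonglongrightarrow> U t" using lim by (rule LIMSEQ_Suc)
    ultimately show ?thesis by (rule LIMSEQ_unique)
  qed
  then have VU: "V = U" by auto
  have "V 0 = a" by (simp add: V_def)
  then show ?thesis using V' unfolding VU by blast
qed

end

text \<open>Weak convergence of sequences in an inner product space, tested by the inner product with fixed vectors.\<close>
definition weakly_tendsto :: "(nat \<Rightarrow> 'h::real_inner) \<Rightarrow> 'h \<Rightarrow> bool" where
  "weakly_tendsto v w \<longleftrightarrow> (\<forall>\<phi>. (\<lambda>n. inner (v n) \<phi>) \<longlonglongrightarrow> inner w \<phi>)"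

lemma weakly_tendsto_antideriv:
  fixes f :: "nat \<Rightarrow> real \<Rightarrow> 'h::{real_inner, banach}"
  assumes f: "\<And>n. continuous_on UNIV (f n)" and f0: "continuous_on UNIV f0"
    and w: "\<And>s. weakly_tendsto (\<lambda>n. f n s) (f0 s)"
    and bnd: "\<And>n s. \<bar>s\<bar> \<le> \<bar>t\<bar> \<Longrightarrow> norm (f n s) \<le> C"
  shows "weakly_tendsto (\<lambda>n. antideriv (f n) t) (antideriv f0 t)"
proof -
  have I: "(\<lambda>n. inner (integral {a..b} (f n)) \<phi>) \<longlonglongrightarrow> inner (integral {a..b} f0) \<phi>"
    if ab: "{a..b} \<subseteq> {-\<bar>t\<bar>..\<bar>t\<bar>}" for a b \<phi>
  proof -
    have eq: "inner (integral {a..b} h) \<phi> = integral {a..b} (\<lambda>s. inner (h s) \<phi>)" if "continuous_on UNIV h" for h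
      using integral_linear[OF integrable_continuous_real bounded_linear_inner_left,
          of a b h \<phi>] continuous_on_subset[OF that] by (simp add: o_def)
    have "(\<lambda>n. integral {a..b} (\<lambda>s. inner (f n s) \<phi>)) \<longlonglongrightarrow> integral {a..b} (\<lambda>s. inner (f0 s) \<phi>)"
    proof (rule dominated_convergence(2))
      show "(\<lambda>s. inner (f n s) \<phi>) integrable_on {a..b}" for n
        by (intro integrable_continuous_real continuous_intros continuous_on_subset[OF f]) auto
      show "(\<lambda>s. C * norm \<phi>) integrable_on {a..b}" by (rule integrable_const_ivl)
      show "norm (inner (f n s) \<phi>) \<le> C * norm \<phi>" if "s \<in> {a..b}" for n s
      proof -
        have "norm (inner (f n s) \<phi>) \<le> norm (f n s) * norm \<phi>" by (simp add: Cauchy_Schwarz_ineq2)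
        also have "\<dots> \<le> C * norm \<phi>" using that ab by (intro mult_right_mono bnd) auto
        finally show ?thesis .
      qed
      show "(\<lambda>n. inner (f n s) \<phi>) \<longlonglongrightarrow> inner (f0 s) \<phi>" for s
        using w[of s] by (simp add: weakly_tendsto_def)
    qed
    then show ?thesis by (simp add: eq f f0)
  qed
  show ?thesis
    unfolding weakly_tendsto_def antideriv_def
    using I[of 0 t] I[of t 0] by (auto simp: inner_minus_left intro!: tendsto_minus)
qed

text \<open>Weak continuous dependence on the vector field. The fields have a common Lipschitz constant
  and converge in the sense that \<open>F n (v n)\<close> tends weakly to \<open>F0 v0\<close> whenever the bounded sequence
  \<open>v n\<close> tends weakly to \<open>v0\<close>; no strong convergence is needed.\<close>
theorem weak_stability_of_solutions:
  fixes F :: "nat \<Rightarrow> 'h::{real_inner, banach} \<Rightarrow> 'h"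
  assumes L: "L > 0"
    and lip: "\<And>n v w. norm (F n v - F n w) \<le> L * norm (v - w)"
    and lip0: "\<And>v w. norm (F0 v - F0 w) \<le> L * norm (v - w)"
    and B: "\<And>n. norm (F n 0) \<le> B"
    and A: "\<And>n. norm (a n) \<le> A"
    and wa: "weakly_tendsto a a0"
    and wF: "\<And>v v0 C. (\<And>n. norm (v n) \<le> C) \<Longrightarrow> weakly_tendsto v v0 \<Longrightarrow>
               weakly_tendsto (\<lambda>n. F n (v n)) (F0 v0)"
    and U: "\<And>n t. (U n has_vector_derivative F n (U n t)) (at t)" "\<And>n. U n 0 = a n"
    and U0: "\<And>t. (U0 has_vector_derivative F0 (U0 t)) (at t)" "U0 0 = a0"
  shows "weakly_tendsto (\<lambda>n. U n t) (U0 t)"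
proof -
  define B1 where "B1 = max (norm (F0 a0)) (B + L * A)"
  have Fa: "norm (F n (a n)) \<le> B1" for n
  proof -
    have "norm (F n (a n)) \<le> norm (F n 0) + norm (F n (a n) - F n 0)"
      by norm
    also have "\<dots> \<le> B + L * A"
      using order_trans[OF lip[of n "a n" 0], of "L * A"] B[of n] A[of n] L
      by (intro add_mono) auto
    finally show ?thesis by (simp add: B1_def)
  qed
  have Fa0: "norm (F0 a0) \<le> B1" by (simp add: B1_def)
  have near: "norm (picard (F n) (a n) k s - a n) \<le> B1 / L * exp (2 * L * \<bar>s\<bar>)" for n k s
    by (rule picard_near_start[OF L lip Fa])
  have B1: "B1 \<ge> 0" by (simp add: B1_def max.coboundedI1)
  have wp: "weakly_tendsto (\<lambda>n. picard (F n) (a n) k t) (picard F0 a0 k t)" for k t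
  proof (induction k arbitrary: t)
    case 0
    then show ?case using wa by simp
  next
    case (Suc k)
    have "weakly_tendsto (\<lambda>n. antideriv (\<lambda>s. F n (picard (F n) (a n) k s)) t) (antideriv (\<lambda>s. F0 (picard F0 a0 k s)) t)"
    proof (rule weakly_tendsto_antideriv)
      show "continuous_on UNIV (\<lambda>s. F n (picard (F n) (a n) k s))" for n
        by (intro continuous_on_lip[OF L lip] picard_continuous[OF L lip])
      show "continuous_on UNIV (\<lambda>s. F0 (picard F0 a0 k s))"
        by (intro continuous_on_lip[OF L lip0] picard_continuous[OF L lip0])
      show "weakly_tendsto (\<lambda>n. F n (picard (F n) (a n) k s)) (F0 (picard F0 a0 k s))" for s
      proof (rule wF[OF _ Suc])
        fix n
        have "norm (picard (F n) (a n) k s) \<le> norm (a n) + norm (picard (F n) (a n) k s - a n)" by norm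
        then show "norm (picard (F n) (a n) k s) \<le> A + B1 / L * exp (2 * L * \<bar>s\<bar>)"
          using near[of n k s] A[of n] by simp
      qed
      fix n s assume s: "\<bar>s\<bar> \<le> \<bar>t\<bar>"
      have "norm (F n (picard (F n) (a n) k s)) \<le>
          norm (F n (a n)) + norm (F n (picard (F n) (a n) k s) - F n (a n))" by norm
      also have "\<dots> \<le> B1 + L * norm (picard (F n) (a n) k s - a n)"
        by (intro add_mono Fa lip)
      also have "\<dots> \<le> B1 + L * (B1 / L * exp (2 * L * \<bar>t\<bar>))"
      proof -
        have "B1 / L * exp (2 * L * \<bar>s\<bar>) \<le> B1 / L * exp (2 * L * \<bar>t\<bar>)"
          using s L B1 by (intro mult_left_mono) auto
        then show ?thesis using near[of n k s] L by (intro add_left_mono mult_left_mono) auto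
      qed
      finally show "norm (F n (picard (F n) (a n) k s)) \<le> B1 + L * (B1 / L * exp (2 * L * \<bar>t\<bar>))" .
    qed
    then show ?case
      using wa by (auto simp: weakly_tendsto_def inner_add_left intro!: tendsto_add)
  qed
  show ?thesis
    unfolding weakly_tendsto_def
  proof
    fix \<phi> :: 'h
    \<comment> \<open>The constant \<open>K\<close> does not depend on \<open>n\<close>, which allows to fix \<open>k\<close> before \<open>n\<close>.\<close>
    define K where "K = B1 / L * exp (2 * L * \<bar>t\<bar>) * norm \<phi>"
    have est: "\<bar>inner (picard (F n) (a n) k t) \<phi> - inner (U n t) \<phi>\<bar> \<le> K * (1/2) ^ k"
      and est0: "\<bar>inner (picard F0 a0 k t) \<phi> - inner (U0 t) \<phi>\<bar> \<le> K * (1/2) ^ k" for n k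
    proof -
      have "\<bar>inner (picard (F n) (a n) k t) \<phi> - inner (U n t) \<phi>\<bar> \<le> norm (picard (F n) (a n) k t - U n t) * norm \<phi>"
        by (metis Cauchy_Schwarz_ineq2 inner_diff_left)
      also have "\<dots> \<le> (B1 / L * exp (2 * L * \<bar>t\<bar>) * (1/2) ^ k) * norm \<phi>"
        by (intro mult_right_mono picard_approximates_solution[OF L lip U Fa]) auto
      finally show "\<bar>inner (picard (F n) (a n) k t) \<phi> - inner (U n t) \<phi>\<bar> \<le> K * (1/2) ^ k"
        by (simp add: K_def mult_ac)
      have "\<bar>inner (picard F0 a0 k t) \<phi> - inner (U0 t) \<phi>\<bar> \<le> norm (picard F0 a0 k t - U0 t) * norm \<phi>"
        by (metis Cauchy_Schwarz_ineq2 inner_diff_left)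
      also have "\<dots> \<le> (B1 / L * exp (2 * L * \<bar>t\<bar>) * (1/2) ^ k) * norm \<phi>"
        by (intro mult_right_mono picard_approximates_solution[OF L lip0 U0 Fa0]) auto
      finally show "\<bar>inner (picard F0 a0 k t) \<phi> - inner (U0 t) \<phi>\<bar> \<le> K * (1/2) ^ k"
        by (simp add: K_def mult_ac)
    qed
    show "(\<lambda>n. inner (U n t) \<phi>) \<longlonglongrightarrow> inner (U0 t) \<phi>"
    proof (rule LIMSEQ_I)
      fix e :: real assume e: "e > 0"
      have "(\<lambda>k. K * (1/2) ^ k) \<longlonglongrightarrow> 0"
        by (rule tendsto_eq_intros refl | simp)+
      then have "\<forall>\<^sub>F k in sequentially. K * (1/2) ^ k < e / 3"
        using e by (intro order_tendstoD) auto
      then obtain k where k: "K * (1/2) ^ k < e / 3"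
        by (auto simp: eventually_sequentially)
      have "\<forall>\<^sub>F n in sequentially. dist (inner (picard (F n) (a n) k t) \<phi>) (inner (picard F0 a0 k t) \<phi>) < e / 3"
        using wp[of k t] e by (intro tendstoD) (auto simp: weakly_tendsto_def)
      then show "\<exists>N. \<forall>n\<ge>N. norm (inner (U n t) \<phi> - inner (U0 t) \<phi>) < e"
        unfolding eventually_sequentially
      proof (elim exE, intro exI allI impI)
        fix N n
        assume "\<forall>n\<ge>N. dist (inner (picard (F n) (a n) k t) \<phi>) (inner (picard F0 a0 k t) \<phi>) < e / 3" "N \<le> n"
        then have "dist (inner (picard (F n) (a n) k t) \<phi>) (inner (picard F0 a0 k t) \<phi>) < e / 3" by blast
        then show "norm (inner (U n t) \<phi> - inner (U0 t) \<phi>) < e"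
          using est[of n k] est0[of k] k unfolding dist_real_def real_norm_def by linarith
      qed
    qed
  qed
qed

section \<open>Curves in spaces of square integrable functions\<close>

lemma continuous_imp_lebesgue_measurable:
  fixes f :: "'a::euclidean_space \<Rightarrow> real"
  assumes "continuous_on UNIV f"
  shows "f \<in> borel_measurable lebesgue"
  using borel_measurable_continuous_onI[OF assms] by (intro measurable_completion) simp

lemma continuous_on_lebesgue_measurable_indicator:
  fixes f :: "'a::euclidean_space \<Rightarrow> real"
  assumes "open D" "continuous_on D f"
  shows "(\<lambda>x. indicator D x * f x) \<in> borel_measurable lebesgue"
  using borel_measurable_continuous_on_indicator[OF _ assms(2)] assms(1)
  by (intro measurable_completion) simp

text \<open>For \<open>D = UNIV\<close> the right-hand side is an instance of the left-hand side, so as a rewrite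
  rule this equivalence has to be used for a fixed set.\<close>
lemma L2_iff_cut:
  assumes "D \<in> sets lebesgue"
  shows "f \<in> L2 D \<longleftrightarrow> (\<lambda>x. indicator D x * f x) \<in> L2 UNIV"
proof -
  have "(\<lambda>x. indicat_real D x * (f x)\<^sup>2) = (\<lambda>x. (indicator D x * f x)\<^sup>2)"
    by (auto simp: indicator_def)
  then show ?thesis
    using assms by (simp add: L2_def lebesgue_on_UNIV_eq borel_measurable_restrict_space_iff integrable_restrict_space)
qed

lemma L2_norm_eq_cut:
  assumes "D \<in> sets lebesgue"
  shows "L2_norm D f = L2_norm UNIV (\<lambda>x. indicator D x * f x)"
proof -
  have "(\<lambda>x. indicat_real D x * (f x)\<^sup>2) = (\<lambda>x. (indicator D x * f x)\<^sup>2)"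
    by (auto simp: indicator_def)
  then show ?thesis
    using assms by (simp add: L2_norm_def lebesgue_on_UNIV_eq integral_restrict_space)
qed

text \<open>The element of \<open>l2\<close> given by the extension by zero of a function on \<open>D\<close>.\<close>
definition cls :: "'a::euclidean_space set \<Rightarrow> ('a \<Rightarrow> real) \<Rightarrow> 'a l2" where
  "cls D f = abs_l2 (\<lambda>x. indicator D x * f x)"

lemma L2_norm_cls:
  assumes D: "D \<in> sets lebesgue" and "f \<in> L2 D"
  shows "L2_norm D f = norm (cls D f)"
  using assms by (simp add: cls_def norm_abs_l2 L2_norm_eq_cut[OF D, of f] L2_iff_cut[OF D])

lemma
  assumes D: "D \<in> sets lebesgue" and f: "f \<in> L2 D" and g: "g \<in> L2 D"
  shows L2_diff: "(\<lambda>x. f x - g x) \<in> L2 D" and cls_diff: "cls D (\<lambda>x. f x - g x) = cls D f - cls D g"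
proof -
  have eq: "(\<lambda>x. indicat_real D x * (f x - g x)) = (\<lambda>x. indicator D x * f x - indicator D x * g x)"
    by (auto simp: algebra_simps)
  show "(\<lambda>x. f x - g x) \<in> L2 D"
    using L2_UNIV_diff[of "\<lambda>x. indicator D x * f x" "\<lambda>x. indicator D x * g x"] assms by (simp add: L2_iff_cut[OF D] eq)
  show "cls D (\<lambda>x. f x - g x) = cls D f - cls D g"
    using assms by (simp add: cls_def eq abs_l2_diff L2_iff_cut[OF D])
qed

lemma
  assumes D: "D \<in> sets lebesgue" and f: "f \<in> L2 D"
  shows L2_scale: "(\<lambda>x. c * f x) \<in> L2 D" and cls_scale: "cls D (\<lambda>x. c * f x) = c *\<^sub>R cls D f"
proof -
  have eq: "(\<lambda>x. indicat_real D x * (c * f x)) = (\<lambda>x. c * (indicator D x * f x))"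
    by (auto simp: algebra_simps)
  show "(\<lambda>x. c * f x) \<in> L2 D"
    using L2_UNIV_scale[of "\<lambda>x. indicator D x * f x"] assms by (simp add: L2_iff_cut[OF D] eq)
  show "cls D (\<lambda>x. c * f x) = c *\<^sub>R cls D f"
    using assms by (simp add: cls_def eq abs_l2_scaleR L2_iff_cut[OF D])
qed

lemma integral_cls:
  assumes D: "D \<in> sets lebesgue" and f: "f \<in> L2 D" and g: "g \<in> L2 D"
  shows "(LINT x|lebesgue_on D. f x * g x) = inner (cls D f) (cls D g)"
proof -
  have "(LINT x|lebesgue_on D. f x * g x) = (LINT x|lebesgue. (indicator D x * f x) * (indicator D x * g x))"
    using D by (simp add: integral_restrict_space) (auto intro!: Bochner_Integration.integral_cong simp: indicator_def)
  then show ?thesis using assms by (simp add: cls_def inner_abs_l2 L2_iff_cut[OF D])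
qed

lemma has_L2_derivative_iff:
  assumes D: "D \<in> sets lebesgue" and t: "t \<in> S"
  shows "has_L2_derivative D u w t S \<longleftrightarrow> (\<forall>s\<in>S. u s \<in> L2 D) \<and> w \<in> L2 D \<and>
    ((\<lambda>s. cls D (u s)) has_vector_derivative cls D w) (at t within S)"
proof -
  have "((\<lambda>s. L2_norm D (\<lambda>x. (u s x - u t x) / (s - t) - w x)) \<longlongrightarrow> 0) (at t within S) \<longleftrightarrow>
      ((\<lambda>s. cls D (u s)) has_vector_derivative cls D w) (at t within S)"
    if u: "\<forall>s\<in>S. u s \<in> L2 D" and w: "w \<in> L2 D"
  proof -
    have "L2_norm D (\<lambda>x. (u s x - u t x) / (s - t) - w x) =
        norm (cls D (u s) - cls D (u t) - (s - t) *\<^sub>R cls D w) / norm (s - t)"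
      if s: "s \<in> S" "s \<noteq> t" for s
    proof -
      have us: "u s \<in> L2 D" "u t \<in> L2 D" using u s t by auto
      have "L2_norm D (\<lambda>x. (u s x - u t x) / (s - t) - w x) =
          L2_norm D (\<lambda>x. inverse (s - t) * (u s x - u t x) - w x)"
        by (simp add: divide_inverse mult.commute)
      also have "\<dots> = norm (inverse (s - t) *\<^sub>R (cls D (u s) - cls D (u t)) - cls D w)"
        using L2_norm_cls[OF D L2_diff[OF D L2_scale[OF D L2_diff[OF D us]] w]]
        by (simp add: cls_diff[OF D L2_scale[OF D L2_diff[OF D us]] w] cls_scale[OF D L2_diff[OF D us]] cls_diff[OF D us])
      also have "inverse (s - t) *\<^sub>R (cls D (u s) - cls D (u t)) - cls D w =
          inverse (s - t) *\<^sub>R (cls D (u s) - cls D (u t) - (s - t) *\<^sub>R cls D w)"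
        using s by (simp add: scaleR_right_diff_distrib)
      also have "norm \<dots> = norm (cls D (u s) - cls D (u t) - (s - t) *\<^sub>R cls D w) / norm (s - t)"
        by (simp add: divide_inverse mult.commute)
      finally show ?thesis .
    qed
    then have "((\<lambda>s. L2_norm D (\<lambda>x. (u s x - u t x) / (s - t) - w x)) \<longlongrightarrow> 0) (at t within S) \<longleftrightarrow>
        ((\<lambda>s. norm (cls D (u s) - cls D (u t) - (s - t) *\<^sub>R cls D w) / norm (s - t)) \<longlongrightarrow> 0) (at t within S)"
      by (intro filterlim_cong refl) (auto simp: eventually_at_filter)
    also have "\<dots> \<longleftrightarrow> ((\<lambda>s. cls D (u s)) has_vector_derivative cls D w) (at t within S)"
      by (simp add: has_vector_derivative_def has_derivative_iff_norm bounded_linear_scaleR_left)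
    finally show ?thesis .
  qed
  then show ?thesis unfolding has_L2_derivative_def by blast
qed

text \<open>A continuous curve is the pointwise limit of its values on finer and finer grids.\<close>

lemma continuous_curve_Linf_L2:
  assumes D: "D \<in> sets lebesgue" and f: "\<And>t. f t \<in> L2 D"
    and cont: "continuous_on UNIV (\<lambda>t. cls D (f t))"
  shows "f \<in> Linf_L2 a b D"
proof -
  \<comment> \<open>The grid points are rounded down, so that they stay in \<open>[a,b]\<close>.\<close>
  define p where "p n t = a + real_of_int \<lfloor>(t - a) * real (Suc n)\<rfloor> / real (Suc n)" for n t
  have simple: "simple_function (lebesgue_on {a..b}) (\<lambda>t. f (p n t))" for n
  proof -
    have "simple_function (lebesgue_on {a..b}) (\<lambda>t. \<lfloor>(t - a) * real (Suc n)\<rfloor>)"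
    proof (subst simple_function_def, intro conjI ballI)
      have "(\<lambda>t. \<lfloor>(t - a) * real (Suc n)\<rfloor>) ` {a..b} \<subseteq> {0..\<lfloor>(b - a) * real (Suc n)\<rfloor>}"
      proof (rule image_subsetI)
        fix t assume t: "t \<in> {a..b}"
        then have "0 \<le> (t - a) * real (Suc n)" "(t - a) * real (Suc n) \<le> (b - a) * real (Suc n)"
          by (simp_all add: mult_right_mono del: of_nat_Suc)
        then show "\<lfloor>(t - a) * real (Suc n)\<rfloor> \<in> {0..\<lfloor>(b - a) * real (Suc n)\<rfloor>}"
          by (simp add: floor_mono del: of_nat_Suc)
      qed
      then show "finite ((\<lambda>t. \<lfloor>(t - a) * real (Suc n)\<rfloor>) ` space (lebesgue_on {a..b}))"
        by (auto intro: finite_subset)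
      fix k
      have "(\<lambda>t. \<lfloor>(t - a) * real (Suc n)\<rfloor>) -` {k} \<inter> {a..b} =
          {t. real_of_int k \<le> (t - a) * real (Suc n) \<and> (t - a) * real (Suc n) < real_of_int k + 1} \<inter> {a..b}"
        by (auto simp: floor_eq_iff)
      moreover have "{t. real_of_int k \<le> (t - a) * real (Suc n) \<and> (t - a) * real (Suc n) < real_of_int k + 1} \<in> sets borel"
        by measurable
      ultimately have "(\<lambda>t. \<lfloor>(t - a) * real (Suc n)\<rfloor>) -` {k} \<inter> {a..b} \<in> sets lebesgue"
        by simp
      then show "(\<lambda>t. \<lfloor>(t - a) * real (Suc n)\<rfloor>) -` {k} \<inter> space (lebesgue_on {a..b}) \<in> sets (lebesgue_on {a..b})"
        by (simp add: sets_restrict_space_iff)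
    qed
    then show ?thesis unfolding p_def by (rule simple_function_compose1)
  qed
  have p: "(\<lambda>n. p n t) \<longlonglongrightarrow> t" for t
  proof -
    have "(\<lambda>n. p n t - t) \<longlonglongrightarrow> 0"
    proof (rule Lim_null_comparison)
      show "(\<lambda>n. inverse (real (Suc n))) \<longlonglongrightarrow> 0" by (rule LIMSEQ_inverse_real_of_nat)
      have "\<bar>p n t - t\<bar> \<le> inverse (real (Suc n))" for n
      proof -
        have "(p n t - t) * real (Suc n) = real_of_int \<lfloor>(t - a) * real (Suc n)\<rfloor> - (t - a) * real (Suc n)"
          by (simp add: p_def field_simps del: of_nat_Suc)
        then have "\<bar>(p n t - t) * real (Suc n)\<bar> \<le> 1"
          by linarith
        then have "\<bar>p n t - t\<bar> * real (Suc n) \<le> 1"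
          by (simp only: abs_mult abs_of_nat)
        then show ?thesis by (simp add: inverse_eq_divide pos_le_divide_eq del: of_nat_Suc)
      qed
      then show "\<forall>\<^sub>F n in sequentially. norm (p n t - t) \<le> inverse (real (Suc n))" by simp
    qed
    then show ?thesis by (simp add: LIM_zero_iff)
  qed
  have lim: "(\<lambda>n. L2_norm D (\<lambda>x. f (p n t) x - f t x)) \<longlonglongrightarrow> 0" for t
  proof -
    have "(\<lambda>n. cls D (f (p n t))) \<longlonglongrightarrow> cls D (f t)"
      by (rule continuous_on_tendsto_compose[OF cont p]) auto
    then have "(\<lambda>n. norm (cls D (f (p n t)) - cls D (f t))) \<longlonglongrightarrow> 0"
      by (intro tendsto_norm_zero LIM_zero)
    then show ?thesis
      by (simp add: L2_norm_cls[OF D L2_diff[OF D f f]] cls_diff[OF D f f])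
  qed
  have "bounded ((\<lambda>t. cls D (f t)) ` {a..b})"
    by (intro compact_imp_bounded compact_continuous_image continuous_on_subset[OF cont]) auto
  then obtain M where M: "\<And>t. t \<in> {a..b} \<Longrightarrow> norm (cls D (f t)) \<le> M"
    unfolding bounded_iff by blast
  have "AE t in lebesgue_on {a..b}. L2_norm D (f t) \<le> M"
    using M by (intro AE_I2) (simp add: L2_norm_cls[OF D f])
  moreover have "f \<in> L2_strongly_measurable a b D"
    unfolding L2_strongly_measurable_def
    using f simple lim by (auto intro!: exI[of _ "\<lambda>n t. f (p n t)"])
  ultimately show ?thesis unfolding Linf_L2_def by blast
qed

lemma inner_simple_function_measurable:
  fixes U S :: "'b \<Rightarrow> 'h::real_inner"
  assumes S: "simple_function M S" and U: "\<And>y. (\<lambda>t. inner (U t) y) \<in> borel_measurable M"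
  shows "(\<lambda>t. inner (U t) (S t)) \<in> borel_measurable M"
proof -
  have fin: "finite (S ` space M)" using S by (rule simple_functionD)
  have "(\<lambda>t. \<Sum>y\<in>S ` space M. indicat_real (S -` {y} \<inter> space M) t * inner (U t) y) \<in> borel_measurable M"
    using U simple_functionD(2)[OF S] by (intro borel_measurable_sum borel_measurable_times) auto
  moreover have "(\<Sum>y\<in>S ` space M. indicat_real (S -` {y} \<inter> space M) t * inner (U t) y) = inner (U t) (S t)"
    if "t \<in> space M" for t
  proof -
    have "(\<Sum>y\<in>S ` space M. indicat_real (S -` {y} \<inter> space M) t * inner (U t) y)
        = (\<Sum>y\<in>S ` space M. if y = S t then inner (U t) y else 0)"
      using that by (intro sum.cong) (auto simp: indicator_def)
    also have "\<dots> = inner (U t) (S t)" using fin that by simp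
    finally show ?thesis .
  qed
  ultimately show ?thesis by (subst measurable_cong[symmetric]) auto
qed

text \<open>By completeness of Lebesgue measure a limit almost everywhere is measurable.\<close>
lemma AE_limit_lebesgue_on_measurable:
  fixes h :: "real \<Rightarrow> real"
  assumes S: "S \<in> sets lebesgue" and g: "\<And>n. g n \<in> borel_measurable (lebesgue_on S)"
    and lim: "AE t in lebesgue_on S. (\<lambda>n. g n t) \<longlonglongrightarrow> h t"
  shows "h \<in> borel_measurable (lebesgue_on S)"
proof -
  let ?g = "\<lambda>n t. indicator S t *\<^sub>R g n t"
  have m: "(\<lambda>t. lim (\<lambda>n. ?g n t)) \<in> borel_measurable lebesgue"
    using g S by (intro borel_measurable_lim_metric) (simp add: borel_measurable_restrict_space_iff)
  have "AE t in lebesgue. lim (\<lambda>n. ?g n t) = indicator S t *\<^sub>R h t"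
  proof -
    have "AE t in lebesgue. t \<in> S \<longrightarrow> (\<lambda>n. g n t) \<longlonglongrightarrow> h t"
      using lim S by (simp add: AE_restrict_space_iff)
    then show ?thesis
    proof eventually_elim
      case (elim t)
      then have "(\<lambda>n. ?g n t) \<longlonglongrightarrow> indicator S t *\<^sub>R h t"
        by (cases "t \<in> S") auto
      then show ?case by (rule limI)
    qed
  qed
  from borel_measurable_AE[OF m this] show ?thesis
    using S by (simp add: borel_measurable_restrict_space_iff)
qed

text \<open>Measurability of the pairing is derived from the approximating simple functions, which
  requires no separability of \<open>l2\<close>.\<close>
lemma L1_L2_inner_measurable:
  assumes D: "D \<in> sets lebesgue" and \<phi>: "\<phi> \<in> L1_L2 a b D" and U: "continuous_on UNIV U"
  shows "(\<lambda>t. inner (U t) (cls D (\<phi> t))) \<in> borel_measurable (lebesgue_on {a..b})"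
proof -
  have \<phi>L: "\<And>t. t \<in> {a..b} \<Longrightarrow> \<phi> t \<in> L2 D"
    using \<phi> by (auto simp: L1_L2_def L2_strongly_measurable_def)
  obtain s where s: "\<And>n. simple_function (lebesgue_on {a..b}) (s n)"
    "\<And>n t. t \<in> {a..b} \<Longrightarrow> s n t \<in> L2 D"
    "AE t in lebesgue_on {a..b}. (\<lambda>n. L2_norm D (\<lambda>x. s n t x - \<phi> t x)) \<longlonglongrightarrow> 0"
    using \<phi> unfolding L1_L2_def L2_strongly_measurable_def by blast
  show ?thesis
  proof (rule AE_limit_lebesgue_on_measurable)
    show "(\<lambda>t. inner (U t) (cls D (s n t))) \<in> borel_measurable (lebesgue_on {a..b})" for n
    proof (rule inner_simple_function_measurable)
      show "simple_function (lebesgue_on {a..b}) (\<lambda>t. cls D (s n t))"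
        using s(1) by (rule simple_function_compose1)
      have "(\<lambda>t. inner (U t) y) \<in> borel_measurable lebesgue" for y
        by (intro continuous_imp_lebesgue_measurable continuous_intros U)
      then show "(\<lambda>t. inner (U t) y) \<in> borel_measurable (lebesgue_on {a..b})" for y
        by (rule measurable_restrict_space1)
    qed
    have "AE t in lebesgue_on {a..b}. t \<in> {a..b}"
      by (rule AE_I2) simp
    with s(3) show "AE t in lebesgue_on {a..b}. (\<lambda>n. inner (U t) (cls D (s n t))) \<longlonglongrightarrow> inner (U t) (cls D (\<phi> t))"
    proof eventually_elim
      case (elim t)
      then have "(\<lambda>n. norm (cls D (s n t) - cls D (\<phi> t))) \<longlonglongrightarrow> 0"
        using s(2) \<phi>L by (simp add: L2_norm_cls[OF D L2_diff[OF D]] cls_diff[OF D])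
      then have "(\<lambda>n. cls D (s n t)) \<longlonglongrightarrow> cls D (\<phi> t)"
        by (simp add: tendsto_norm_zero_iff LIM_zero_iff)
      then show ?case by (intro tendsto_intros)
    qed
  qed simp
qed

lemma weak_star_from_pointwise_weak:
  assumes D: "D \<in> sets lebesgue"
    and u: "\<And>n t. u n t \<in> L2 D" "\<And>n. continuous_on UNIV (\<lambda>t. cls D (u n t))"
    and u0: "\<And>t. u0 t \<in> L2 D" "continuous_on UNIV (\<lambda>t. cls D (u0 t))"
    and weak: "\<And>t. weakly_tendsto (\<lambda>n. cls D (u n t)) (cls D (u0 t))"
    and B: "\<And>n t. t \<in> {a..b} \<Longrightarrow> norm (cls D (u n t)) \<le> B"
    and \<phi>: "\<phi> \<in> L1_L2 a b D"
  shows "(\<lambda>n. LINT t|lebesgue_on {a..b}. LINT x|lebesgue_on D. u n t x * \<phi> t x)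
    \<longlonglongrightarrow> (LINT t|lebesgue_on {a..b}. LINT x|lebesgue_on D. u0 t x * \<phi> t x)"
proof -
  have \<phi>L: "\<And>t. t \<in> {a..b} \<Longrightarrow> \<phi> t \<in> L2 D"
    using \<phi> by (auto simp: L1_L2_def L2_strongly_measurable_def)
  have eq: "(LINT t|lebesgue_on {a..b}. LINT x|lebesgue_on D. w t x * \<phi> t x)
      = (LINT t|lebesgue_on {a..b}. inner (cls D (w t)) (cls D (\<phi> t)))" if "\<And>t. w t \<in> L2 D" for w
    using integral_cls[OF D that \<phi>L] by (intro Bochner_Integration.integral_cong) auto
  have "(\<lambda>n. LINT t|lebesgue_on {a..b}. inner (cls D (u n t)) (cls D (\<phi> t)))
    \<longlonglongrightarrow> (LINT t|lebesgue_on {a..b}. inner (cls D (u0 t)) (cls D (\<phi> t)))"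
  proof (rule integral_dominated_convergence)
    show "integrable (lebesgue_on {a..b}) (\<lambda>t. B * L2_norm D (\<phi> t))"
      using \<phi> by (auto simp: L1_L2_def)
    show "AE t in lebesgue_on {a..b}. (\<lambda>n. inner (cls D (u n t)) (cls D (\<phi> t))) \<longlonglongrightarrow> inner (cls D (u0 t)) (cls D (\<phi> t))"
      using weak by (auto simp: weakly_tendsto_def)
    show "AE t in lebesgue_on {a..b}. norm (inner (cls D (u n t)) (cls D (\<phi> t))) \<le> B * L2_norm D (\<phi> t)" for n
    proof (rule AE_I2)
      fix t assume "t \<in> space (lebesgue_on {a..b})"
      then have t: "t \<in> {a..b}" by simp
      have "norm (inner (cls D (u n t)) (cls D (\<phi> t))) \<le> norm (cls D (u n t)) * norm (cls D (\<phi> t))"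
        by (simp add: Cauchy_Schwarz_ineq2)
      also have "\<dots> \<le> B * norm (cls D (\<phi> t))" using B[OF t] by (rule mult_right_mono) simp
      finally show "norm (inner (cls D (u n t)) (cls D (\<phi> t))) \<le> B * L2_norm D (\<phi> t)"
        by (simp add: L2_norm_cls[OF D \<phi>L[OF t]])
    qed
  qed (intro L1_L2_inner_measurable D \<phi> u u0)+
  then show ?thesis by (simp add: eq u u0)
qed

lemma rep_cls: "D \<in> sets lebesgue \<Longrightarrow> f \<in> L2 D \<Longrightarrow> AE x in lebesgue. rep_l2 (cls D f) x = indicator D x * f x"
  unfolding cls_def by (rule rep_abs_l2) (simp add: L2_iff_cut[of D])

lemma cls_rep_cls:
  assumes D: "D \<in> sets lebesgue" and f: "f \<in> L2 D"
  shows "cls D (rep_l2 (cls D f)) = cls D f"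
proof -
  have fc: "(\<lambda>x. indicator D x * f x) \<in> L2 UNIV" using f by (simp add: L2_iff_cut[OF D])
  have "AE x in lebesgue. indicator D x * rep_l2 (cls D f) x = indicator D x * f x"
    using rep_cls[OF D f] by eventually_elim (simp add: indicator_def)
  then have "abs_l2 (\<lambda>x. indicator D x * rep_l2 (cls D f) x) = abs_l2 (\<lambda>x. indicator D x * f x)"
    by (simp add: abs_l2_eq_iff[OF L2_UNIV_cut[OF D rep_l2_L2] fc])
  then show ?thesis unfolding cls_def[of D f] cls_def[of D "rep_l2 _"] .
qed

lemma bounded_linear_cls_rep:
  assumes D: "D \<in> sets lebesgue"
  shows "bounded_linear (\<lambda>v. cls D (rep_l2 v))"
proof (rule bounded_linear_intro)
  have c: "(\<lambda>x. indicator D x * rep_l2 v x) \<in> L2 UNIV" for v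
    by (rule L2_UNIV_cut[OF D rep_l2_L2])
  fix v w :: "'a l2" and r :: real
  show "cls D (rep_l2 (v + w)) = cls D (rep_l2 v) + cls D (rep_l2 w)"
    unfolding cls_def abs_l2_add[OF c c]
    using rep_l2_add[of v w] by (subst abs_l2_eq_iff[OF c L2_UNIV_add[OF c c]]) (auto simp: distrib_left)
  show "cls D (rep_l2 (r *\<^sub>R v)) = r *\<^sub>R cls D (rep_l2 v)"
    unfolding cls_def abs_l2_scaleR[OF c]
    using rep_l2_scaleR[of r v] by (subst abs_l2_eq_iff[OF c L2_UNIV_scale[OF c]]) auto
  have "norm (cls D (rep_l2 v)) \<le> 1 * norm v"
    unfolding cls_def using c[of v]
    by (intro norm_l2_dominated) (auto simp: L2_UNIV_iff indicator_def)
  then show "norm (cls D (rep_l2 v)) \<le> norm v * 1" by simp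
qed

section \<open>The nonlocal operators\<close>

text \<open>Averages over balls depend continuously on the centre, because spheres are null sets.\<close>

lemma continuous_ball_integral:
  fixes f :: "'a::euclidean_space \<Rightarrow> real"
  assumes f: "integrable lebesgue f"
  shows "continuous_on UNIV (\<lambda>x. LINT y:ball x \<delta>|lebesgue. f y)"
  unfolding continuous_on_sequentially comp_def
proof safe
  fix x and z :: "nat \<Rightarrow> 'a" assume z: "z \<longlonglongrightarrow> x"
  show "(\<lambda>n. LINT y:ball (z n) \<delta>|lebesgue. f y) \<longlonglongrightarrow> (LINT y:ball x \<delta>|lebesgue. f y)"
    unfolding set_lebesgue_integral_def
  proof (rule integral_dominated_convergence[where w = "\<lambda>y. \<bar>f y\<bar>"])
    have "sphere x \<delta> \<in> null_sets lebesgue"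
      using negligible_sphere[of x \<delta>] by (simp add: negligible_iff_null_sets)
    then have "AE y in lebesgue. y \<notin> sphere x \<delta>" by (rule AE_not_in)
    then show "AE y in lebesgue. (\<lambda>n. indicat_real (ball (z n) \<delta>) y *\<^sub>R f y) \<longlonglongrightarrow> indicat_real (ball x \<delta>) y *\<^sub>R f y"
    proof eventually_elim
      case (elim y)
      have d: "(\<lambda>n. dist (z n) y) \<longlonglongrightarrow> dist x y" by (intro tendsto_intros z)
      have "\<forall>\<^sub>F n in sequentially. indicat_real (ball (z n) \<delta>) y = indicat_real (ball x \<delta>) y"
      proof (cases "dist x y < \<delta>")
        case True
        from order_tendstoD(2)[OF d True] show ?thesis
          by eventually_elim (use True in \<open>auto simp: indicator_def\<close>)
      next
        case False
        then have "\<delta> < dist x y" using elim by auto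
        from order_tendstoD(1)[OF d this] show ?thesis
          by eventually_elim (use False in \<open>auto simp: indicator_def\<close>)
      qed
      then show ?case
        by (intro tendsto_eventually) (auto elim: eventually_mono)
    qed
    show "AE y in lebesgue. norm (indicat_real (ball (z n) \<delta>) y *\<^sub>R f y) \<le> \<bar>f y\<bar>" for n
      by (auto simp: indicator_def)
  qed (use f in \<open>auto intro!: borel_measurable_indicator borel_measurable_times\<close>)
qed

text \<open>The data of the nonlocal problem that do not depend on the holes.\<close>
locale nonlocal_problem =
  fixes \<Omega> :: "'a::euclidean_space set" and J :: "'a \<Rightarrow> real" and g :: "real \<Rightarrow> real" and Lg \<delta> :: real
  assumes open_Omega: "open \<Omega>" and bounded_Omega: "bounded \<Omega>"
    and J_cont: "continuous_on UNIV J" and J_nonneg: "\<And>x. J x \<ge> 0" and J_even: "\<And>x. J (- x) = J x"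
    and J_int: "has_bochner_integral lebesgue J 1"
    and g_lip: "Lg-lipschitz_on UNIV g"
    and delta_pos: "\<delta> > 0"
begin

lemma Omega_lebesgue [measurable, simp]: "\<Omega> \<in> sets lebesgue"
  using open_Omega by auto

lemma Omega_lmeasurable [simp]: "\<Omega> \<in> lmeasurable"
  using open_Omega bounded_Omega by (simp add: lmeasurable_open)

lemma J_measurable [measurable]: "J \<in> borel_measurable lebesgue"
  by (rule continuous_imp_lebesgue_measurable[OF J_cont])

lemma J_shift_measurable [measurable]: "(\<lambda>y. J (x - y)) \<in> borel_measurable lebesgue"
  by (intro continuous_imp_lebesgue_measurable continuous_on_compose2[OF J_cont] continuous_intros) auto

lemma J_shift: "has_bochner_integral lebesgue (\<lambda>y. J (x - y)) 1"
proof -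
  have Jb: "J \<in> borel_measurable borel" using J_cont by (rule borel_measurable_continuous_onI)
  have "has_bochner_integral lborel J 1"
    using J_int Jb by (simp add: has_bochner_integral_iff integrable_completion integral_completion)
  then have "has_bochner_integral (distr lborel borel ((+) (- x))) J 1"
    by (simp only: lborel_distr_plus)
  then have "has_bochner_integral lborel (\<lambda>y. J (- x + y)) 1"
    using Jb by (simp add: has_bochner_integral_iff integrable_distr_eq integral_distr)
  moreover have "(\<lambda>y. J (- x + y)) = (\<lambda>y. J (x - y))"
    using J_even[of "x - _"] by (auto simp: algebra_simps)
  moreover have "(\<lambda>y. J (x - y)) \<in> borel_measurable lborel"
    using Jb by measurable
  ultimately show ?thesis
    by (simp add: has_bochner_integral_iff integrable_completion integral_completion)
qed

lemma J_shift_integrable [simp]: "integrable lebesgue (\<lambda>y. J (x - y))"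
  using J_shift by (rule integrable.intros)

lemma J_shift_integral [simp]: "(LINT y|lebesgue. J (x - y)) = 1"
  using J_shift by (rule has_bochner_integral_integral_eq)

lemma J_bounded_near:
  assumes "bounded S"
  shows "\<exists>C>0. \<forall>x\<in>S. \<forall>y\<in>\<Omega>. J (x - y) \<le> C"
proof -
  have "bounded (\<Union>x\<in>S. \<Union>y\<in>\<Omega>. {x - y})" by (intro bounded_differences assms bounded_Omega)
  then have "compact (closure (\<Union>x\<in>S. \<Union>y\<in>\<Omega>. {x - y}))" by simp
  then have "bounded (J ` closure (\<Union>x\<in>S. \<Union>y\<in>\<Omega>. {x - y}))"
    by (intro compact_imp_bounded compact_continuous_image continuous_on_subset[OF J_cont]) auto
  then obtain C where "C > 0" and C: "\<And>z. z \<in> closure (\<Union>x\<in>S. \<Union>y\<in>\<Omega>. {x - y}) \<Longrightarrow> norm (J z) \<le> C"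
    unfolding bounded_pos by blast
  have "J (x - y) \<le> C" if "x \<in> S" "y \<in> \<Omega>" for x y
  proof -
    have "x - y \<in> closure (\<Union>x\<in>S. \<Union>y\<in>\<Omega>. {x - y})"
      using that by (intro subsetD[OF closure_subset]) auto
    from C[OF this] show ?thesis by simp
  qed
  then show ?thesis using \<open>C > 0\<close> by blast
qed

lemma continuous_J_convolution:
  assumes f: "integrable lebesgue f" and out: "\<And>x. x \<notin> \<Omega> \<Longrightarrow> f x = 0"
  shows "continuous_on UNIV (\<lambda>x. LINT y|lebesgue. J (x - y) * f y)"
  unfolding continuous_on_sequentially comp_def
proof safe
  fix x and z :: "nat \<Rightarrow> 'a" assume z: "z \<longlonglongrightarrow> x"
  have "bounded (range z)" using z by (rule convergent_imp_bounded)
  then obtain C where C: "C > 0" "\<And>n y. y \<in> \<Omega> \<Longrightarrow> J (z n - y) \<le> C"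
    using J_bounded_near[of "range z"] by auto
  show "(\<lambda>n. LINT y|lebesgue. J (z n - y) * f y) \<longlonglongrightarrow> (LINT y|lebesgue. J (x - y) * f y)"
  proof (rule integral_dominated_convergence[where w = "\<lambda>y. C * \<bar>f y\<bar>"])
    show "AE y in lebesgue. (\<lambda>n. J (z n - y) * f y) \<longlonglongrightarrow> J (x - y) * f y"
      using J_cont by (intro AE_I2 tendsto_intros z continuous_on_tendsto_compose[OF J_cont]) auto
    show "AE y in lebesgue. norm (J (z n - y) * f y) \<le> C * \<bar>f y\<bar>" for n
    proof (rule AE_I2)
      fix y show "norm (J (z n - y) * f y) \<le> C * \<bar>f y\<bar>"
        using C(2)[of y n] out[of y] J_nonneg[of "z n - y"]
        by (cases "y \<in> \<Omega>") (auto simp: abs_mult intro!: mult_right_mono)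
    qed
  qed (use f in auto)
qed

text \<open>Evaluation of \<open>J * v\<close> at \<open>x\<close> and integration of \<open>v\<close> over the ball around \<open>x\<close> are inner products
  with the vectors \<open>kern x\<close> and \<open>ball_ind x\<close> (see \<open>inner_kern\<close> and \<open>inner_ball_ind\<close>); both involve only
  the values of \<open>v\<close> on \<open>\<Omega>\<close>.\<close>
definition kern :: "'a \<Rightarrow> 'a l2" where
  "kern x = abs_l2 (\<lambda>y. indicator \<Omega> y * J (x - y))"

definition ball_ind :: "'a \<Rightarrow> 'a l2" where
  "ball_ind x = abs_l2 (\<lambda>y. indicator \<Omega> y * indicator (ball x \<delta>) y)"

text \<open>The denominators of the averages.\<close>
definition ball_mass :: "('a \<Rightarrow> real) \<Rightarrow> 'a \<Rightarrow> real" where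
  "ball_mass \<theta> x = (LINT y:ball x \<delta>|lebesgue. \<theta> y)"

text \<open>The sum $(J * v)(x) + g(m_\theta(x,v))$.\<close>
definition gain :: "('a \<Rightarrow> real) \<Rightarrow> 'a l2 \<Rightarrow> 'a \<Rightarrow> real" where
  "gain \<theta> v x = inner v (kern x) + g (inner v (ball_ind x) / ball_mass \<theta> x)"

text \<open>The coefficient $h_\theta$; for a perforated domain it is \<open>h_coeff\<close>, in the limit it is \<open>Lambda_coeff + X\<close>.\<close>
definition loss :: "('a \<Rightarrow> real) \<Rightarrow> 'a \<Rightarrow> real" where
  "loss \<theta> x = (LINT y|lebesgue. J (x - y) * (1 - indicator \<Omega> y + \<theta> y))"

text \<open>The vector field $F_\theta$. No cut-off to \<open>\<Omega>\<close> is needed in the gain term, because weights vanish outside \<open>\<Omega>\<close>.\<close>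
definition drift :: "('a \<Rightarrow> real) \<Rightarrow> 'a l2 \<Rightarrow> 'a l2" where
  "drift \<theta> v = abs_l2 (\<lambda>x. \<theta> x * gain \<theta> v x) - abs_l2 (\<lambda>x. indicator \<Omega> x * loss \<theta> x * rep_l2 v x)"

text \<open>The number $|\Omega|^{1/2}$.\<close>
definition Omega_norm :: real where
  "Omega_norm = norm (abs_l2 (indicator \<Omega> :: 'a \<Rightarrow> real))"

text \<open>A bound for the kernel on differences of points of \<open>\<Omega>\<close>, chosen once and for all.\<close>
definition J_sup :: real where
  "J_sup = (SOME C. C > 0 \<and> (\<forall>x\<in>\<Omega>. \<forall>y\<in>\<Omega>. J (x - y) \<le> C))"

lemma J_sup: "J_sup > 0" "x \<in> \<Omega> \<Longrightarrow> y \<in> \<Omega> \<Longrightarrow> J (x - y) \<le> J_sup"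
proof -
  have "J_sup > 0 \<and> (\<forall>x\<in>\<Omega>. \<forall>y\<in>\<Omega>. J (x - y) \<le> J_sup)"
    unfolding J_sup_def by (rule someI_ex) (use J_bounded_near[OF bounded_Omega] in blast)
  then show "J_sup > 0" "x \<in> \<Omega> \<Longrightarrow> y \<in> \<Omega> \<Longrightarrow> J (x - y) \<le> J_sup" by auto
qed

lemma Omega_norm_nonneg [simp]: "Omega_norm \<ge> 0"
  by (simp add: Omega_norm_def)

lemma bounded_on_Omega:
  assumes "f \<in> borel_measurable lebesgue" "AE x in lebesgue. \<bar>f x\<bar> \<le> C * indicator \<Omega> x" "C \<ge> 0"
  shows "f \<in> L2 UNIV" "norm (abs_l2 f) \<le> C * Omega_norm"
proof -
  note ind = L2_UNIV_indicator[OF Omega_lmeasurable]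
  show "f \<in> L2 UNIV"
    using assms by (intro L2_UNIV_dominated[OF ind, of f C]) auto
  have "AE x in lebesgue. \<bar>f x\<bar> \<le> C * \<bar>rep_l2 (abs_l2 (indicator \<Omega>)) x\<bar>"
    using assms(2) rep_abs_l2[OF ind] by eventually_elim simp
  then show "norm (abs_l2 f) \<le> C * Omega_norm"
    unfolding Omega_norm_def by (intro norm_l2_dominated assms)
qed

lemma ind_J_L2: "(\<lambda>y. indicator \<Omega> y * J (x - y)) \<in> L2 UNIV"
proof -
  obtain C where "C > 0" "\<And>y. y \<in> \<Omega> \<Longrightarrow> J (x - y) \<le> C"
    using J_bounded_near[of "{x}"] by auto
  then show ?thesis
    using J_nonneg by (intro bounded_on_Omega(1)[where C=C]) (auto simp: indicator_def)
qed

lemma norm_kern: "x \<in> \<Omega> \<Longrightarrow> norm (kern x) \<le> J_sup * Omega_norm"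
  unfolding kern_def using J_sup J_nonneg
  by (intro bounded_on_Omega(2)) (auto simp: indicator_def less_imp_le)

lemma ind_ball_L2: "(\<lambda>y. indicator \<Omega> y * indicator (ball x \<delta>) y) \<in> L2 UNIV"
  by (intro L2_UNIV_cut L2_UNIV_indicator) auto

lemma norm_ball_ind: "norm (ball_ind x) \<le> Omega_norm"
proof -
  have "norm (ball_ind x) \<le> 1 * Omega_norm"
    unfolding ball_ind_def
  proof (rule bounded_on_Omega(2))
    show "(\<lambda>y. indicat_real \<Omega> y * indicator (ball x \<delta>) y) \<in> borel_measurable lebesgue"
      using ind_ball_L2[of x] by (simp add: L2_UNIV_iff)
  qed (auto simp: indicator_def)
  then show ?thesis by simp
qed

lemma inner_kern:
  assumes "f \<in> L2 UNIV"
  shows "inner (abs_l2 f) (kern x) = (LINT y|lebesgue. J (x - y) * (indicator \<Omega> y * f y))"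
  unfolding kern_def inner_abs_l2[OF assms ind_J_L2] by (simp add: mult_ac)

lemma inner_ball_ind:
  assumes "f \<in> L2 UNIV"
  shows "inner (abs_l2 f) (ball_ind x) = (LINT y:ball x \<delta>|lebesgue. indicator \<Omega> y * f y)"
  unfolding ball_ind_def inner_abs_l2[OF assms ind_ball_L2] by (simp add: set_lebesgue_integral_def mult_ac)

lemma cut_integrable:
  assumes "f \<in> L2 UNIV"
  shows "integrable lebesgue (\<lambda>y. indicator \<Omega> y * f y)"
  by (rule L2_UNIV_mult_integrable[OF L2_UNIV_indicator[OF Omega_lmeasurable] assms])

lemma continuous_inner_kern: "continuous_on UNIV (\<lambda>x. inner v (kern x))"
  using continuous_J_convolution[OF cut_integrable[OF rep_l2_L2[of v]]] inner_kern[OF rep_l2_L2[of v]]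
  by simp

lemma continuous_inner_ball_ind: "continuous_on UNIV (\<lambda>x. inner v (ball_ind x))"
  using continuous_ball_integral[OF cut_integrable[OF rep_l2_L2[of v]]] inner_ball_ind[OF rep_l2_L2[of v]]
  by simp

text \<open>The weights \<open>\<theta>\<close> that occur, characteristic functions of perforated domains and their weak limits,
  with a bound \<open>M\<close> that holds almost everywhere and a lower bound \<open>\<kappa>\<close> for the masses of balls
  centred in \<open>\<Omega>\<close>.\<close>

definition weight :: "real \<Rightarrow> real \<Rightarrow> ('a \<Rightarrow> real) \<Rightarrow> bool" where
  "weight M \<kappa> \<theta> \<longleftrightarrow> \<theta> \<in> borel_measurable lebesgue \<and> (AE x in lebesgue. \<bar>\<theta> x\<bar> \<le> M) \<and>
     (\<forall>x. x \<notin> \<Omega> \<longrightarrow> \<theta> x = 0) \<and> (\<forall>x\<in>\<Omega>. \<kappa> \<le> ball_mass \<theta> x) \<and> M \<ge> 0 \<and> \<kappa> > 0"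

text \<open>The Lipschitz constant of \<open>drift \<theta>\<close>, which depends on the weight only through its bounds.\<close>
definition lip_const :: "real \<Rightarrow> real \<Rightarrow> real" where
  "lip_const M \<kappa> = M * (J_sup * Omega_norm + Lg * (Omega_norm / \<kappa>)) * Omega_norm + (1 + M)"

context
  fixes M \<kappa> \<theta> assumes \<theta>: "weight M \<kappa> \<theta>"
begin

lemma weightD:
  shows weight_measurable: "\<theta> \<in> borel_measurable lebesgue" and weight_bound: "AE x in lebesgue. \<bar>\<theta> x\<bar> \<le> M"
    and weight_outside: "\<And>x. x \<notin> \<Omega> \<Longrightarrow> \<theta> x = 0" and weight_mass: "\<And>x. x \<in> \<Omega> \<Longrightarrow> \<kappa> \<le> ball_mass \<theta> x"
    and M_nonneg: "M \<ge> 0" and kappa_pos: "\<kappa> > 0"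
  using \<theta> by (auto simp: weight_def)

lemma weight_integrable: "integrable lebesgue \<theta>"
proof (rule Bochner_Integration.integrable_bound)
  show "integrable lebesgue (\<lambda>x. M * indicator \<Omega> x)"
    using Omega_lmeasurable by (auto simp: lmeasurable_iff_integrable)
  show "AE x in lebesgue. norm (\<theta> x) \<le> norm (M * indicator \<Omega> x)"
    using weight_bound by eventually_elim (use weight_outside M_nonneg in \<open>auto simp: indicator_def\<close>)
qed (rule weight_measurable)

lemma gain_lipschitz:
  assumes x: "x \<in> \<Omega>"
  shows "\<bar>gain \<theta> v x - gain \<theta> w x\<bar> \<le> (J_sup * Omega_norm + Lg * (Omega_norm / \<kappa>)) * norm (v - w)"
proof -
  have W: "\<kappa> \<le> ball_mass \<theta> x" "\<kappa> > 0" using weight_mass[OF x] kappa_pos by auto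
  have Lg: "Lg \<ge> 0" using g_lip by (rule lipschitz_on_nonneg)
  have "\<bar>inner v (ball_ind x) / ball_mass \<theta> x - inner w (ball_ind x) / ball_mass \<theta> x\<bar>
      = \<bar>inner (v - w) (ball_ind x)\<bar> / ball_mass \<theta> x"
    using W by (simp add: inner_diff_left flip: diff_divide_distrib)
  also have "\<dots> \<le> (norm (v - w) * Omega_norm) / \<kappa>"
    using W order_trans[OF Cauchy_Schwarz_ineq2[of "v - w" "ball_ind x"] mult_left_mono[OF norm_ball_ind]]
    by (intro frac_le) auto
  finally have "\<bar>inner v (ball_ind x) / ball_mass \<theta> x - inner w (ball_ind x) / ball_mass \<theta> x\<bar>
      \<le> norm (v - w) * Omega_norm / \<kappa>" .
  then have 1: "Lg * \<bar>inner v (ball_ind x) / ball_mass \<theta> x - inner w (ball_ind x) / ball_mass \<theta> x\<bar>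
      \<le> Lg * (norm (v - w) * Omega_norm / \<kappa>)"
    using Lg by (rule mult_left_mono)
  have 2: "\<bar>g (inner v (ball_ind x) / ball_mass \<theta> x) - g (inner w (ball_ind x) / ball_mass \<theta> x)\<bar>
      \<le> Lg * \<bar>inner v (ball_ind x) / ball_mass \<theta> x - inner w (ball_ind x) / ball_mass \<theta> x\<bar>"
    using lipschitz_onD[OF g_lip] by (simp add: dist_real_def)
  have "\<bar>inner v (kern x) - inner w (kern x)\<bar> \<le> norm (v - w) * norm (kern x)"
    using Cauchy_Schwarz_ineq2[of "v - w" "kern x"] by (simp add: inner_diff_left)
  also have "\<dots> \<le> norm (v - w) * (J_sup * Omega_norm)"
    using norm_kern[OF x] by (intro mult_left_mono) auto
  finally have "\<bar>gain \<theta> v x - gain \<theta> w x\<bar> \<le>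
      norm (v - w) * (J_sup * Omega_norm) + Lg * (norm (v - w) * Omega_norm / \<kappa>)"
    using 1 2 unfolding gain_def by linarith
  then show ?thesis by (simp add: algebra_simps)
qed

lemma gain_bound:
  assumes x: "x \<in> \<Omega>"
  shows "\<bar>gain \<theta> v x\<bar> \<le> (J_sup * Omega_norm + Lg * (Omega_norm / \<kappa>)) * norm v + \<bar>g 0\<bar>"
proof -
  have "gain \<theta> 0 x = g 0" by (simp add: gain_def)
  then show ?thesis using gain_lipschitz[OF x, of v 0] by simp
qed

lemma gain_measurable: "(\<lambda>x. indicator \<Omega> x * gain \<theta> v x) \<in> borel_measurable lebesgue"
proof (rule continuous_on_lebesgue_measurable_indicator[OF open_Omega])
  have "continuous_on \<Omega> (ball_mass \<theta>)"
    unfolding ball_mass_def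
    by (rule continuous_on_subset[OF continuous_ball_integral[OF weight_integrable]]) auto
  then have "continuous_on \<Omega> (\<lambda>x. inner v (ball_ind x) / ball_mass \<theta> x)"
    using weight_mass kappa_pos
    by (intro continuous_intros continuous_on_subset[OF continuous_inner_ball_ind]) force+
  then have "continuous_on \<Omega> (\<lambda>x. g (inner v (ball_ind x) / ball_mass \<theta> x))"
    by (intro continuous_on_compose2[OF lipschitz_on_continuous_on[OF g_lip]]) auto
  then show "continuous_on \<Omega> (gain \<theta> v)"
    unfolding gain_def[abs_def]
    by (intro continuous_intros continuous_on_subset[OF continuous_inner_kern]) auto
qed

lemma weight_gain_measurable: "(\<lambda>x. \<theta> x * gain \<theta> v x) \<in> borel_measurable lebesgue"
proof -
  have "(\<lambda>x. \<theta> x * gain \<theta> v x) = (\<lambda>x. \<theta> x * (indicator \<Omega> x * gain \<theta> v x))"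
    by (rule ext) (metis indicator_simps mult_1 mult_zero_left weight_outside)
  then show ?thesis using gain_measurable weight_measurable by simp
qed

lemma weight_gain_L2: "(\<lambda>x. \<theta> x * gain \<theta> v x) \<in> L2 UNIV"
proof -
  let ?C = "(J_sup * Omega_norm + Lg * (Omega_norm / \<kappa>)) * norm v + \<bar>g 0\<bar>"
  have C: "?C \<ge> 0"
    using lipschitz_on_nonneg[OF g_lip] J_sup(1) kappa_pos by simp
  show ?thesis
  proof (rule bounded_on_Omega(1)[OF weight_gain_measurable])
    show "AE x in lebesgue. \<bar>\<theta> x * gain \<theta> v x\<bar> \<le> (M * ?C) * indicator \<Omega> x"
      using weight_bound
    proof eventually_elim
      case (elim x)
      show ?case
        using elim gain_bound[of x v] M_nonneg C weight_outside[of x]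
        by (cases "x \<in> \<Omega>") (auto simp: abs_mult intro!: mult_mono)
    qed
    show "M * ?C \<ge> 0" using M_nonneg C by simp
  qed
qed

text \<open>In this form the coefficient is the convolution of \<open>J\<close> with a function that vanishes outside \<open>\<Omega>\<close>,
  which is continuous.\<close>
lemma loss_eq: "loss \<theta> x = 1 - (LINT y|lebesgue. J (x - y) * (indicator \<Omega> y - \<theta> y))"
proof -
  have i: "integrable lebesgue (\<lambda>y. J (x - y) * (indicator \<Omega> y - \<theta> y))"
  proof (rule Bochner_Integration.integrable_bound)
    show "integrable lebesgue (\<lambda>y. (1 + M) * J (x - y))" by simp
    show "AE y in lebesgue. norm (J (x - y) * (indicator \<Omega> y - \<theta> y)) \<le> norm ((1 + M) * J (x - y))"
      using weight_bound
    proof eventually_elim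
      case (elim y)
      have "\<bar>indicator \<Omega> y - \<theta> y\<bar> \<le> 1 + M" using elim by (auto simp: indicator_def)
      then have "\<bar>J (x - y)\<bar> * \<bar>indicator \<Omega> y - \<theta> y\<bar> \<le> \<bar>J (x - y)\<bar> * (1 + M)" by (intro mult_left_mono) auto
      then show ?case using M_nonneg by (simp add: abs_mult mult.commute)
    qed
  qed (use weight_measurable in measurable)
  have "loss \<theta> x = (LINT y|lebesgue. J (x - y) - J (x - y) * (indicator \<Omega> y - \<theta> y))"
    unfolding loss_def by (intro Bochner_Integration.integral_cong) (auto simp: algebra_simps)
  also have "\<dots> = 1 - (LINT y|lebesgue. J (x - y) * (indicator \<Omega> y - \<theta> y))"
    using i by (simp add: Bochner_Integration.integral_diff)
  finally show ?thesis .
qed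

lemma loss_continuous: "continuous_on UNIV (loss \<theta>)"
proof -
  have "integrable lebesgue (\<lambda>y. indicator \<Omega> y - \<theta> y)"
    using weight_integrable Omega_lmeasurable
    by (intro Bochner_Integration.integrable_diff) (auto simp: lmeasurable_iff_integrable)
  then have "continuous_on UNIV (\<lambda>x. LINT y|lebesgue. J (x - y) * (indicator \<Omega> y - \<theta> y))"
    by (rule continuous_J_convolution) (simp add: weight_outside)
  then show ?thesis unfolding loss_eq[abs_def] by (intro continuous_intros)
qed

lemma loss_measurable: "loss \<theta> \<in> borel_measurable lebesgue"
  by (rule continuous_imp_lebesgue_measurable[OF loss_continuous])

lemma loss_bound: "\<bar>loss \<theta> x\<bar> \<le> 1 + M"
proof -
  have bnd: "AE y in lebesgue. norm (J (x - y) * (1 - indicator \<Omega> y + \<theta> y)) \<le> (1 + M) * J (x - y)"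
    using weight_bound
  proof eventually_elim
    case (elim y)
    have "\<bar>1 - indicator \<Omega> y + \<theta> y\<bar> \<le> 1 + M" using elim by (auto simp: indicator_def)
    then have "\<bar>J (x - y)\<bar> * \<bar>1 - indicator \<Omega> y + \<theta> y\<bar> \<le> \<bar>J (x - y)\<bar> * (1 + M)" by (intro mult_left_mono) auto
    then show ?case using J_nonneg[of "x - y"] by (simp add: abs_mult mult.commute)
  qed
  have int: "integrable lebesgue (\<lambda>y. J (x - y) * (1 - indicator \<Omega> y + \<theta> y))"
  proof (rule Bochner_Integration.integrable_bound)
    show "integrable lebesgue (\<lambda>y. (1 + M) * J (x - y))" by simp
    show "AE y in lebesgue. norm (J (x - y) * (1 - indicator \<Omega> y + \<theta> y)) \<le> norm ((1 + M) * J (x - y))"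
      using bnd by eventually_elim (use M_nonneg in \<open>auto intro: order_trans\<close>)
  qed (use weight_measurable in measurable)
  have "norm (loss \<theta> x) \<le> (LINT y|lebesgue. norm (J (x - y) * (1 - indicator \<Omega> y + \<theta> y)))"
    unfolding loss_def by (rule integral_norm_bound)
  also have "\<dots> \<le> (LINT y|lebesgue. (1 + M) * J (x - y))"
    by (rule integral_mono_AE[OF integrable_norm[OF int] _ bnd]) simp
  finally show ?thesis by simp
qed

lemma ind_loss_measurable: "(\<lambda>x. indicator \<Omega> x * loss \<theta> x) \<in> borel_measurable lebesgue"
  using loss_measurable by measurable

lemma ind_loss_bound: "\<bar>indicator \<Omega> x * loss \<theta> x\<bar> \<le> 1 + M"
  using loss_bound[of x] M_nonneg by (auto simp: indicator_def)

lemma loss_L2: "f \<in> L2 UNIV \<Longrightarrow> (\<lambda>x. indicator \<Omega> x * loss \<theta> x * f x) \<in> L2 UNIV"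
  using ind_loss_bound by (intro L2_UNIV_mult_bounded[OF _ ind_loss_measurable]) auto

lemma norm_loss:
  "norm (abs_l2 (\<lambda>x. indicator \<Omega> x * loss \<theta> x * rep_l2 v x)) \<le> (1 + M) * norm v"
proof (rule norm_l2_dominated)
  show "(\<lambda>x. indicator \<Omega> x * loss \<theta> x * rep_l2 v x) \<in> borel_measurable lebesgue"
    using ind_loss_measurable by measurable
  show "AE x in lebesgue. \<bar>indicator \<Omega> x * loss \<theta> x * rep_l2 v x\<bar> \<le> (1 + M) * \<bar>rep_l2 v x\<bar>"
    using ind_loss_bound by (auto simp: abs_mult intro!: AE_I2 mult_right_mono simp del: times_divide_eq_left)
  show "1 + M \<ge> 0" using M_nonneg by simp
qed

lemma drift_lipschitz: "norm (drift \<theta> v - drift \<theta> w) \<le> lip_const M \<kappa> * norm (v - w)"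
proof -
  let ?C = "(J_sup * Omega_norm + Lg * (Omega_norm / \<kappa>)) * norm (v - w)"
  have C: "?C \<ge> 0"
    using lipschitz_on_nonneg[OF g_lip] J_sup(1) kappa_pos by simp
  let ?G = "\<lambda>v. abs_l2 (\<lambda>x. \<theta> x * gain \<theta> v x)" and ?H = "\<lambda>v. abs_l2 (\<lambda>x. indicator \<Omega> x * loss \<theta> x * rep_l2 v x)"
  have G: "norm (?G v - ?G w) \<le> M * ?C * Omega_norm"
    unfolding abs_l2_diff[OF weight_gain_L2 weight_gain_L2]
  proof (rule bounded_on_Omega(2))
    show "(\<lambda>x. \<theta> x * gain \<theta> v x - \<theta> x * gain \<theta> w x) \<in> borel_measurable lebesgue"
      using weight_gain_measurable by measurable
    show "AE x in lebesgue. \<bar>\<theta> x * gain \<theta> v x - \<theta> x * gain \<theta> w x\<bar> \<le> M * ?C * indicator \<Omega> x"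
      using weight_bound
    proof eventually_elim
      case (elim x)
      have "\<bar>\<theta> x * (gain \<theta> v x - gain \<theta> w x)\<bar> \<le> M * ?C * indicator \<Omega> x"
        using elim gain_lipschitz[of x v w] M_nonneg C weight_outside[of x]
        by (cases "x \<in> \<Omega>") (auto simp: abs_mult intro!: mult_mono)
      then show ?case by (simp add: right_diff_distrib)
    qed
    show "M * ?C \<ge> 0" using M_nonneg C by simp
  qed
  have "?H v - ?H w = ?H (v - w)"
    unfolding abs_l2_diff[OF loss_L2[OF rep_l2_L2] loss_L2[OF rep_l2_L2]]
  proof (subst abs_l2_eq_iff)
    show "AE x in lebesgue. indicator \<Omega> x * loss \<theta> x * rep_l2 v x - indicator \<Omega> x * loss \<theta> x * rep_l2 w x =
        indicator \<Omega> x * loss \<theta> x * rep_l2 (v - w) x"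
      using rep_l2_diff[of v w] by eventually_elim (simp only: right_diff_distrib)
  qed (simp_all add: L2_UNIV_diff loss_L2)
  then have H: "norm (?H v - ?H w) \<le> (1 + M) * norm (v - w)" using norm_loss[of "v - w"] by simp
  have diff_swap: "a - b - (c - d) = a - c - (b - d)" for a b c d :: "'a l2" by simp
  have "norm (drift \<theta> v - drift \<theta> w) = norm ((?G v - ?G w) - (?H v - ?H w))"
    unfolding drift_def by (rule arg_cong[of _ _ norm], rule diff_swap)
  also have "\<dots> \<le> M * ?C * Omega_norm + (1 + M) * norm (v - w)"
    by (rule order_trans[OF norm_triangle_ineq4 add_mono[OF G H]])
  finally show ?thesis by (simp add: lip_const_def algebra_simps)
qed

lemma norm_drift_0: "norm (drift \<theta> 0) \<le> M * \<bar>g 0\<bar> * Omega_norm"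
proof -
  have "norm (abs_l2 (\<lambda>x. \<theta> x * gain \<theta> 0 x)) \<le> (M * \<bar>g 0\<bar>) * Omega_norm"
  proof (rule bounded_on_Omega(2)[OF weight_gain_measurable])
    show "AE x in lebesgue. \<bar>\<theta> x * gain \<theta> 0 x\<bar> \<le> M * \<bar>g 0\<bar> * indicator \<Omega> x"
      using weight_bound
    proof eventually_elim
      case (elim x)
      show ?case
        using elim M_nonneg weight_outside[of x]
        by (cases "x \<in> \<Omega>") (auto simp: abs_mult gain_def intro!: mult_mono)
    qed
  qed (use M_nonneg in simp)
  moreover have "norm (abs_l2 (\<lambda>x. indicator \<Omega> x * loss \<theta> x * rep_l2 0 x)) \<le> (1 + M) * norm (0::'a l2)"
    by (rule norm_loss)
  moreover have "norm (drift \<theta> 0) \<le> norm (abs_l2 (\<lambda>x. \<theta> x * gain \<theta> 0 x))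
      + norm (abs_l2 (\<lambda>x. indicator \<Omega> x * loss \<theta> x * rep_l2 0 x))"
    unfolding drift_def by (rule norm_triangle_ineq4)
  ultimately show ?thesis by simp
qed

end

text \<open>The vector fields are continuous jointly in the weight, under weak* convergence, and in the
  argument, under weak convergence.\<close>
lemma weakly_tendsto_drift:
  assumes \<theta>: "\<And>n. weight M \<kappa> (\<theta> n)" and \<theta>0: "weight M \<kappa> \<theta>0"
    and conv: "\<And>\<phi>. integrable lebesgue \<phi> \<Longrightarrow>
      (\<lambda>n. LINT x|lebesgue. \<theta> n x * \<phi> x) \<longlonglongrightarrow> (LINT x|lebesgue. \<theta>0 x * \<phi> x)"
    and v: "\<And>n. norm (v n) \<le> C" and wv: "weakly_tendsto v v0"
  shows "weakly_tendsto (\<lambda>n. drift (\<theta> n) (v n)) (drift \<theta>0 v0)"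
proof -
  have M0: "M \<ge> 0" using \<theta>0 by (simp add: weight_def)
  have C0: "C \<ge> 0" using v[of 0] norm_ge_zero order_trans by blast
  define P where "P = (J_sup * Omega_norm + Lg * (Omega_norm / \<kappa>)) * max C (norm v0) + \<bar>g 0\<bar>"
  have nn: "J_sup * Omega_norm + Lg * (Omega_norm / \<kappa>) \<ge> 0"
    using lipschitz_on_nonneg[OF g_lip] J_sup(1) \<theta>0 by (simp add: weight_def)
  have Pn: "\<bar>gain (\<theta> n) (v n) x\<bar> \<le> P" if "x \<in> \<Omega>" for n x
  proof -
    have "norm (v n) \<le> max C (norm v0)" using v[of n] by simp
    from mult_left_mono[OF this nn] show ?thesis
      using gain_bound[OF \<theta>[of n] that, of "v n"] unfolding P_def by linarith
  qed
  have P0: "\<bar>gain \<theta>0 v0 x\<bar> \<le> P" if "x \<in> \<Omega>" for x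
    using gain_bound[OF \<theta>0 that, of v0] mult_left_mono[OF max.cobounded2[of "norm v0" C] nn]
    unfolding P_def by linarith
  have mass: "(\<lambda>n. ball_mass (\<theta> n) x) \<longlonglongrightarrow> ball_mass \<theta>0 x" for x
    using conv[of "indicator (ball x \<delta>)"]
    by (simp add: ball_mass_def set_lebesgue_integral_def mult.commute lmeasurable_iff_integrable[symmetric])
  have gain: "(\<lambda>n. gain (\<theta> n) (v n) x) \<longlonglongrightarrow> gain \<theta>0 v0 x" if "x \<in> \<Omega>" for x
  proof -
    have "ball_mass \<theta>0 x \<noteq> 0" using \<theta>0 that by (force simp: weight_def)
    then have "(\<lambda>n. inner (v n) (ball_ind x) / ball_mass (\<theta> n) x) \<longlonglongrightarrow> inner v0 (ball_ind x) / ball_mass \<theta>0 x"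
      using wv by (intro tendsto_divide mass) (auto simp: weakly_tendsto_def)
    then show ?thesis
      unfolding gain_def using wv
      by (intro tendsto_add continuous_on_tendsto_compose[OF lipschitz_on_continuous_on[OF g_lip]])
        (auto simp: weakly_tendsto_def)
  qed
  have loss: "(\<lambda>n. loss (\<theta> n) x) \<longlonglongrightarrow> loss \<theta>0 x" for x
  proof -
    have i1: "integrable lebesgue (\<lambda>y. J (x - y) * (1 - indicator \<Omega> y))"
      by (rule Bochner_Integration.integrable_bound[OF J_shift_integrable[of x]])
        (use J_nonneg in \<open>auto simp: indicator_def\<close>)
    have eq: "loss \<eta> x = (LINT y|lebesgue. J (x - y) * (1 - indicator \<Omega> y)) + (LINT y|lebesgue. \<eta> y * J (x - y))"
      if \<eta>: "weight M \<kappa> \<eta>" for \<eta>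
    proof -
      have "integrable lebesgue (\<lambda>y. \<eta> y * J (x - y))"
      proof (rule Bochner_Integration.integrable_bound)
        show "integrable lebesgue (\<lambda>y. M * J (x - y))" by simp
        show "AE y in lebesgue. norm (\<eta> y * J (x - y)) \<le> norm (M * J (x - y))"
          using weight_bound[OF \<eta>] by eventually_elim (use M0 in \<open>auto simp: abs_mult intro!: mult_right_mono\<close>)
      qed (use weight_measurable[OF \<eta>] in measurable)
      from Bochner_Integration.integral_add[OF i1 this] show ?thesis
        unfolding loss_def by (simp add: algebra_simps)
    qed
    show ?thesis unfolding eq[OF \<theta>] eq[OF \<theta>0] by (intro tendsto_intros conv) simp
  qed
  show ?thesis
    unfolding weakly_tendsto_def
  proof
    fix \<phi> :: "'a l2"
    let ?r = "rep_l2 \<phi>"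
    have iL2: "(\<lambda>x. (indicator \<Omega> x * gain \<eta> w x) * ?r x) \<in> L2 UNIV"
      if "weight M \<kappa> \<eta>" "\<And>x. x \<in> \<Omega> \<Longrightarrow> \<bar>gain \<eta> w x\<bar> \<le> P" for \<eta> w
    proof (rule L2_UNIV_mult_bounded[OF rep_l2_L2 gain_measurable[OF that(1)]])
      have "P \<ge> 0" using nn by (simp add: P_def C0 max_def)
      then show "AE x in lebesgue. \<bar>indicator \<Omega> x * gain \<eta> w x\<bar> \<le> P"
        using that(2) by (auto simp: indicator_def)
    qed
    have ind_mult: "integrable lebesgue (\<lambda>x. indicator \<Omega> x * f x)" if "f \<in> L2 UNIV" for f
      by (rule cut_integrable[OF that])
    \<comment> \<open>The gain terms converge strongly, so that their products with the weights converge weakly.\<close>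
    have G: "(\<lambda>n. inner (abs_l2 (\<lambda>x. \<theta> n x * gain (\<theta> n) (v n) x)) \<phi>)
        \<longlonglongrightarrow> inner (abs_l2 (\<lambda>x. \<theta>0 x * gain \<theta>0 v0 x)) \<phi>"
    proof -
      let ?d = "\<lambda>n x. \<theta> n x * (gain (\<theta> n) (v n) x - gain \<theta>0 v0 x) * ?r x"
      let ?e = "\<lambda>\<eta> x. \<eta> x * (indicator \<Omega> x * (indicator \<Omega> x * gain \<theta>0 v0 x * ?r x))"
      have ie: "integrable lebesgue (\<lambda>x. indicator \<Omega> x * (indicator \<Omega> x * gain \<theta>0 v0 x * ?r x))"
        by (intro ind_mult iL2 \<theta>0 P0)
      have ee: "(\<lambda>n. LINT x|lebesgue. ?e (\<theta> n) x) \<longlonglongrightarrow> (LINT x|lebesgue. ?e \<theta>0 x)"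
        by (rule conv[OF ie])
      have AEb: "AE x in lebesgue. \<forall>n. \<bar>\<theta> n x\<bar> \<le> M"
        using weight_bound[OF \<theta>] by (simp add: AE_all_countable)
      have dm: "?d n \<in> borel_measurable lebesgue" for n
      proof -
        have "?d n = (\<lambda>x. \<theta> n x * (indicator \<Omega> x * gain (\<theta> n) (v n) x - indicator \<Omega> x * gain \<theta>0 v0 x) * ?r x)"
          using weight_outside[OF \<theta>[of n]] by (auto simp: indicator_def fun_eq_iff)
        then show ?thesis
          using weight_measurable[OF \<theta>[of n]] gain_measurable[OF \<theta>[of n], of "v n"] gain_measurable[OF \<theta>0, of v0]
          by simp
      qed
      have db: "AE x in lebesgue. norm (?d n x) \<le> M * (2 * P) * \<bar>indicator \<Omega> x * ?r x\<bar>" for n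
        using AEb
      proof eventually_elim
        case (elim x)
        show ?case
        proof (cases "x \<in> \<Omega>")
          case True
          have "\<bar>gain (\<theta> n) (v n) x - gain \<theta>0 v0 x\<bar> \<le> 2 * P"
            using Pn[OF True, of n] P0[OF True] by linarith
          then have "\<bar>\<theta> n x\<bar> * \<bar>gain (\<theta> n) (v n) x - gain \<theta>0 v0 x\<bar> \<le> M * (2 * P)"
            using elim M0 by (intro mult_mono) auto
          from mult_right_mono[OF this, of "\<bar>?r x\<bar>"] show ?thesis
            using True by (simp add: abs_mult)
        qed (use weight_outside[OF \<theta>[of n]] in simp)
      qed
      have wi: "integrable lebesgue (\<lambda>x. M * (2 * P) * \<bar>indicator \<Omega> x * ?r x\<bar>)"
        by (intro integrable_mult_right integrable_abs cut_integrable rep_l2_L2)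
      have dd: "(\<lambda>n. LINT x|lebesgue. ?d n x) \<longlonglongrightarrow> (LINT x|(lebesgue::'a measure). 0)"
      proof (rule integral_dominated_convergence[OF _ dm wi _ db])
        show "AE x in lebesgue. (\<lambda>n. ?d n x) \<longlonglongrightarrow> 0"
          using AEb
        proof eventually_elim
          case (elim x)
          show ?case
          proof (cases "x \<in> \<Omega>")
            case True
            have "(\<lambda>n. \<theta> n x * (gain (\<theta> n) (v n) x - gain \<theta>0 v0 x)) \<longlonglongrightarrow> 0"
            proof (rule Lim_null_comparison)
              show "(\<lambda>n. M * \<bar>gain (\<theta> n) (v n) x - gain \<theta>0 v0 x\<bar>) \<longlonglongrightarrow> 0"
                using gain[OF True] by (intro tendsto_mult_right_zero tendsto_rabs_zero) (simp add: LIM_zero)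
            qed (use elim in \<open>auto simp: abs_mult intro!: always_eventually mult_right_mono\<close>)
            then show ?thesis by (rule tendsto_mult_left_zero)
          qed (use weight_outside[OF \<theta>] in simp)
        qed
      qed simp
      have split: "inner (abs_l2 (\<lambda>x. \<theta> n x * gain (\<theta> n) (v n) x)) \<phi> = (LINT x|lebesgue. ?d n x) + (LINT x|lebesgue. ?e (\<theta> n) x)" for n
      proof -
        have di: "integrable lebesgue (?d n)"
          by (rule Bochner_Integration.integrable_bound[OF wi dm])
            (use db[of n] in \<open>eventually_elim, auto intro: order_trans\<close>)
        have ei: "integrable lebesgue (?e (\<theta> n))"
        proof (rule Bochner_Integration.integrable_bound)
          show "integrable lebesgue (\<lambda>x. M * (indicator \<Omega> x * (indicator \<Omega> x * gain \<theta>0 v0 x * ?r x)))"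
            using ie by simp
          show "AE x in lebesgue. norm (?e (\<theta> n) x) \<le> norm (M * (indicator \<Omega> x * (indicator \<Omega> x * gain \<theta>0 v0 x * ?r x)))"
            using AEb by eventually_elim (use M0 in \<open>auto simp: abs_mult intro!: mult_right_mono\<close>)
        qed (use ie weight_measurable[OF \<theta>[of n]] in auto)
        have "inner (abs_l2 (\<lambda>x. \<theta> n x * gain (\<theta> n) (v n) x)) \<phi> = (LINT x|lebesgue. \<theta> n x * gain (\<theta> n) (v n) x * ?r x)"
          using inner_abs_l2[OF weight_gain_L2[OF \<theta>[of n], of "v n"] rep_l2_L2[of \<phi>]] by simp
        also have "\<dots> = (LINT x|lebesgue. ?d n x + ?e (\<theta> n) x)"
          using weight_outside[OF \<theta>[of n]]
          by (intro Bochner_Integration.integral_cong refl) (auto simp: indicator_def algebra_simps)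
        also have "\<dots> = (LINT x|lebesgue. ?d n x) + (LINT x|lebesgue. ?e (\<theta> n) x)"
          by (rule Bochner_Integration.integral_add[OF di ei])
        finally show ?thesis .
      qed
      have split0: "inner (abs_l2 (\<lambda>x. \<theta>0 x * gain \<theta>0 v0 x)) \<phi> = (LINT x|(lebesgue::'a measure). 0) + (LINT x|lebesgue. ?e \<theta>0 x)"
      proof -
        have "inner (abs_l2 (\<lambda>x. \<theta>0 x * gain \<theta>0 v0 x)) \<phi> = (LINT x|lebesgue. \<theta>0 x * gain \<theta>0 v0 x * ?r x)"
          using inner_abs_l2[OF weight_gain_L2[OF \<theta>0, of v0] rep_l2_L2[of \<phi>]] by simp
        also have "\<dots> = (LINT x|lebesgue. ?e \<theta>0 x)"
          using weight_outside[OF \<theta>0]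
          by (intro Bochner_Integration.integral_cong refl) (auto simp: indicator_def algebra_simps)
        finally show ?thesis by simp
      qed
      show ?thesis unfolding split split0 by (intro tendsto_add dd ee)
    qed
    \<comment> \<open>In the loss terms the coefficients converge strongly; they are moved onto the test function.\<close>
    have H: "(\<lambda>n. inner (abs_l2 (\<lambda>x. indicator \<Omega> x * loss (\<theta> n) x * rep_l2 (v n) x)) \<phi>)
        \<longlonglongrightarrow> inner (abs_l2 (\<lambda>x. indicator \<Omega> x * loss \<theta>0 x * rep_l2 v0 x)) \<phi>"
    proof -
      define \<psi> where "\<psi> \<eta> = abs_l2 (\<lambda>x. indicator \<Omega> x * loss \<eta> x * ?r x)" for \<eta>
      have move: "inner (abs_l2 (\<lambda>x. indicator \<Omega> x * loss \<eta> x * rep_l2 w x)) \<phi> = inner w (\<psi> \<eta>)"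
        if "weight M \<kappa> \<eta>" for \<eta> w
        using inner_abs_l2[OF loss_L2[OF that rep_l2_L2[of w]] rep_l2_L2[of \<phi>]]
          inner_abs_l2[OF rep_l2_L2[of w] loss_L2[OF that rep_l2_L2[of \<phi>]]]
        by (simp add: \<psi>_def mult_ac)
      have "(\<lambda>n. (norm (\<psi> (\<theta> n) - \<psi> \<theta>0))\<^sup>2) \<longlonglongrightarrow> 0"
      proof -
        let ?f = "\<lambda>n x. (indicator \<Omega> x * loss (\<theta> n) x * ?r x - indicator \<Omega> x * loss \<theta>0 x * ?r x)\<^sup>2"
        have fL: "(\<lambda>x. indicator \<Omega> x * loss (\<theta> n) x * ?r x - indicator \<Omega> x * loss \<theta>0 x * ?r x) \<in> L2 UNIV" for n
          by (rule L2_UNIV_diff[OF loss_L2[OF \<theta> rep_l2_L2] loss_L2[OF \<theta>0 rep_l2_L2]])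
        have "(norm (\<psi> (\<theta> n) - \<psi> \<theta>0))\<^sup>2 = (LINT x|lebesgue. ?f n x)" for n
          unfolding \<psi>_def abs_l2_diff[OF loss_L2[OF \<theta> rep_l2_L2] loss_L2[OF \<theta>0 rep_l2_L2]] norm_abs_l2[OF fL]
          by (simp add: L2_norm_UNIV)
        moreover have "(\<lambda>n. LINT x|lebesgue. ?f n x) \<longlonglongrightarrow> (LINT x|(lebesgue::'a measure). 0)"
        proof (rule integral_dominated_convergence)
          show "integrable lebesgue (\<lambda>x. (2 * (1 + M))\<^sup>2 * (?r x)\<^sup>2)"
            using rep_l2_L2[of \<phi>] by (simp add: L2_UNIV_iff del: rep_l2_L2)
          show "?f n \<in> borel_measurable lebesgue" for n
            using borel_measurable_power[OF conjunct1[OF fL[of n, unfolded L2_UNIV_iff]], of 2] by simp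
          show "AE x in lebesgue. norm (?f n x) \<le> (2 * (1 + M))\<^sup>2 * (?r x)\<^sup>2" for n
          proof (rule AE_I2)
            fix x
            have "\<bar>indicator \<Omega> x * loss (\<theta> n) x - indicator \<Omega> x * loss \<theta>0 x\<bar> \<le> 2 * (1 + M)"
              using order_trans[OF abs_triangle_ineq4 add_mono[OF ind_loss_bound[OF \<theta>[of n], of x] ind_loss_bound[OF \<theta>0, of x]]]
              by simp
            then have "(indicator \<Omega> x * loss (\<theta> n) x - indicator \<Omega> x * loss \<theta>0 x)\<^sup>2 \<le> (2 * (1 + M))\<^sup>2"
              using M0 by (intro abs_le_square_iff[THEN iffD1]) simp
            from mult_right_mono[OF this, of "(?r x)\<^sup>2"] show "norm (?f n x) \<le> (2 * (1 + M))\<^sup>2 * (?r x)\<^sup>2"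
              by (simp add: left_diff_distrib flip: power_mult_distrib)
          qed
          show "AE x in lebesgue. (\<lambda>n. ?f n x) \<longlonglongrightarrow> 0"
          proof (rule AE_I2)
            fix x
            have "(\<lambda>n. ?f n x) \<longlonglongrightarrow> (indicator \<Omega> x * loss \<theta>0 x * ?r x - indicator \<Omega> x * loss \<theta>0 x * ?r x)\<^sup>2"
              by (intro tendsto_intros loss)
            then show "(\<lambda>n. ?f n x) \<longlonglongrightarrow> 0" by simp
          qed
        qed simp
        ultimately show ?thesis by simp
      qed
      then have \<psi>: "(\<lambda>n. norm (\<psi> (\<theta> n) - \<psi> \<theta>0)) \<longlonglongrightarrow> 0"
        using tendsto_real_sqrt[of "\<lambda>n. (norm (\<psi> (\<theta> n) - \<psi> \<theta>0))\<^sup>2" 0] by simp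
      have "(\<lambda>n. inner (v n) (\<psi> (\<theta> n) - \<psi> \<theta>0)) \<longlonglongrightarrow> 0"
      proof (rule Lim_null_comparison)
        show "(\<lambda>n. C * norm (\<psi> (\<theta> n) - \<psi> \<theta>0)) \<longlonglongrightarrow> 0" using \<psi> by (rule tendsto_mult_right_zero)
        show "\<forall>\<^sub>F n in sequentially. norm (inner (v n) (\<psi> (\<theta> n) - \<psi> \<theta>0)) \<le> C * norm (\<psi> (\<theta> n) - \<psi> \<theta>0)"
          using order_trans[OF Cauchy_Schwarz_ineq2 mult_right_mono[OF v norm_ge_zero]]
          by (intro always_eventually allI) simp
      qed
      moreover have "(\<lambda>n. inner (v n) (\<psi> \<theta>0)) \<longlonglongrightarrow> inner v0 (\<psi> \<theta>0)"
        using wv by (simp add: weakly_tendsto_def)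
      ultimately have "(\<lambda>n. inner (v n) (\<psi> (\<theta> n) - \<psi> \<theta>0) + inner (v n) (\<psi> \<theta>0)) \<longlonglongrightarrow> 0 + inner v0 (\<psi> \<theta>0)"
        by (rule tendsto_add)
      then show ?thesis
        unfolding move[OF \<theta>] move[OF \<theta>0] by (simp add: inner_diff_right)
    qed
    show "(\<lambda>n. inner (drift (\<theta> n) (v n)) \<phi>) \<longlonglongrightarrow> inner (drift \<theta>0 v0) \<phi>"
      unfolding drift_def inner_diff_left by (intro tendsto_diff G H)
  qed
qed

end

section \<open>The perforated and the limit equations\<close>

context nonlocal_problem
begin

text \<open>If nonnegative weights converge weakly* to a limit that is bounded below on \<open>\<Omega>\<close>, then the
  masses of balls centred in \<open>\<Omega>\<close> eventually stay away from zero, uniformly in the centre: it suffices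
  to test finitely many balls of half the radius, since each ball of radius \<open>\<delta>\<close> centred in \<open>\<Omega>\<close>
  contains one of them.\<close>

lemma uniform_ball_mass:
  fixes \<theta> :: "'i \<Rightarrow> 'a \<Rightarrow> real"
  assumes conv: "\<And>\<phi>. integrable lebesgue \<phi> \<Longrightarrow>
      ((\<lambda>i. LINT x|lebesgue. \<theta> i x * \<phi> x) \<longlongrightarrow> (LINT x|lebesgue. X x * \<phi> x)) F"
    and \<theta>: "\<forall>\<^sub>F i in F. integrable lebesgue (\<theta> i) \<and> (\<forall>x. \<theta> i x \<ge> 0)"
    and X: "integrable lebesgue X" "\<And>x. x \<in> \<Omega> \<Longrightarrow> X x \<ge> c" "\<And>x. x \<notin> \<Omega> \<Longrightarrow> X x = 0" and c: "c > 0"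
  shows "\<exists>\<kappa>>0. \<forall>\<^sub>F i in F. \<forall>x\<in>\<Omega>. \<kappa> \<le> ball_mass (\<theta> i) x"
proof -
  have "compact (closure \<Omega>)" using bounded_Omega by simp
  then have "\<exists>k. finite k \<and> closure \<Omega> \<subseteq> (\<Union>z\<in>k. ball z (\<delta> / 2))"
    using delta_pos unfolding compact_eq_totally_bounded by simp
  then obtain k where k: "finite k" "closure \<Omega> \<subseteq> (\<Union>z\<in>k. ball z (\<delta> / 2))" by blast
  define K where "K = {z \<in> k. ball z (\<delta> / 2) \<inter> \<Omega> \<noteq> {}}"
  define m where "m z = (LINT x|lebesgue. X x * indicator (ball z (\<delta> / 2)) x)" for z
  have m: "m z > 0" if "z \<in> K" for z
  proof -
    have "ball z (\<delta> / 2) \<inter> \<Omega> \<in> lmeasurable" by (intro fmeasurable_Int_fmeasurable) auto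
    moreover have "\<not> negligible (ball z (\<delta> / 2) \<inter> \<Omega>)"
      using that open_Omega by (intro open_not_negligible) (auto simp: K_def)
    ultimately have pos: "measure lebesgue (ball z (\<delta> / 2) \<inter> \<Omega>) > 0"
      by (metis negligible_iff_measure zero_less_measure_iff measure_nonneg order_le_less)
    have "c * measure lebesgue (ball z (\<delta> / 2) \<inter> \<Omega>) = (LINT x|lebesgue. c * indicator (ball z (\<delta> / 2) \<inter> \<Omega>) x)"
      by simp
    also have "\<dots> \<le> m z"
      unfolding m_def
    proof (rule integral_mono)
      show "integrable lebesgue (\<lambda>x. c * indicat_real (ball z (\<delta> / 2) \<inter> \<Omega>) x)"
        using \<open>ball z (\<delta> / 2) \<inter> \<Omega> \<in> lmeasurable\<close> by (auto simp: lmeasurable_iff_integrable)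
      show "integrable lebesgue (\<lambda>x. X x * indicat_real (ball z (\<delta> / 2)) x)"
        using X(1) by (intro integrable_real_mult_indicator) auto
      show "c * indicat_real (ball z (\<delta> / 2) \<inter> \<Omega>) x \<le> X x * indicat_real (ball z (\<delta> / 2)) x" for x
        using X(2)[of x] X(3)[of x] by (cases "x \<in> \<Omega>") (auto simp: indicator_def)
    qed
    finally show ?thesis using pos c by (smt (verit) mult_pos_pos)
  qed
  define \<kappa> where "\<kappa> = Min (insert 1 (m ` K)) / 2"
  have K: "finite K" using k by (simp add: K_def)
  then have \<kappa>: "\<kappa> > 0" using m by (simp add: \<kappa>_def)
  have "\<forall>\<^sub>F i in F. \<kappa> < (LINT x|lebesgue. \<theta> i x * indicator (ball z (\<delta> / 2)) x)" if z: "z \<in> K" for z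
  proof -
    have "2 * \<kappa> \<le> m z" using K z by (simp add: \<kappa>_def)
    then have "\<kappa> < m z" using \<kappa> by simp
    then show ?thesis
      unfolding m_def
      by (intro order_tendstoD(1)[OF conv]) (auto simp: lmeasurable_iff_integrable[symmetric])
  qed
  then have "\<forall>\<^sub>F i in F. \<forall>z\<in>K. \<kappa> < (LINT x|lebesgue. \<theta> i x * indicator (ball z (\<delta> / 2)) x)"
    using K by (simp add: eventually_ball_finite)
  with \<theta> have "\<forall>\<^sub>F i in F. \<forall>x\<in>\<Omega>. \<kappa> \<le> ball_mass (\<theta> i) x"
  proof eventually_elim
    case (elim i)
    show ?case
    proof
      fix x assume x: "x \<in> \<Omega>"
      then have "x \<in> closure \<Omega>" using closure_subset by blast
      then obtain z where z: "z \<in> k" "x \<in> ball z (\<delta> / 2)" using k by blast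
      then have "z \<in> K" using x by (auto simp: K_def)
      then have "\<kappa> \<le> (LINT x|lebesgue. \<theta> i x * indicator (ball z (\<delta> / 2)) x)" using elim by (auto intro: less_imp_le)
      also have "\<dots> \<le> ball_mass (\<theta> i) x"
        unfolding ball_mass_def set_lebesgue_integral_def
      proof (rule integral_mono)
        show "integrable lebesgue (\<lambda>x. \<theta> i x * indicat_real (ball z (\<delta> / 2)) x)"
          using elim by (intro integrable_real_mult_indicator) auto
        show "integrable lebesgue (\<lambda>y. indicat_real (ball x \<delta>) y *\<^sub>R \<theta> i y)"
          using elim integrable_real_mult_indicator[of "ball x \<delta>" lebesgue "\<theta> i"] by (simp add: mult.commute)
        fix y
        have "y \<in> ball x \<delta>" if "y \<in> ball z (\<delta> / 2)"
          using that z(2) dist_triangle_half_r[of z x \<delta> y] by (simp add: dist_commute)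
        then show "\<theta> i y * indicat_real (ball z (\<delta> / 2)) y \<le> indicat_real (ball x \<delta>) y *\<^sub>R \<theta> i y"
          using elim by (auto simp: indicator_def)
      qed
      finally show "\<kappa> \<le> ball_mass (\<theta> i) x" .
    qed
  qed
  then show ?thesis using \<kappa> by blast
qed

lemma drift_eq_abs:
  assumes "weight M \<kappa> \<theta>"
  shows "drift \<theta> v = abs_l2 (\<lambda>x. \<theta> x * gain \<theta> v x - indicator \<Omega> x * loss \<theta> x * rep_l2 v x)"
    and "(\<lambda>x. \<theta> x * gain \<theta> v x - indicator \<Omega> x * loss \<theta> x * rep_l2 v x) \<in> L2 UNIV"
  unfolding drift_def
  using abs_l2_diff[OF weight_gain_L2[OF assms] loss_L2[OF assms rep_l2_L2]]
    L2_UNIV_diff[OF weight_gain_L2[OF assms] loss_L2[OF assms rep_l2_L2]] by auto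

text \<open>The extension by zero of a solution of the perforated problem solves the differential equation
  whose weight is the characteristic function of the perforated domain.\<close>

lemma perforated_solution_ode:
  assumes E: "open E" "E \<subseteq> \<Omega>" and W: "weight M \<kappa> (indicator E)"
    and sol: "perforated_solution J g \<delta> \<Omega> E u0 u"
  shows "((\<lambda>t. cls E (u t)) has_vector_derivative drift (indicator E) (cls E (u t))) (at t)"
proof -
  have Em: "E \<in> sets lebesgue" using E by auto
  define w where "w x = (LINT y:- (\<Omega> - E)|lebesgue. J (x - y) * u t y)
                 - h_coeff J \<Omega> E x * u t x + g (mean_on \<delta> E x (u t))" for x
  have out: "u t x = 0" if "x \<notin> \<Omega>" for x using sol that by (auto simp: perforated_solution_def)
  have "has_L2_derivative E u w t UNIV"
    using sol by (simp add: perforated_solution_def w_def[abs_def])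
  then have uL: "u t \<in> L2 E" and wL: "w \<in> L2 E"
    and d: "((\<lambda>t. cls E (u t)) has_vector_derivative cls E w) (at t)"
    by (simp_all add: has_L2_derivative_iff[OF Em])
  have cut: "(\<lambda>x. indicator E x * u t x) \<in> L2 UNIV" using uL by (simp add: L2_iff_cut[OF Em])
  have "cls E w = drift (indicator E) (cls E (u t))"
    unfolding drift_eq_abs[OF W] cls_def[of E w]
  proof (subst abs_l2_eq_iff[OF _ drift_eq_abs(2)[OF W]])
    show "(\<lambda>x. indicator E x * w x) \<in> L2 UNIV" using wL by (simp add: L2_iff_cut[OF Em])
    have "AE x in lebesgue. rep_l2 (cls E (u t)) x = indicator E x * u t x"
      unfolding cls_def by (rule rep_abs_l2[OF cut])
    then show "AE x in lebesgue. indicator E x * w x = indicator E x * gain (indicator E) (cls E (u t)) x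
        - indicator \<Omega> x * loss (indicator E) x * rep_l2 (cls E (u t)) x"
    proof eventually_elim
      case (elim x)
      show ?case
      proof (cases "x \<in> E")
        case True
        have "inner (cls E (u t)) (kern x) = (LINT y:- (\<Omega> - E)|lebesgue. J (x - y) * u t y)"
          unfolding cls_def inner_kern[OF cut] set_lebesgue_integral_def
          using E(2) out by (intro Bochner_Integration.integral_cong refl) (auto simp: indicator_def)
        moreover have "inner (cls E (u t)) (ball_ind x) = (LINT y:(ball x \<delta> \<inter> E)|lebesgue. u t y)"
          unfolding cls_def inner_ball_ind[OF cut] set_lebesgue_integral_def
          using E(2) by (intro Bochner_Integration.integral_cong refl) (auto simp: indicator_def)
        moreover have "ball_mass (indicator E) x = measure lebesgue (ball x \<delta> \<inter> E)"
        proof -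
          have "ball_mass (indicator E) x = (LINT y|lebesgue. indicator (ball x \<delta> \<inter> E) y)"
            unfolding ball_mass_def set_lebesgue_integral_def
            by (intro Bochner_Integration.integral_cong refl) (auto simp: indicator_def)
          then show ?thesis by simp
        qed
        moreover have "loss (indicator E) x = h_coeff J \<Omega> E x"
          unfolding loss_def h_coeff_def set_lebesgue_integral_def
          using E(2) by (intro Bochner_Integration.integral_cong refl) (auto simp: indicator_def)
        ultimately show ?thesis
          using True E(2) elim by (auto simp: w_def gain_def mean_on_def)
      qed (use elim in simp)
    qed
  qed
  then show ?thesis using d by simp
qed

lemma lip_const_pos: "weight M \<kappa> \<theta> \<Longrightarrow> lip_const M \<kappa> > 0"
proof -
  assume W: "weight M \<kappa> \<theta>"
  then have "M * (J_sup * Omega_norm + Lg * (Omega_norm / \<kappa>)) * Omega_norm \<ge> 0"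
    using lipschitz_on_nonneg[OF g_lip] J_sup(1) by (simp add: weight_def)
  then show ?thesis using W unfolding lip_const_def by (simp add: weight_def)
qed

lemma cls_rep_drift:
  assumes W: "weight M \<kappa> \<theta>"
  shows "cls \<Omega> (rep_l2 (drift \<theta> v)) = drift \<theta> v"
  unfolding cls_def
proof (subst (2) abs_rep_l2[symmetric], subst abs_l2_eq_iff)
  have "AE x in lebesgue. rep_l2 (drift \<theta> v) x = \<theta> x * gain \<theta> v x - indicator \<Omega> x * loss \<theta> x * rep_l2 v x"
    unfolding drift_eq_abs(1)[OF W] by (rule rep_abs_l2[OF drift_eq_abs(2)[OF W]])
  then show "AE x in lebesgue. indicator \<Omega> x * rep_l2 (drift \<theta> v) x = rep_l2 (drift \<theta> v) x"
    by eventually_elim (use weight_outside[OF W] in \<open>auto simp: indicator_def\<close>)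
qed (simp_all add: L2_UNIV_cut)

text \<open>Solutions that vanish outside \<open>\<Omega>\<close> initially do so at all times.\<close>
lemma drift_solution_supported:
  assumes W: "weight M \<kappa> \<theta>" and U: "\<And>t. (U has_vector_derivative drift \<theta> (U t)) (at t)"
    and U0: "cls \<Omega> (rep_l2 (U 0)) = U 0"
  shows "cls \<Omega> (rep_l2 (U t)) = U t"
proof -
  have "norm ((\<lambda>t. cls \<Omega> (rep_l2 (U t)) - U t) t) \<le> 0 / 1 * exp (1 * \<bar>t\<bar>)"
  proof (rule norm_growth_bound[where D' = "\<lambda>_. 0"])
    fix s
    have "((\<lambda>t. cls \<Omega> (rep_l2 (U t))) has_vector_derivative cls \<Omega> (rep_l2 (drift \<theta> (U s)))) (at s)"
      by (rule bounded_linear.has_vector_derivative[OF bounded_linear_cls_rep U]) simp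
    from has_vector_derivative_diff[OF this U]
    show "((\<lambda>t. cls \<Omega> (rep_l2 (U t)) - U t) has_vector_derivative 0) (at s)"
      by (simp add: cls_rep_drift[OF W])
  qed (use U0 in auto)
  then show ?thesis by simp
qed

text \<open>The right-hand side of the limit equation is the vector field with weight \<open>X\<close>: as \<open>J\<close> has
  integral \<open>1\<close>, the term \<open>- X x * u x\<close> from the difference cancels against the one in \<open>Lambda_coeff\<close>.\<close>
lemma limit_equation_rhs:
  assumes x: "x \<in> \<Omega>"
    and u: "u = (\<lambda>x. indicator \<Omega> x * rep_l2 v x)"
  shows "X x * (LINT y|lebesgue. J (x - y) * (u y - u x)) + X x * g (mean_weighted \<delta> X x u)
      - Lambda_coeff J \<Omega> X x * u x
    = X x * gain X v x - indicator \<Omega> x * loss X x * rep_l2 v x"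
proof -
  have "integrable lebesgue (\<lambda>y. (indicator \<Omega> y * J (x - y)) * rep_l2 v y)"
    by (rule L2_UNIV_mult_integrable[OF ind_J_L2 rep_l2_L2])
  then have i: "integrable lebesgue (\<lambda>y. J (x - y) * u y)"
    by (simp add: u mult_ac)
  have k: "inner v (kern x) = (LINT y|lebesgue. J (x - y) * u y)"
    using inner_kern[OF rep_l2_L2[of v], of x] by (simp add: u)
  have "(LINT y|lebesgue. J (x - y) * (u y - u x)) = (LINT y|lebesgue. J (x - y) * u y - J (x - y) * u x)"
    by (simp add: algebra_simps)
  also have "\<dots> = inner v (kern x) - u x"
    using i by (simp add: k)
  finally have 1: "(LINT y|lebesgue. J (x - y) * (u y - u x)) = inner v (kern x) - u x" .
  have 2: "mean_weighted \<delta> X x u = inner v (ball_ind x) / ball_mass X x"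
    using inner_ball_ind[OF rep_l2_L2[of v], of x] by (simp add: u mean_weighted_def ball_mass_def)
  have 3: "Lambda_coeff J \<Omega> X x = loss X x - X x"
    by (simp add: Lambda_coeff_def loss_def)
  show ?thesis unfolding 1 2 3 gain_def using x by (simp add: u algebra_simps)
qed

lemma Lambda_coeff_Linf:
  assumes W: "weight M \<kappa> X"
  shows "Lambda_coeff J \<Omega> X \<in> Linf UNIV"
proof -
  have eq: "Lambda_coeff J \<Omega> X = (\<lambda>x. loss X x - X x)"
    by (simp add: Lambda_coeff_def loss_def fun_eq_iff)
  have "AE x in lebesgue. \<bar>loss X x - X x\<bar> \<le> 1 + M + M"
    using weight_bound[OF W]
  proof eventually_elim
    case (elim x)
    show ?case
      by (rule order_trans[OF abs_triangle_ineq4 add_mono[OF loss_bound[OF W] elim]])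
  qed
  then show ?thesis
    unfolding Linf_def eq lebesgue_on_UNIV_eq
    using loss_measurable[OF W] weight_measurable[OF W] by auto
qed

end

section \<open>Convergence of the perforated problems\<close>

theorem theorem2p2:
  fixes \<Omega> :: "'a::euclidean_space set"
    and \<Omega>\<epsilon> :: "real \<Rightarrow> 'a set"
    and X J u0 :: "'a \<Rightarrow> real"
    and g :: "real \<Rightarrow> real"
    and c \<delta> :: real
    and u :: "real \<Rightarrow> real \<Rightarrow> 'a \<Rightarrow> real"
  assumes "open \<Omega>" and "connected \<Omega>" and "\<Omega> \<noteq> {}" and "bounded \<Omega>"
    and "\<And>\<epsilon>. \<epsilon> > 0 \<Longrightarrow> open (\<Omega>\<epsilon> \<epsilon>) \<and> \<Omega>\<epsilon> \<epsilon> \<subseteq> \<Omega>"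
    and "X \<in> Linf UNIV"
    and "\<And>x. x \<notin> \<Omega> \<Longrightarrow> X x = 0"
    and "\<And>\<phi> :: 'a \<Rightarrow> real. integrable (lebesgue_on \<Omega>) \<phi> \<Longrightarrow>
           ((\<lambda>\<epsilon>. LINT x|lebesgue_on \<Omega>. indicator (\<Omega>\<epsilon> \<epsilon>) x * \<phi> x)
              \<longlongrightarrow> (LINT x|lebesgue_on \<Omega>. X x * \<phi> x)) (at_right 0)"
    and "c > 0" and "\<And>x. x \<in> \<Omega> \<Longrightarrow> X x \<ge> c"
    and "continuous_on UNIV J" and "\<And>x. J x \<ge> 0" and "J 0 > 0" and "\<And>x. J (- x) = J x"
    and "has_bochner_integral lebesgue J 1"
    and "smooth g" and "\<exists>L. L-lipschitz_on UNIV g"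
    and "\<delta> > 0"
    and "u0 \<in> L2 \<Omega>"
    and "\<And>\<epsilon>. \<epsilon> > 0 \<Longrightarrow> perforated_solution J g \<delta> \<Omega> (\<Omega>\<epsilon> \<epsilon>) u0 (u \<epsilon>)"
  shows "Lambda_coeff J \<Omega> X \<in> Linf UNIV \<and>
    (\<exists>ustar :: real \<Rightarrow> 'a \<Rightarrow> real.
       (\<forall>t. \<forall>x\<in>- \<Omega>. ustar t x = 0) \<and>
       (\<forall>a b. a < b \<longrightarrow> ustar \<in> C1_L2 a b UNIV) \<and>
       (\<forall>a b. a < b \<longrightarrow>
          weak_star_Linf_L2 a b \<Omega>
            (\<lambda>\<epsilon> t x. if x \<in> \<Omega>\<epsilon> \<epsilon> then u \<epsilon> t x else 0) ustar (at_right 0)) \<and>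
       limit_solution J g \<delta> \<Omega> X u0 ustar)"
proof -
  note bdd = assms(4) and Oe = assms(5) and XLinf = assms(6) and Xout = assms(7)
    and Xconv = assms(8) and c = assms(9) and Xc = assms(10) and u0 = assms(19) and sol = assms(20)
  obtain L where L: "L-lipschitz_on UNIV g" using assms(17) by blast
  interpret nonlocal_problem \<Omega> J g L \<delta>
    by unfold_locales (use assms L in auto)
  have Om: "\<Omega> \<in> sets lebesgue" by simp
  obtain M0 where Xm: "X \<in> borel_measurable lebesgue" and M0: "AE x in lebesgue. \<bar>X x\<bar> \<le> M0"
    using XLinf unfolding Linf_def lebesgue_on_UNIV_eq by blast
  \<comment> \<open>The bound \<open>M\<close> also has to serve for characteristic functions.\<close>
  define M where "M = max 1 M0"
  have M: "M \<ge> 1" "AE x in lebesgue. \<bar>X x\<bar> \<le> M"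
    using M0 by (auto simp: M_def elim: eventually_mono)
  have XI: "integrable lebesgue X"
  proof (rule Bochner_Integration.integrable_bound)
    show "integrable lebesgue (\<lambda>x. M * indicator \<Omega> x)"
      using Omega_lmeasurable by (auto simp: lmeasurable_iff_integrable)
    show "AE x in lebesgue. norm (X x) \<le> norm (M * indicator \<Omega> x)"
      using M(2) by eventually_elim (use Xout M(1) in \<open>auto simp: indicator_def\<close>)
  qed (rule Xm)
  \<comment> \<open>The convergence hypothesis, restated with integrals over the whole space.\<close>
  have conv: "((\<lambda>\<epsilon>. LINT x|lebesgue. indicator (\<Omega>\<epsilon> \<epsilon>) x * \<phi> x) \<longlongrightarrow> (LINT x|lebesgue. X x * \<phi> x)) (at_right 0)"
    if \<phi>: "integrable lebesgue \<phi>" for \<phi> :: "'a \<Rightarrow> real"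
  proof -
    have "integrable (lebesgue_on \<Omega>) \<phi>"
      using \<phi> integrable_mult_indicator[OF Om \<phi>] by (simp add: integrable_restrict_space)
    note * = Xconv[OF this]
    have "(LINT x|lebesgue_on \<Omega>. X x * \<phi> x) = (LINT x|lebesgue. X x * \<phi> x)"
      using Xout by (simp add: integral_restrict_space) (auto intro!: Bochner_Integration.integral_cong simp: indicator_def)
    moreover have "(LINT x|lebesgue_on \<Omega>. indicator (\<Omega>\<epsilon> \<epsilon>) x * \<phi> x) = (LINT x|lebesgue. indicator (\<Omega>\<epsilon> \<epsilon>) x * \<phi> x)"
      if "\<epsilon> > 0" for \<epsilon>
      using Oe[OF that] by (simp add: integral_restrict_space) (auto intro!: Bochner_Integration.integral_cong simp: indicator_def)
    then have "\<forall>\<^sub>F \<epsilon> in at_right 0. (LINT x|lebesgue_on \<Omega>. indicator (\<Omega>\<epsilon> \<epsilon>) x * \<phi> x) = (LINT x|lebesgue. indicator (\<Omega>\<epsilon> \<epsilon>) x * \<phi> x)"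
      by (auto simp: eventually_at_filter)
    ultimately show ?thesis using * by (auto simp: tendsto_cong)
  qed
  have Em: "\<Omega>\<epsilon> \<epsilon> \<in> sets lebesgue" "\<Omega>\<epsilon> \<epsilon> \<in> lmeasurable" if "\<epsilon> > 0" for \<epsilon>
    using Oe[OF that] bdd by (auto intro!: lmeasurable_open intro: bounded_subset)
  have "\<exists>\<kappa>>0. \<forall>\<^sub>F \<epsilon> in at_right 0. \<forall>x\<in>\<Omega>. \<kappa> \<le> ball_mass (indicator (\<Omega>\<epsilon> \<epsilon>)) x"
  proof (rule uniform_ball_mass[OF conv _ XI Xc Xout c])
    show "\<forall>\<^sub>F \<epsilon> in at_right 0. integrable lebesgue (indicat_real (\<Omega>\<epsilon> \<epsilon>)) \<and> (\<forall>x. 0 \<le> indicat_real (\<Omega>\<epsilon> \<epsilon>) x)"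
      using Em(2) by (auto simp: eventually_at_filter lmeasurable_iff_integrable)
  qed
  then obtain \<kappa> where \<kappa>: "\<kappa> > 0" and ev: "\<forall>\<^sub>F \<epsilon> in at_right 0. \<forall>x\<in>\<Omega>. \<kappa> \<le> ball_mass (indicator (\<Omega>\<epsilon> \<epsilon>)) x"
    by blast
  then obtain d where d: "d > 0" and mass: "\<And>\<epsilon> x. 0 < \<epsilon> \<Longrightarrow> \<epsilon> < d \<Longrightarrow> x \<in> \<Omega> \<Longrightarrow> \<kappa> \<le> ball_mass (indicator (\<Omega>\<epsilon> \<epsilon>)) x"
    unfolding eventually_at_right_field by blast
  have W: "weight M \<kappa> (indicator (\<Omega>\<epsilon> \<epsilon>))" if "0 < \<epsilon>" "\<epsilon> < d" for \<epsilon>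
    unfolding weight_def
  proof (intro conjI ballI)
    show "indicat_real (\<Omega>\<epsilon> \<epsilon>) \<in> borel_measurable lebesgue"
      using Em(1)[OF that(1)] by (rule borel_measurable_indicator)
    show "AE x in lebesgue. \<bar>indicat_real (\<Omega>\<epsilon> \<epsilon>) x\<bar> \<le> M"
      using M(1) by (auto simp: indicator_def)
  qed (use mass[OF that] Oe[OF that(1)] M(1) \<kappa> in \<open>auto simp: indicator_def\<close>)
  \<comment> \<open>The lower bound passes to the limit, so all weights in question share the bounds \<open>M\<close> and \<open>\<kappa>\<close>.\<close>
  have "\<kappa> \<le> ball_mass X x" if x: "x \<in> \<Omega>" for x
  proof (rule tendsto_lowerbound)
    have "((\<lambda>\<epsilon>. LINT y|lebesgue. indicator (\<Omega>\<epsilon> \<epsilon>) y * indicat_real (ball x \<delta>) y) \<longlongrightarrow> (LINT y|lebesgue. X y * indicator (ball x \<delta>) y)) (at_right 0)"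
      by (rule conv) (simp add: lmeasurable_iff_integrable[symmetric])
    then show "((\<lambda>\<epsilon>. ball_mass (indicator (\<Omega>\<epsilon> \<epsilon>)) x) \<longlongrightarrow> ball_mass X x) (at_right 0)"
      by (simp add: ball_mass_def set_lebesgue_integral_def mult.commute)
    show "\<forall>\<^sub>F \<epsilon> in at_right 0. \<kappa> \<le> ball_mass (indicator (\<Omega>\<epsilon> \<epsilon>)) x"
      using ev by eventually_elim (use x in blast)
  qed simp
  then have WX: "weight M \<kappa> X"
    using Xm M Xout \<kappa> by (auto simp: weight_def)
  let ?Lc = "lip_const M \<kappa>"
  have Lc: "?Lc > 0" by (rule lip_const_pos[OF WX])
  have u0L: "(\<lambda>x. indicator \<Omega> x * u0 x) \<in> L2 UNIV" using u0 by (simp add: L2_iff_cut[OF Om])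
  have "(\<lambda>x. X x * (indicator \<Omega> x * u0 x)) \<in> L2 UNIV"
    by (rule L2_UNIV_mult_bounded[OF u0L Xm M(2)])
  then have Xu0: "(\<lambda>x. X x * u0 x) \<in> L2 \<Omega>" by (simp add: L2_iff_cut[OF Om] mult_ac)
  obtain U where U: "\<And>t. (U has_vector_derivative drift X (U t)) (at t)" and U0: "U 0 = cls \<Omega> (\<lambda>x. X x * u0 x)"
    using lipschitz_ode_solution_exists[OF Lc drift_lipschitz[OF WX]] by metis
  have contU: "continuous_on UNIV U"
    using U by (auto intro!: continuous_at_imp_continuous_on has_vector_derivative_continuous)
  have repU0: "AE x in lebesgue. rep_l2 (U 0) x = indicator \<Omega> x * (X x * u0 x)"
    unfolding U0 by (rule rep_cls[OF Om Xu0])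
  \<comment> \<open>The representative of \<open>U t\<close> is changed on a null set, because \<open>ustar t\<close> has to vanish
    everywhere outside \<open>\<Omega>\<close>. The derivative is represented by \<open>w\<close>.\<close>
  define ustar where "ustar t = (\<lambda>x. indicator \<Omega> x * rep_l2 (U t) x)" for t
  define w where "w t x = X x * gain X (U t) x - indicator \<Omega> x * loss X x * rep_l2 (U t) x" for t x
  have "cls \<Omega> (rep_l2 (U 0)) = U 0"
    unfolding U0 by (rule cls_rep_cls[OF Om Xu0])
  then have supp: "cls \<Omega> (rep_l2 (U t)) = U t" for t
    by (rule drift_solution_supported[OF WX U])
  have usL: "ustar t \<in> L2 UNIV" for t by (simp add: ustar_def L2_UNIV_cut)
  have usU: "cls UNIV (ustar t) = U t" for t
    using supp[of t] by (simp add: cls_def ustar_def)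
  have usLO: "ustar t \<in> L2 \<Omega>" for t
    using usL L2_UNIV_cut[OF Om usL] by (simp add: L2_iff_cut[OF Om])
  have usUO: "cls \<Omega> (ustar t) = U t" for t
  proof -
    have "(\<lambda>x. indicator \<Omega> x * ustar t x) = (\<lambda>x. indicator \<Omega> x * rep_l2 (U t) x)"
      by (auto simp: ustar_def indicator_def)
    then show ?thesis using supp[of t] by (simp add: cls_def)
  qed
  have wL: "w t \<in> L2 UNIV" for t unfolding w_def[abs_def] by (rule drift_eq_abs(2)[OF WX])
  have wU: "cls UNIV (w t) = drift X (U t)" for t
    by (simp add: cls_def w_def[abs_def] drift_eq_abs(1)[OF WX])
  have wcut: "(\<lambda>x. indicator \<Omega> x * w t x) = w t" for t
    using Xout by (auto simp: w_def indicator_def)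
  have wLO: "w t \<in> L2 \<Omega>" for t using wL by (simp add: L2_iff_cut[OF Om] wcut)
  have wUO: "cls \<Omega> (w t) = drift X (U t)" for t
    using wU[of t] by (simp add: cls_def wcut)
  have C1: "ustar \<in> C1_L2 a b UNIV" for a b
    unfolding C1_L2_def
  proof (intro CollectI exI[of _ w] conjI ballI)
    fix t assume t: "t \<in> {a..b}"
    have UN: "UNIV \<in> sets (lebesgue :: 'a measure)" by simp
    show "has_L2_derivative UNIV ustar (w t) t {a..b}"
      unfolding has_L2_derivative_iff[OF UN t] using usL wL has_vector_derivative_at_within[OF U]
      by (auto simp: usU wU)
    have "continuous_on UNIV (\<lambda>t. drift X (U t))"
      by (rule continuous_on_lip[OF Lc drift_lipschitz[OF WX] contU])
    then have "((\<lambda>s. drift X (U s)) \<longlongrightarrow> drift X (U t)) (at t within {a..b})"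
      by (meson continuous_on_def continuous_on_subset t subset_UNIV)
    then have "((\<lambda>s. norm (drift X (U s) - drift X (U t))) \<longlongrightarrow> 0) (at t within {a..b})"
      by (intro tendsto_norm_zero LIM_zero)
    then show "((\<lambda>s. L2_norm UNIV (\<lambda>x. w s x - w t x)) \<longlongrightarrow> 0) (at t within {a..b})"
      by (simp add: L2_norm_cls[OF UN L2_diff[OF UN wL wL]] cls_diff[OF UN wL wL] wU)
  qed
  have lim: "limit_solution J g \<delta> \<Omega> X u0 ustar"
    unfolding limit_solution_def
  proof (intro conjI allI ballI)
    fix t
    let ?w = "\<lambda>x. X x * (LINT y|lebesgue. J (x - y) * (ustar t y - ustar t x))
                 + X x * g (mean_weighted \<delta> X x (ustar t)) - Lambda_coeff J \<Omega> X x * ustar t x"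
    have eq: "(\<lambda>x. indicator \<Omega> x * ?w x) = w t"
    proof
      fix x
      show "indicator \<Omega> x * ?w x = w t x"
        using limit_equation_rhs[where X = X, OF _ ustar_def[of t], of x] Xout[of x]
        by (cases "x \<in> \<Omega>") (simp_all add: w_def)
    qed
    have "?w \<in> L2 \<Omega>" using wL[of t] by (simp add: L2_iff_cut[OF Om] eq)
    moreover have "cls \<Omega> ?w = drift X (U t)"
      using wU[of t] unfolding cls_def eq by simp
    ultimately show "has_L2_derivative \<Omega> ustar ?w t UNIV"
      unfolding has_L2_derivative_iff[OF Om UNIV_I] using usLO U by (simp add: usUO)
    show "ustar t x = 0" if "x \<in> - \<Omega>" for x using that by (simp add: ustar_def)
  next
    show "AE x in lebesgue_on \<Omega>. ustar 0 x = X x * u0 x"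
      using repU0 by (auto simp: AE_restrict_space_iff ustar_def elim!: eventually_mono)
  qed
  let ?ext = "\<lambda>\<epsilon> t x. if x \<in> \<Omega>\<epsilon> \<epsilon> then u \<epsilon> t x else 0"
  have cut_ext: "(\<lambda>x. indicator \<Omega> x * ?ext \<epsilon> t x) = (\<lambda>x. indicator (\<Omega>\<epsilon> \<epsilon>) x * u \<epsilon> t x)" if "\<epsilon> > 0" for \<epsilon> t
    using Oe[OF that] by (auto simp: indicator_def fun_eq_iff)
  have uL: "u \<epsilon> t \<in> L2 (\<Omega>\<epsilon> \<epsilon>)" if "\<epsilon> > 0" for \<epsilon> t
    using sol[OF that] by (auto simp: perforated_solution_def has_L2_derivative_def)
  have extL: "?ext \<epsilon> t \<in> L2 \<Omega>" if "\<epsilon> > 0" for \<epsilon> t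
    using uL[OF that, of t] cut_ext[OF that, of t] by (simp add: L2_iff_cut[OF Om] L2_iff_cut[OF Em(1)[OF that]])
  have ext_cls: "cls \<Omega> (?ext \<epsilon> t) = cls (\<Omega>\<epsilon> \<epsilon>) (u \<epsilon> t)" if "\<epsilon> > 0" for \<epsilon> t
    by (simp add: cls_def cut_ext[OF that])
  have ode: "((\<lambda>t. cls \<Omega> (?ext \<epsilon> t)) has_vector_derivative drift (indicator (\<Omega>\<epsilon> \<epsilon>)) (cls \<Omega> (?ext \<epsilon> t))) (at t)"
    if "0 < \<epsilon>" "\<epsilon> < d" for \<epsilon> t
    unfolding ext_cls[OF that(1)]
    using Oe[OF that(1)] by (intro perforated_solution_ode[OF _ _ W[OF that] sol[OF that(1)]]) auto
  have ext_cont: "continuous_on UNIV (\<lambda>t. cls \<Omega> (?ext \<epsilon> t))" if "0 < \<epsilon>" "\<epsilon> < d" for \<epsilon>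
    using ode[OF that] by (auto intro!: continuous_at_imp_continuous_on has_vector_derivative_continuous)
  have ext0: "cls \<Omega> (?ext \<epsilon> 0) = abs_l2 (\<lambda>x. indicator (\<Omega>\<epsilon> \<epsilon>) x * (indicator \<Omega> x * u0 x))" if "\<epsilon> > 0" for \<epsilon>
  proof -
    have f1: "(\<lambda>x. indicator (\<Omega>\<epsilon> \<epsilon>) x * u \<epsilon> 0 x) \<in> L2 UNIV"
      using uL[OF that] by (simp add: L2_iff_cut[OF Em(1)[OF that]])
    have f2: "(\<lambda>x. indicator (\<Omega>\<epsilon> \<epsilon>) x * (indicator \<Omega> x * u0 x)) \<in> L2 UNIV"
      by (rule L2_UNIV_cut[OF Em(1)[OF that] u0L])
    have "AE x in lebesgue_on (\<Omega>\<epsilon> \<epsilon>). u \<epsilon> 0 x = u0 x"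
      using sol[OF that] by (simp add: perforated_solution_def)
    then have "AE x in lebesgue. x \<in> \<Omega>\<epsilon> \<epsilon> \<longrightarrow> u \<epsilon> 0 x = u0 x"
      using Em(1)[OF that] by (simp add: AE_restrict_space_iff)
    then have ae: "AE x in lebesgue. indicator (\<Omega>\<epsilon> \<epsilon>) x * u \<epsilon> 0 x = indicator (\<Omega>\<epsilon> \<epsilon>) x * (indicator \<Omega> x * u0 x)"
      by eventually_elim (use Oe[OF that] in \<open>auto simp: indicator_def\<close>)
    have "cls \<Omega> (?ext \<epsilon> 0) = abs_l2 (\<lambda>x. indicator (\<Omega>\<epsilon> \<epsilon>) x * u \<epsilon> 0 x)"
      unfolding cls_def[symmetric] by (rule ext_cls[OF that])
    then show ?thesis using ae by (simp only: abs_l2_eq_iff[OF f1 f2])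
  qed
  have ext0_norm: "norm (cls \<Omega> (?ext \<epsilon> 0)) \<le> norm (cls \<Omega> u0)" if "\<epsilon> > 0" for \<epsilon>
  proof -
    have "norm (cls \<Omega> (?ext \<epsilon> 0)) \<le> 1 * norm (cls \<Omega> u0)"
      unfolding ext0[OF that]
    proof (rule norm_l2_dominated)
      show "(\<lambda>x. indicator (\<Omega>\<epsilon> \<epsilon>) x * (indicator \<Omega> x * u0 x)) \<in> borel_measurable lebesgue"
        using L2_UNIV_cut[OF Em(1)[OF that] u0L] by (simp add: L2_UNIV_iff)
      show "AE x in lebesgue. \<bar>indicator (\<Omega>\<epsilon> \<epsilon>) x * (indicator \<Omega> x * u0 x)\<bar> \<le> 1 * \<bar>rep_l2 (cls \<Omega> u0) x\<bar>"
        using rep_cls[OF Om u0] by eventually_elim (auto simp: indicator_def)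
    qed simp
    then show ?thesis by simp
  qed
  have ws: "weak_star_Linf_L2 a b \<Omega> ?ext ustar (at_right 0)" for a b
    unfolding weak_star_Linf_L2_def
  proof (intro conjI ballI)
    show "\<forall>\<^sub>F \<epsilon> in at_right 0. ?ext \<epsilon> \<in> Linf_L2 a b \<Omega>"
      unfolding eventually_at_right_field
      using d by (intro exI[of _ d] conjI allI impI continuous_curve_Linf_L2[OF Om extL ext_cont]) auto
    show "ustar \<in> Linf_L2 a b \<Omega>"
      by (rule continuous_curve_Linf_L2[OF Om usLO]) (simp add: usUO contU)
    fix \<phi> assume \<phi>: "\<phi> \<in> L1_L2 a b \<Omega>"
    \<comment> \<open>Sequences in \<open>{0<..<d}\<close> suffice, and for these the mass bound holds for every index.\<close>
    have at: "at_right 0 = at 0 within {0<..<d}"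
      using d by (intro at_within_nhd[of _ "{-1<..<d}"]) auto
    show "((\<lambda>\<epsilon>. LINT t|lebesgue_on {a..b}. LINT x|lebesgue_on \<Omega>. ?ext \<epsilon> t x * \<phi> t x) \<longlongrightarrow>
        (LINT t|lebesgue_on {a..b}. LINT x|lebesgue_on \<Omega>. ustar t x * \<phi> t x)) (at_right 0)"
      unfolding at tendsto_at_iff_sequentially comp_def
    proof (intro allI impI)
      fix e :: "nat \<Rightarrow> real"
      assume e_in: "\<forall>i. e i \<in> {0<..<d} - {0}" and e0: "e \<longlonglongrightarrow> 0"
      have e: "0 < e n" "e n < d" for n using e_in by auto
      have e_filter: "filterlim e (at_right 0) sequentially"
        unfolding filterlim_at using e0 e by (auto intro!: always_eventually less_imp_neq[symmetric])
      have conv_e: "(\<lambda>n. LINT x|lebesgue. indicator (\<Omega>\<epsilon> (e n)) x * \<psi> x) \<longlonglongrightarrow> (LINT x|lebesgue. X x * \<psi> x)"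
        if "integrable lebesgue \<psi>" for \<psi> :: "'a \<Rightarrow> real"
        by (rule filterlim_compose[OF conv[OF that] e_filter])
      let ?a = "\<lambda>n. cls \<Omega> (?ext (e n) 0)"
      have wa: "weakly_tendsto ?a (U 0)"
        unfolding weakly_tendsto_def
      proof
        fix \<psi> :: "'a l2"
        have i: "integrable lebesgue (\<lambda>x. (indicator \<Omega> x * u0 x) * rep_l2 \<psi> x)"
          by (rule L2_UNIV_mult_integrable[OF u0L rep_l2_L2])
        have "inner (?a n) \<psi> = (LINT x|lebesgue. indicator (\<Omega>\<epsilon> (e n)) x * ((indicator \<Omega> x * u0 x) * rep_l2 \<psi> x))" for n
          unfolding ext0[OF e(1)]
          using inner_abs_l2[OF L2_UNIV_cut[OF Em(1)[OF e(1)] u0L] rep_l2_L2[of \<psi>]] by (simp add: mult_ac)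
        moreover have "inner (U 0) \<psi> = (LINT x|lebesgue. X x * ((indicator \<Omega> x * u0 x) * rep_l2 \<psi> x))"
          using inner_abs_l2[OF _ rep_l2_L2[of \<psi>], of "\<lambda>x. indicator \<Omega> x * (X x * u0 x)"] Xu0
          by (simp add: U0 cls_def L2_iff_cut[OF Om] mult_ac)
        ultimately show "(\<lambda>n. inner (?a n) \<psi>) \<longlonglongrightarrow> inner (U 0) \<psi>"
          using conv_e[OF i] by simp
      qed
      have weak: "weakly_tendsto (\<lambda>n. cls \<Omega> (?ext (e n) t)) (U t)" for t
      proof (rule weak_stability_of_solutions[where F = "\<lambda>n. drift (indicator (\<Omega>\<epsilon> (e n)))" and ?F0.0 = "drift X"
            and a = ?a and ?a0.0 = "U 0" and U = "\<lambda>n t. cls \<Omega> (?ext (e n) t)" and L = ?Lc])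
        show "norm (drift (indicator (\<Omega>\<epsilon> (e n))) 0) \<le> M * \<bar>g 0\<bar> * Omega_norm" for n
          by (rule norm_drift_0[OF W[OF e]])
        show "weakly_tendsto (\<lambda>n. drift (indicator (\<Omega>\<epsilon> (e n))) (v n)) (drift X v0)"
          if "\<And>n. norm (v n) \<le> C" "weakly_tendsto v v0" for v v0 C
          by (rule weakly_tendsto_drift[OF W[OF e] WX conv_e that])
      qed (use Lc drift_lipschitz[OF W[OF e]] drift_lipschitz[OF WX] ext0_norm[OF e(1)] wa ode[OF e] U in auto)
      define R where "R = max \<bar>a\<bar> \<bar>b\<bar>"
      define B1 where "B1 = M * \<bar>g 0\<bar> * Omega_norm + ?Lc * norm (cls \<Omega> u0)"
      have bnd: "norm (cls \<Omega> (?ext (e n) t)) \<le> norm (cls \<Omega> u0) + B1 / ?Lc * exp (2 * ?Lc * R)"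
        if t: "t \<in> {a..b}" for n t
      proof -
        let ?F = "drift (indicator (\<Omega>\<epsilon> (e n)))"
        have "norm (?F (?a n)) \<le> norm (?F 0) + norm (?F (?a n) - ?F 0)" by norm
        also have "norm (?F (?a n) - ?F 0) \<le> ?Lc * norm (cls \<Omega> u0)"
          using order_trans[OF drift_lipschitz[OF W[OF e], of n "?a n" 0] mult_left_mono[of _ _ ?Lc]] ext0_norm[OF e(1), of n] Lc
          by simp
        finally have F: "norm (?F (?a n)) \<le> B1"
          using norm_drift_0[OF W[OF e], of n] by (simp add: B1_def)
        have "B1 \<ge> 0" using F norm_ge_zero order_trans by blast
        have "\<bar>t\<bar> \<le> R" using t by (auto simp: R_def)
        have "norm (cls \<Omega> (?ext (e n) t)) \<le> norm (?a n) + B1 / ?Lc * exp (2 * ?Lc * \<bar>t\<bar>)"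
          by (rule solution_bound[OF Lc drift_lipschitz[OF W[OF e]] ode[OF e] F])
        also have "\<dots> \<le> norm (cls \<Omega> u0) + B1 / ?Lc * exp (2 * ?Lc * R)"
          using \<open>B1 \<ge> 0\<close> \<open>\<bar>t\<bar> \<le> R\<close> Lc by (intro add_mono ext0_norm[OF e(1)] mult_left_mono) auto
        finally show ?thesis .
      qed
      show "(\<lambda>n. LINT t|lebesgue_on {a..b}. LINT x|lebesgue_on \<Omega>. ?ext (e n) t x * \<phi> t x) \<longlonglongrightarrow>
          (LINT t|lebesgue_on {a..b}. LINT x|lebesgue_on \<Omega>. ustar t x * \<phi> t x)"
        by (rule weak_star_from_pointwise_weak[OF Om extL[OF e(1)] ext_cont[OF e] usLO _ _ bnd \<phi>])
          (simp_all only: usUO contU weak)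
    qed
  qed
  show ?thesis
    using Lambda_coeff_Linf[OF WX] C1 ws lim by (intro conjI exI[of _ ustar]) (auto simp: ustar_def)
qed

end
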